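(* Let $r\geq 3$ be an integer. There exists $n_0=n_0(r)$ such that for every $n\geq n_0$ and every $K_r$-minor free graph $G$ on $n$ vertices, \[ s(G)\leq\sqrt{4(r-2)(n-r+2)+(r-3)^2}, \] with equality if and only if $G\cong K_{r-2}\vee(n-r+2)K_1$.
   Context: For a simple graph $G$, $\lambda_1(G)\geq\cdots\geq\lambda_n(G)$ are the eigenvalues of its adjacency matrix and the spread is $s(G)=\lambda_1(G)-\lambda_n(G)$. A graph is $H$-minor free if $H$ cannot be obtained from it by vertex deletions, edge deletions and edge contractions. $G\vee H$ denotes the join (disjoint union plus all edges between the two graphs), $K_m$ is the complete graph and $mK_1$ the edgeless graph on $m$ vertices. *)

theory Defs
  imports "Jordan_Normal_Form.Char_Poly"
begin

definition wf_graph :: "'a set \<Rightarrow> 'a set set \<Rightarrow> bool" where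
  "wf_graph V E \<longleftrightarrow> finite V \<and> (\<forall>e\<in>E. e \<subseteq> V \<and> card e = 2)"

text \<open>minor V' E' V E: the graph (V',E') is obtained from (V,E) by a sequence of
  vertex deletions, edge deletions and edge contractions (contracting the edge {u,v}
  merges v into u, removing loops and parallel edges).\<close>
inductive minor :: "'a set \<Rightarrow> 'a set set \<Rightarrow> 'a set \<Rightarrow> 'a set set \<Rightarrow> bool" where
  refl: "minor V E V E"
| del_vertex: "minor V' E' V E \<Longrightarrow> v \<in> V' \<Longrightarrow> minor (V' - {v}) {e\<in>E'. v \<notin> e} V E"
| del_edge: "minor V' E' V E \<Longrightarrow> e \<in> E' \<Longrightarrow> minor V' (E' - {e}) V E"
| contract: "minor V' E' V E \<Longrightarrow> {u, v} \<in> E' \<Longrightarrow> u \<noteq> v \<Longrightarrow>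
     minor (V' - {v}) ({e\<in>E'. v \<notin> e} \<union> {{u, w} | w. {v, w} \<in> E' \<and> w \<noteq> u}) V E"

definition graph_iso :: "'a set \<Rightarrow> 'a set set \<Rightarrow> 'b set \<Rightarrow> 'b set set \<Rightarrow> bool" where
  "graph_iso V E V' E' \<longleftrightarrow> (\<exists>f. bij_betw f V V' \<and>
     (\<forall>x\<in>V. \<forall>y\<in>V. {x, y} \<in> E \<longleftrightarrow> {f x, f y} \<in> E'))"

definition complete_edges :: "nat \<Rightarrow> nat set set" where
  "complete_edges k = {{i, j} | i j. i < k \<and> j < k \<and> i \<noteq> j}"

definition has_complete_minor :: "nat \<Rightarrow> nat set \<Rightarrow> nat set set \<Rightarrow> bool" where
  "has_complete_minor r V E \<longleftrightarrow>
     (\<exists>V' E'. minor V' E' V E \<and> graph_iso V' E' {0..<r} (complete_edges r))"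

definition join_clique_indep_edges :: "nat \<Rightarrow> nat \<Rightarrow> nat set set" where
  "join_clique_indep_edges k m =
     {{i, j} | i j. i < k + m \<and> j < k + m \<and> i \<noteq> j \<and> (i < k \<or> j < k)}"

definition adj_mat :: "nat \<Rightarrow> nat set set \<Rightarrow> real mat" where
  "adj_mat n E = mat n n (\<lambda>(i, j). if {i, j} \<in> E then 1 else 0)"

definition spread :: "nat \<Rightarrow> nat set set \<Rightarrow> real" where
  "spread n E = Max {x. eigenvalue (adj_mat n E) x} - Min {x. eigenvalue (adj_mat n E) x}"

end

theory Submission
  imports Defs "Jordan_Normal_Form.Spectral_Radius" "HOL-Analysis.Convex"
begin

text \<open>Put \<open>k = r - 2\<close>. The extremal spread is \<open>2 \<sigma>\<close> with \<open>\<sigma>\<^sup>2 = k (n - k) + (k - 1)\<^sup>2 / 4\<close>, so it suffices to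
  find a centre \<open>c\<close> with \<open>\<bar>l - c\<bar> \<le> \<sigma>\<close> for all eigenvalues \<open>l\<close>, strictly unless the graph is the join.

  A graph without \<open>K\<^sub>r\<close>-minor is degenerate (Mader), and no \<open>k + 1\<close> vertices have many common neighbours.
  Hence only boundedly many vertices have linear degree, the others contribute little to the quadratic
  form, and an eigenvalue with \<open>l\<^sup>2 \<ge> k (n - k)\<close> forces \<open>k\<close> vertices \<open>K\<close> to have almost all
  vertices as common neighbours. If there is no such eigenvalue, take \<open>c = 0\<close>.

  Otherwise take for \<open>c\<close> half the average degree of the graph induced on \<open>K\<close>. Expanding the quadratic
  form around vectors that are constant on \<open>K\<close> and on its complement leaves a binary form in the two means.
  Each edge missing between \<open>K\<close> and the rest improves its determinant by more than the few
  edges outside \<open>K\<close> can cost, and inside \<open>K\<close> the gain \<open>(k - 1)\<^sup>2 / 4 - c\<^sup>2\<close> from missing edges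
  exceeds the loss from the variance of the degrees by an inequality of de Caen.\<close>

section \<open>Models of complete minors\<close>

text \<open>One interval of length 2 \<sigma> around the whole spectrum bounds both ends at once, so
  the eigenvectors of the largest and the smallest eigenvalue never have to be compared. The centre
  is read off from the quotient form on the two means: neglecting edges outside \<open>K\<close>,
  its diagonal entries are the average degree 2 c of \<open>K\<close> and 0, and its off-diagonal
  entry is at most sqrt (k (n - k)), so its eigenvalues lie within sqrt (k (n - k) + c^2) of c. For
  the join 2 c = k - 1 and this radius is \<sigma>.

  The obstacle is the order of magnitude of the terms. Edges missing inside \<open>K\<close> leave
  the gain (k - 1)^2 / 4 - c^2 in \<sigma>^2, which does not grow with n, and the loss from
  irregular degrees in \<open>K\<close> has the same order. These two have to be compared with a
  sharp factor, whereas the other errors are paid for by the edges missing between \<open>K\<close>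
  and the rest and may be estimated roughly. This is why one weight is taken almost equal to
  \<sigma> and why a tiny relative slack \<open>h\<close> is carried through the last
  estimates.\<close>

definition nbrs :: "'a set set \<Rightarrow> 'a set \<Rightarrow> 'a \<Rightarrow> 'a set" where
  "nbrs E W v = {u \<in> W. {v, u} \<in> E}"

text \<open>Connectivity is encoded by cuts and not by paths: under a contraction a cut on one side
  translates directly into a cut on the other side, whereas a path would have to be
  rerouted.\<close>

definition connected_in :: "'a set set \<Rightarrow> 'a set \<Rightarrow> bool" where
  "connected_in E B \<longleftrightarrow> B \<noteq> {} \<and>
     (\<forall>X. X \<subset> B \<and> X \<noteq> {} \<longrightarrow> (\<exists>x\<in>X. \<exists>y\<in>B - X. {x, y} \<in> E))"

text \<open>The usual branch sets of a \<open>K_r\<close> minor. Only the vertex set confines them,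
  so passing to an induced subgraph changes \<open>V\<close> and leaves \<open>E\<close>
  alone.\<close>

definition clique_model :: "nat \<Rightarrow> 'a set \<Rightarrow> 'a set set \<Rightarrow> bool" where
  "clique_model r V E \<longleftrightarrow> (\<exists>B :: nat \<Rightarrow> 'a set.
     (\<forall>i<r. B i \<subseteq> V \<and> connected_in E (B i)) \<and>
     (\<forall>i<r. \<forall>j<r. i \<noteq> j \<longrightarrow> B i \<inter> B j = {} \<and> (\<exists>x\<in>B i. \<exists>y\<in>B j. {x, y} \<in> E)))"

definition contract_edges :: "'a set set \<Rightarrow> 'a \<Rightarrow> 'a \<Rightarrow> 'a set set" where
  "contract_edges E u v = {e\<in>E. v \<notin> e} \<union> {{u, w} | w. {v, w} \<in> E \<and> w \<noteq> u}"

lemma contract_edges_iff: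
  assumes "x \<noteq> v" "y \<noteq> v" "{v} \<notin> E"
  shows "{x, y} \<in> contract_edges E u v \<longleftrightarrow>
    {x, y} \<in> E \<or> (x = u \<and> y \<noteq> u \<and> {v, y} \<in> E) \<or> (y = u \<and> x \<noteq> u \<and> {v, x} \<in> E)"
  using assms unfolding contract_edges_def by (auto simp: doubleton_eq_iff)

lemma singleton_notin_contract_edges: "(\<And>x. {x} \<notin> E) \<Longrightarrow> {x} \<notin> contract_edges E u v"
  unfolding contract_edges_def by (auto simp: singleton_insert_inj_eq)

section \<open>Connected branch sets and edge contractions\<close>

lemma connected_in_singleton: "connected_in E {x}"
  unfolding connected_in_def by auto

lemma connected_in_insert:
  assumes "connected_in E B" "x \<in> B" "{x, y} \<in> E"
  shows "connected_in E (insert y B)"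
  unfolding connected_in_def
proof (intro conjI allI impI)
  fix X assume X: "X \<subset> insert y B \<and> X \<noteq> {}"
  show "\<exists>x\<in>X. \<exists>z\<in>insert y B - X. {x, z} \<in> E"
  proof (cases "y \<in> B")
    case True
    then show ?thesis using X assms(1) unfolding connected_in_def by (metis insert_absorb)
  next
    case yB: False
    show ?thesis
    proof (cases "X \<inter> B = {} \<or> B \<subseteq> X")
      case True
      then show ?thesis
      proof
        assume "X \<inter> B = {}"
        then have "X = {y}" using X by auto
        then show ?thesis using assms(2,3) yB by (auto simp: insert_commute)
      next
        assume "B \<subseteq> X"
        then have "X = B" using X by auto
        then show ?thesis using assms(2,3) yB by auto
      qed
    next
      case False
      then have "X \<inter> B \<subset> B \<and> X \<inter> B \<noteq> {}" by auto
      then obtain a b where "a \<in> X \<inter> B" "b \<in> B - X \<inter> B" "{a, b} \<in> E"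
        using assms(1) unfolding connected_in_def by meson
      then show ?thesis by auto
    qed
  qed
qed auto

lemma connected_in_pair: "{x, y} \<in> E \<Longrightarrow> connected_in E {x, y}"
  using connected_in_insert[OF connected_in_singleton[of E x], of x y]
  by (simp add: insert_commute)

lemma clique_model_mono:
  assumes "clique_model r W E" "W \<subseteq> V"
  shows "clique_model r V E"
proof -
  obtain B where B: "\<forall>i<r. B i \<subseteq> W \<and> connected_in E (B i)"
    "\<forall>i<r. \<forall>j<r. i \<noteq> j \<longrightarrow> B i \<inter> B j = {} \<and> (\<exists>x\<in>B i. \<exists>y\<in>B j. {x, y} \<in> E)"
    using assms(1) unfolding clique_model_def by blast
  have "\<forall>i<r. B i \<subseteq> V \<and> connected_in E (B i)" using B(1) assms(2) by blast
  then show ?thesis using B(2) unfolding clique_model_def by blast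
qed

lemma connected_in_contract:
  assumes con: "connected_in E B" and u: "u \<in> B" and v: "v \<in> B" and uv: "u \<noteq> v"
    and loop: "\<And>x. {x} \<notin> E"
  shows "connected_in (contract_edges E u v) (B - {v})"
  unfolding connected_in_def
proof (intro conjI allI impI)
  show "B - {v} \<noteq> {}" using u uv by auto
  fix X assume X: "X \<subset> B - {v} \<and> X \<noteq> {}"
  \<comment> \<open>The cut is lifted to \<open>B\<close> by putting \<open>v\<close> on the side of
    \<open>u\<close>; an edge that crosses the lifted cut at \<open>v\<close> becomes an edge at
    \<open>u\<close>.\<close>
  define X' where "X' = (if u \<in> X then insert v X else X)"
  have "X' \<subset> B \<and> X' \<noteq> {}" using X v unfolding X'_def by auto
  then obtain x y where xy: "x \<in> X'" "y \<in> B - X'" "{x, y} \<in> E"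
    using con unfolding connected_in_def by meson
  have iff: "\<And>x y. x \<noteq> v \<Longrightarrow> y \<noteq> v \<Longrightarrow> {x, y} \<in> contract_edges E u v \<longleftrightarrow>
    {x, y} \<in> E \<or> (x = u \<and> y \<noteq> u \<and> {v, y} \<in> E) \<or> (y = u \<and> x \<noteq> u \<and> {v, x} \<in> E)"
    using contract_edges_iff loop by metis
  show "\<exists>x\<in>X. \<exists>y\<in>B - {v} - X. {x, y} \<in> contract_edges E u v"
  proof (cases "x = v")
    case True
    then have "u \<in> X" using xy X unfolding X'_def by (auto split: if_splits)
    moreover have "y \<in> B - {v} - X" using xy X calculation unfolding X'_def by auto
    moreover have "{u, y} \<in> contract_edges E u v"
      using iff[of u y] True xy calculation uv by auto
    ultimately show ?thesis by blast
  next
    case xv: False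
    then have xX: "x \<in> X" using xy unfolding X'_def by (auto split: if_splits)
    show ?thesis
    proof (cases "y = v")
      case True
      then have uX: "u \<notin> X" using xy unfolding X'_def by auto
      then have "x \<noteq> u" using xX by auto
      then have "{x, u} \<in> contract_edges E u v"
        using iff[of x u] xv uv True xy by (auto simp: insert_commute)
      then show ?thesis using xX uX u uv by auto
    next
      case False
      then have "y \<in> B - {v} - X" using xy unfolding X'_def by (auto split: if_splits)
      then show ?thesis using iff[of x y] xv False xy xX by auto
    qed
  qed
qed

lemma connected_in_contract_outside:
  assumes con: "connected_in E B" and v: "v \<notin> B"
  shows "connected_in (contract_edges E u v) B"
  unfolding connected_in_def
proof (intro conjI allI impI)
  show "B \<noteq> {}" using con unfolding connected_in_def by auto
  fix X assume X: "X \<subset> B \<and> X \<noteq> {}"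
  then obtain x y where xy: "x \<in> X" "y \<in> B - X" "{x, y} \<in> E"
    using con unfolding connected_in_def by meson
  then have "{x, y} \<in> contract_edges E u v" using X v unfolding contract_edges_def by auto
  then show "\<exists>x\<in>X. \<exists>y\<in>B - X. {x, y} \<in> contract_edges E u v" using xy by auto
qed

text \<open>A cut that separates \<open>u\<close> from \<open>v\<close> is crossed by the edge
  between them. Any other cut comes from a cut of \<open>B\<close>, and an edge crossing it after
  the contraction stems from an edge at \<open>u\<close> or at \<open>v\<close>, which lie on the
  same side.\<close>

lemma connected_in_uncontract:
  assumes con: "connected_in (contract_edges E u v) B" and v: "v \<notin> B"
    and uv: "u \<noteq> v" and e: "{u, v} \<in> E" and loop: "\<And>x. {x} \<notin> E"
  shows "connected_in E (if u \<in> B then insert v B else B)"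
proof -
  have iff: "\<And>x y. x \<noteq> v \<Longrightarrow> y \<noteq> v \<Longrightarrow> {x, y} \<in> contract_edges E u v \<longleftrightarrow>
    {x, y} \<in> E \<or> (x = u \<and> y \<noteq> u \<and> {v, y} \<in> E) \<or> (y = u \<and> x \<noteq> u \<and> {v, x} \<in> E)"
    using contract_edges_iff loop by metis
  have ne: "B \<noteq> {}" using con unfolding connected_in_def by auto
  have cut: "\<exists>x\<in>X. \<exists>y\<in>B - X. {x, y} \<in> E \<or> (x = u \<and> {v, y} \<in> E) \<or> (y = u \<and> {x, v} \<in> E)"
    if XB: "X \<subset> B" "X \<noteq> {}" for X
  proof -
    obtain x y where "x \<in> X" "y \<in> B - X" "{x, y} \<in> contract_edges E u v"
      using con XB unfolding connected_in_def by meson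
    moreover have "x \<noteq> v" "y \<noteq> v" using calculation XB v by auto
    ultimately show ?thesis using iff[of x y] insert_commute[of v x "{}"] by metis
  qed
  show ?thesis
  proof (cases "u \<in> B")
    case False
    have "connected_in E B" unfolding connected_in_def
    proof (intro conjI allI impI)
      fix X assume X: "X \<subset> B \<and> X \<noteq> {}"
      then obtain x y where "x \<in> X" "y \<in> B - X"
        "{x, y} \<in> E \<or> (x = u \<and> {v, y} \<in> E) \<or> (y = u \<and> {x, v} \<in> E)" using cut by meson
      then show "\<exists>x\<in>X. \<exists>y\<in>B - X. {x, y} \<in> E" using False X by blast
    qed (rule ne)
    then show ?thesis using False by simp
  next
    case uB: True
    have "connected_in E (insert v B)" unfolding connected_in_def
    proof (intro conjI allI impI)
      fix X assume X: "X \<subset> insert v B \<and> X \<noteq> {}"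
      show "\<exists>x\<in>X. \<exists>y\<in>insert v B - X. {x, y} \<in> E"
      proof (cases "u \<in> X \<longleftrightarrow> v \<in> X")
        case False
        then show ?thesis using e uB insert_commute[of u v "{}"] by (metis DiffI insertCI)
      next
        case same: True
        have "X - {v} \<subset> B" "X - {v} \<noteq> {}" using X same uB uv by auto
        then obtain x y where xy: "x \<in> X - {v}" "y \<in> B - (X - {v})"
          "{x, y} \<in> E \<or> (x = u \<and> {v, y} \<in> E) \<or> (y = u \<and> {x, v} \<in> E)" using cut by meson
        have y: "y \<in> insert v B - X" using xy v by auto
        show ?thesis using xy(3)
        proof (elim disjE conjE)
          assume "{x, y} \<in> E" then show ?thesis using xy y by blast
        next
          assume "x = u" "{v, y} \<in> E" then show ?thesis using xy y same by blast
        next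
          assume a: "y = u" "{x, v} \<in> E"
          then have "v \<in> insert v B - X" using xy y same by auto
          then show ?thesis using xy a by blast
        qed
      qed
    qed auto
    then show ?thesis using uB by simp
  qed
qed

text \<open>The vertex \<open>v\<close> returns to the branch set of \<open>u\<close>, if there is
  one. This lets the induction for Mader's bound run on models of arbitrary edge sets, without
  mentioning \<open>minor\<close>.\<close>

lemma clique_model_uncontract:
  assumes m: "clique_model r (V - {v}) (contract_edges E u v)"
    and uv: "u \<noteq> v" and e: "{u, v} \<in> E" and v: "v \<in> V" and loop: "\<And>x. {x} \<notin> E"
  shows "clique_model r V E"
proof -
  obtain B where B: "\<forall>i<r. B i \<subseteq> V - {v} \<and> connected_in (contract_edges E u v) (B i)"
    and d: "\<forall>i<r. \<forall>j<r. i \<noteq> j \<longrightarrow> B i \<inter> B j = {} \<and>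
       (\<exists>x\<in>B i. \<exists>y\<in>B j. {x, y} \<in> contract_edges E u v)"
    using m unfolding clique_model_def by blast
  define B' where "B' i = (if u \<in> B i then insert v (B i) else B i)" for i
  have vB: "v \<notin> B i" if "i < r" for i using B that by auto
  have iff: "\<And>x y. x \<noteq> v \<Longrightarrow> y \<noteq> v \<Longrightarrow> {x, y} \<in> contract_edges E u v \<longleftrightarrow>
    {x, y} \<in> E \<or> (x = u \<and> y \<noteq> u \<and> {v, y} \<in> E) \<or> (y = u \<and> x \<noteq> u \<and> {v, x} \<in> E)"
    using contract_edges_iff loop by metis
  have "\<forall>i<r. B' i \<subseteq> V \<and> connected_in E (B' i)"
  proof (intro allI impI)
    fix i assume i: "i < r"
    show "B' i \<subseteq> V \<and> connected_in E (B' i)"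
      using connected_in_uncontract[of E u v "B i"] B vB i uv e loop v unfolding B'_def by auto
  qed
  moreover have "B' i \<inter> B' j = {} \<and> (\<exists>x\<in>B' i. \<exists>y\<in>B' j. {x, y} \<in> E)"
    if ij: "i < r" "j < r" "i \<noteq> j" for i j
  proof
    have dij: "B i \<inter> B j = {}" using d ij by blast
    show "B' i \<inter> B' j = {}" using dij vB ij unfolding B'_def by auto
    obtain x y where xy: "x \<in> B i" "y \<in> B j" "{x, y} \<in> contract_edges E u v" using d ij by blast
    have "x \<noteq> v" "y \<noteq> v" using xy vB ij by auto
    with xy iff have "{x, y} \<in> E \<or> (x = u \<and> {v, y} \<in> E) \<or> (y = u \<and> {x, v} \<in> E)"
      by (auto simp: insert_commute)
    then show "\<exists>x\<in>B' i. \<exists>y\<in>B' j. {x, y} \<in> E" using xy unfolding B'_def by auto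
  qed
  ultimately show ?thesis unfolding clique_model_def by blast
qed

lemma wf_graph_no_loop: "wf_graph V E \<Longrightarrow> {x} \<notin> E"
  unfolding wf_graph_def by auto

lemma wf_graph_contract:
  assumes "wf_graph V E" "{u, v} \<in> E" "u \<noteq> v"
  shows "wf_graph (V - {v}) (contract_edges E u v)"
  unfolding wf_graph_def
proof (intro conjI ballI)
  fix e assume "e \<in> contract_edges E u v"
  then consider "e \<in> E" "v \<notin> e" | w where "e = {u, w}" "{v, w} \<in> E" "w \<noteq> u"
    unfolding contract_edges_def by auto
  then have "e \<subseteq> V - {v} \<and> card e = 2"
  proof cases
    case 1
    then show ?thesis using assms unfolding wf_graph_def by auto
  next
    case 2
    have "w \<noteq> v" using 2 wf_graph_no_loop[OF assms(1), of v] by auto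
    then show ?thesis using 2 assms unfolding wf_graph_def by auto
  qed
  then show "e \<subseteq> V - {v}" "card e = 2" by auto
qed (use assms in \<open>simp add: wf_graph_def\<close>)

text \<open>Vertices outside the branch sets are deleted and branch sets with an inner edge are contracted
  along it, until every branch set is a single vertex.\<close>
lemma clique_model_imp_minor:
  assumes "wf_graph V' E'" "minor V' E' V E" "clique_model r V' E'"
  shows "\<exists>V'' E''. minor V'' E'' V E \<and> graph_iso V'' E'' {0..<r} (complete_edges r)"
  using assms
proof (induction "card V'" arbitrary: V' E' rule: less_induct)
  case less
  note wf = less.prems(1)
  have fin: "finite V'" using wf unfolding wf_graph_def by auto
  have loop: "\<And>x. {x} \<notin> E'" using wf wf_graph_no_loop by metis
  obtain B where B: "\<forall>i<r. B i \<subseteq> V' \<and> connected_in E' (B i)"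
    and d: "\<forall>i<r. \<forall>j<r. i \<noteq> j \<longrightarrow> B i \<inter> B j = {} \<and> (\<exists>x\<in>B i. \<exists>y\<in>B j. {x, y} \<in> E')"
    using less.prems(3) unfolding clique_model_def by blast
  show ?case
  proof (cases "\<exists>v\<in>V'. \<forall>i<r. v \<notin> B i")
    case True
    then obtain v where v: "v \<in> V'" "\<forall>i<r. v \<notin> B i" by blast
    let ?E = "{e\<in>E'. v \<notin> e}"
    have "wf_graph (V' - {v}) ?E" using wf unfolding wf_graph_def by auto
    moreover have "minor (V' - {v}) ?E V E" using less.prems(2) v(1) by (rule minor.del_vertex)
    moreover have "clique_model r (V' - {v}) ?E" unfolding clique_model_def
    proof (intro exI[of _ B] conjI allI impI)
      fix i assume i: "i < r"
      show "B i \<subseteq> V' - {v}" using B v i by auto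
      show "connected_in ?E (B i)" unfolding connected_in_def
      proof (intro conjI allI impI)
        show "B i \<noteq> {}" using B i unfolding connected_in_def by auto
        fix X assume X: "X \<subset> B i \<and> X \<noteq> {}"
        then obtain x y where "x \<in> X" "y \<in> B i - X" "{x, y} \<in> E'"
          using B i unfolding connected_in_def by meson
        then show "\<exists>x\<in>X. \<exists>y\<in>B i - X. {x, y} \<in> ?E" using v i X by auto
      qed
    next
      fix i j assume ij: "i < r" "j < r" "i \<noteq> j"
      show "B i \<inter> B j = {}" using d ij by blast
      obtain x y where "x \<in> B i" "y \<in> B j" "{x, y} \<in> E'" using d ij by blast
      then show "\<exists>x\<in>B i. \<exists>y\<in>B j. {x, y} \<in> ?E" using v ij by auto
    qed
    moreover have "card (V' - {v}) < card V'" using fin v by (intro card_Diff1_less)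
    ultimately show ?thesis using less.hyps by blast
  next
    case cover: False
    show ?thesis
    proof (cases "\<exists>i<r. \<exists>u\<in>B i. \<exists>v\<in>B i. u \<noteq> v")
      case True
      then obtain k a b where k: "k < r" "a \<in> B k" "b \<in> B k" "a \<noteq> b" by blast
      \<comment> \<open>The cut \<open>{a}\<close> of the connected set \<open>B k\<close> provides
        an inner edge at \<open>a\<close> to contract.\<close>
      then have "{a} \<subset> B k \<and> {a} \<noteq> {}" by auto
      then obtain v where v: "v \<in> B k" "v \<noteq> a" "{a, v} \<in> E'"
        using B k unfolding connected_in_def by (metis Diff_iff singletonD singletonI)
      let ?E = "contract_edges E' a v"
      have vV: "v \<in> V'" using B k v by auto
      have "wf_graph (V' - {v}) ?E" using wf_graph_contract[OF wf v(3)] v(2) by auto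
      moreover have "minor (V' - {v}) ?E V E"
        unfolding contract_edges_def using less.prems(2) v(3) v(2)[symmetric]
        by (rule minor.contract)
      moreover have "clique_model r (V' - {v}) ?E" unfolding clique_model_def
      proof (intro exI[of _ "\<lambda>i. B i - {v}"] conjI allI impI)
        fix i assume i: "i < r"
        show "B i - {v} \<subseteq> V' - {v}" using B i by auto
        show "connected_in ?E (B i - {v})"
        proof (cases "i = k")
          case True
          then show ?thesis
            using connected_in_contract[of E' "B k" a v] B k v loop by auto
        next
          case False
          then have "v \<notin> B i" using d i k v by blast
          then show ?thesis using connected_in_contract_outside B i by (metis Diff_empty Diff_insert0)
        qed
      next
        fix i j assume ij: "i < r" "j < r" "i \<noteq> j"
        show "(B i - {v}) \<inter> (B j - {v}) = {}" using d ij by blast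
        obtain x y where xy: "x \<in> B i" "y \<in> B j" "{x, y} \<in> E'" using d ij by blast
        have iff: "\<And>x y. x \<noteq> v \<Longrightarrow> y \<noteq> v \<Longrightarrow> {x, y} \<in> ?E \<longleftrightarrow>
          {x, y} \<in> E' \<or> (x = a \<and> y \<noteq> a \<and> {v, y} \<in> E') \<or> (y = a \<and> x \<noteq> a \<and> {v, x} \<in> E')"
          using contract_edges_iff loop by metis
        have only: "l = k" if "l < r" "v \<in> B l \<or> a \<in> B l" for l
          using d that k v by blast
        show "\<exists>x\<in>B i - {v}. \<exists>y\<in>B j - {v}. {x, y} \<in> ?E"
        proof (cases "x = v \<or> y = v")
          case False
          then show ?thesis using iff xy by blast
        next
          case True
          then show ?thesis
          proof
            assume x: "x = v"
            then have "i = k" using only xy ij by blast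
            then have "y \<noteq> v" "y \<noteq> a" using only xy ij by blast+
            then have "{a, y} \<in> ?E" using iff[of a y] v x xy by auto
            then show ?thesis using \<open>i = k\<close> k v xy \<open>y \<noteq> v\<close> by auto
          next
            assume y: "y = v"
            then have "j = k" using only xy ij by blast
            then have "x \<noteq> v" "x \<noteq> a" using only xy ij by blast+
            then have "{x, a} \<in> ?E" using iff[of x a] v y xy by (auto simp: insert_commute)
            then show ?thesis using \<open>j = k\<close> k v xy \<open>x \<noteq> v\<close> by auto
          qed
        qed
      qed
      moreover have "card (V' - {v}) < card V'" using fin vV by (intro card_Diff1_less)
      ultimately show ?thesis using less.hyps by blast
    next
      case sing: False
      define g where "g i = (SOME x. x \<in> B i)" for i
      have g: "B i = {g i}" if "i < r" for i
      proof -
        have "B i \<noteq> {}" using B that unfolding connected_in_def by auto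
        then have "g i \<in> B i" unfolding g_def by (simp add: some_in_eq)
        then show ?thesis using sing that by auto
      qed
      have inj: "inj_on g {0..<r}"
      proof (rule inj_onI)
        fix i j assume ij: "i \<in> {0..<r}" "j \<in> {0..<r}" "g i = g j"
        then have "B i \<inter> B j \<noteq> {}" using g by auto
        then show "i = j" using d ij by (meson atLeastLessThan_iff)
      qed
      have img: "g ` {0..<r} = V'"
      proof
        show "g ` {0..<r} \<subseteq> V'" using B g by auto
        show "V' \<subseteq> g ` {0..<r}" using cover g by force
      qed
      have edge: "{g i, g j} \<in> E' \<longleftrightarrow> i \<noteq> j" if "i < r" "j < r" for i j
      proof
        assume "{g i, g j} \<in> E'" then show "i \<noteq> j" using loop by auto
      next
        assume "i \<noteq> j"
        then show "{g i, g j} \<in> E'" using d g that by (metis singletonD)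
      qed
      define f where "f = the_inv_into {0..<r} g"
      have f: "bij_betw f V' {0..<r}" unfolding f_def
        using inj img by (intro bij_betw_the_inv_into) (simp add: bij_betw_def)
      have fg: "f (g i) = i" if "i < r" for i
        unfolding f_def using inj that by (simp add: the_inv_into_f_f)
      have "{x, y} \<in> E' \<longleftrightarrow> {f x, f y} \<in> complete_edges r" if xy: "x \<in> V'" "y \<in> V'" for x y
      proof -
        have "x \<in> g ` {0..<r}" "y \<in> g ` {0..<r}" using xy img by simp_all
        then obtain i j where ij: "i < r" "j < r" "x = g i" "y = g j" by (elim imageE) simp
        have "{i, j} \<in> complete_edges r \<longleftrightarrow> i \<noteq> j"
          unfolding complete_edges_def using ij by (auto simp: doubleton_eq_iff)
        then show ?thesis using edge ij fg by simp
      qed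
      then have "graph_iso V' E' {0..<r} (complete_edges r)"
        unfolding graph_iso_def using f by blast
      then show ?thesis using less.prems(2) by blast
    qed
  qed
qed

lemma has_complete_minor_of_clique_model:
  assumes "wf_graph V E" "clique_model r V E"
  shows "has_complete_minor r V E"
  unfolding has_complete_minor_def
  using clique_model_imp_minor[OF assms(1) minor.refl assms(2)] .

section \<open>Many edges force a complete minor\<close>

lemma card_arcs:
  assumes "finite W"
  shows "card (Sigma W (nbrs E W)) = (\<Sum>v\<in>W. card (nbrs E W v))"
  using assms by (intro card_SigmaI) (auto simp: nbrs_def)

text \<open>A contraction destroys the edge itself and, for every common neighbour, one of two edges
  that become parallel. Arcs are ordered pairs, hence the factor 2.\<close>

lemma card_arcs_contract:
  assumes fin: "finite V" and uv: "u \<noteq> v" "u \<in> V" "v \<in> V" "{u, v} \<in> E" and loop: "\<And>x. {x} \<notin> E"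
  shows "card (Sigma V (nbrs E V)) \<le>
    card (Sigma (V - {v}) (nbrs (contract_edges E u v) (V - {v}))) +
      2 * (card (nbrs E V u \<inter> nbrs E V v) + 1)"
proof -
  let ?N = "nbrs E V v" and ?M = "nbrs E V u \<inter> nbrs E V v"
  \<comment> \<open>The neighbours that \<open>u\<close> gains from \<open>v\<close>; their arcs
    reappear at \<open>u\<close>.\<close>
  define X where "X = ?N - {u} - nbrs E V u"
  define A where "A = {(x, y). x \<in> V - {v} \<and> y \<in> V - {v} \<and> {x, y} \<in> E}"
  have finN: "finite ?N" using fin unfolding nbrs_def by auto
  have finX: "finite X" using finN unfolding X_def by auto
  have finA: "finite A" by (rule finite_subset[of _ "V \<times> V"]) (auto simp: A_def fin)
  have Sub: "Sigma V (nbrs E V) \<subseteq> A \<union> Pair v ` ?N \<union> (\<lambda>y. (y, v)) ` ?N"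
    unfolding A_def nbrs_def by (auto simp: insert_commute)
  have "card (Sigma V (nbrs E V)) \<le> card (A \<union> Pair v ` ?N \<union> (\<lambda>y. (y, v)) ` ?N)"
    using Sub finA finN by (intro card_mono) auto
  also have "\<dots> \<le> card A + card (Pair v ` ?N) + card ((\<lambda>y. (y, v)) ` ?N)"
    by (meson add_le_mono1 card_Un_le le_trans)
  also have "\<dots> \<le> card A + card ?N + card ?N"
    using finN by (intro add_mono card_image_le) auto
  finally have 1: "card (Sigma V (nbrs E V)) \<le> card A + 2 * card ?N" by simp
  have "?N \<subseteq> insert u (?M \<union> X)" unfolding X_def by auto
  then have "card ?N \<le> card (insert u (?M \<union> X))" using finN finX by (intro card_mono) auto
  also have "\<dots> \<le> 1 + (card ?M + card X)"
    using card_Un_le[of ?M X] finN finX by (simp add: card_insert_if)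
  finally have 2: "card ?N \<le> 1 + card ?M + card X" by simp
  let ?S = "Sigma (V - {v}) (nbrs (contract_edges E u v) (V - {v}))"
  have vX: "v \<notin> X" using loop unfolding X_def nbrs_def by auto
  have "A \<union> (Pair u ` X \<union> (\<lambda>y. (y, u)) ` X) \<subseteq> ?S"
  proof (intro Un_least subsetI)
    fix p assume "p \<in> A"
    then show "p \<in> ?S" unfolding A_def nbrs_def contract_edges_def by auto
  next
    fix p assume "p \<in> Pair u ` X"
    then obtain x where x: "p = (u, x)" "x \<in> X" by auto
    then have "{u, x} \<in> contract_edges E u v" unfolding contract_edges_def X_def nbrs_def by auto
    then show "p \<in> ?S" using x uv vX unfolding X_def nbrs_def by auto
  next
    fix p assume "p \<in> (\<lambda>y. (y, u)) ` X"
    then obtain x where x: "p = (x, u)" "x \<in> X" by auto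
    then have "{u, x} \<in> contract_edges E u v" unfolding contract_edges_def X_def nbrs_def by auto
    then show "p \<in> ?S" using x uv vX unfolding X_def nbrs_def by (auto simp: insert_commute)
  qed
  moreover have "finite ?S" using fin unfolding nbrs_def by auto
  ultimately have "card (A \<union> (Pair u ` X \<union> (\<lambda>y. (y, u)) ` X)) \<le> card ?S" by (rule card_mono[rotated])
  moreover have "card (A \<union> (Pair u ` X \<union> (\<lambda>y. (y, u)) ` X)) = card A + card (Pair u ` X \<union> (\<lambda>y. (y, u)) ` X)"
    using finA finX by (intro card_Un_disjoint) (auto simp: A_def X_def nbrs_def insert_commute)
  moreover have "card (Pair u ` X \<union> (\<lambda>y. (y, u)) ` X) = card (Pair u ` X) + card ((\<lambda>y. (y, u)) ` X)"
    using finX by (intro card_Un_disjoint) (auto simp: X_def)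
  moreover have "card (Pair u ` X) = card X" "card ((\<lambda>y. (y, u)) ` X) = card X"
    by (auto intro!: card_image inj_onI)
  ultimately have 3: "card A + 2 * card X \<le> card ?S" by simp
  have "a \<le> f + 2 * (d + 1)" if "a \<le> b + 2 * c" "c \<le> 1 + d + e" "b + 2 * e \<le> f"
    for a b c d e f :: nat using that by presburger
  from this[OF 1 2 3] show ?thesis .
qed

text \<open>Mader's bound, proved by contracting an edge with few common neighbours; if there is none,
  induct on \<open>r\<close> inside a neighbourhood.\<close>
lemma clique_model_of_many_arcs:
  assumes "finite V" "V \<noteq> {}" "\<And>x. {x} \<notin> E" "2 ^ (r + 1) * card V \<le> card (Sigma V (nbrs E V))"
  shows "clique_model r V E"
  using assms
proof (induction r arbitrary: V E)
  case 0
  then show ?case unfolding clique_model_def by auto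
next
  case (Suc r)
  note outer = Suc.IH
  from Suc.prems show ?case
  proof (induction "card V" arbitrary: V E rule: less_induct)
    case less
    note fin = less.prems(1) and loop = less.prems(3)
    show ?case
    \<comment> \<open>The threshold serves both cases. Below it a contraction costs at most
      \<open>2 ^ (r + 2)\<close> arcs, the share of the one vertex that disappears. Above it every
      neighbourhood has minimum degree at least \<open>2 ^ (r + 1)\<close>, which is the arc density
      required for \<open>r\<close>.\<close>
    proof (cases "\<exists>u\<in>V. \<exists>v\<in>V. {u, v} \<in> E \<and> card (nbrs E V u \<inter> nbrs E V v) < 2 ^ (r + 1)")
      case True
      then obtain u v where uv: "u \<in> V" "v \<in> V" "{u, v} \<in> E"
        and few: "card (nbrs E V u \<inter> nbrs E V v) + 1 \<le> 2 ^ (r + 1)" by auto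
      have ne: "u \<noteq> v" using uv loop by auto
      have "2 ^ (Suc r + 1) * card V \<le> card (Sigma (V - {v}) (nbrs (contract_edges E u v) (V - {v})))
          + 2 * (card (nbrs E V u \<inter> nbrs E V v) + 1)"
        using less.prems(4) card_arcs_contract[OF fin ne uv loop] by linarith
      moreover have "card V = card (V - {v}) + 1" using fin uv
        by (metis Suc_eq_plus1 card_Suc_Diff1)
      ultimately have "2 ^ (Suc r + 1) * card (V - {v}) \<le>
          card (Sigma (V - {v}) (nbrs (contract_edges E u v) (V - {v})))"
        using few by (simp add: algebra_simps)
      moreover have "V - {v} \<noteq> {}" using ne uv by auto
      moreover have "card (V - {v}) < card V" using fin uv by (intro card_Diff1_less)
      ultimately have "clique_model (Suc r) (V - {v}) (contract_edges E u v)"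
        using less.hyps[of "V - {v}" "contract_edges E u v"] fin
          singleton_notin_contract_edges[OF loop] by blast
      then show ?thesis using clique_model_uncontract[OF _ ne uv(3,2) loop] by blast
    next
      case many: False
      have "Sigma V (nbrs E V) \<noteq> {}"
      proof
        assume "Sigma V (nbrs E V) = {}"
        then have "card V = 0" using less.prems(4) by (metis card.empty le_zero_eq mult_eq_0_iff
              power_not_zero zero_neq_numeral)
        then show False using less.prems(1,2) by auto
      qed
      then obtain v w0 where v: "v \<in> V" "w0 \<in> nbrs E V v" by blast
      let ?W = "nbrs E V v"
      have WV: "?W \<subseteq> V" unfolding nbrs_def by auto
      have finW: "finite ?W" using fin WV finite_subset by blast
      have deg: "2 ^ (r + 1) \<le> card (nbrs E ?W w)" if "w \<in> ?W" for w
      proof -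
        have "nbrs E V v \<inter> nbrs E V w = nbrs E ?W w" unfolding nbrs_def by auto
        moreover have "w \<in> V" "{v, w} \<in> E" using that unfolding nbrs_def by auto
        ultimately show ?thesis using many v by (metis not_le_imp_less)
      qed
      have "2 ^ (r + 1) * card ?W = (\<Sum>w\<in>?W. 2 ^ (r + 1))" by simp
      also have "\<dots> \<le> (\<Sum>w\<in>?W. card (nbrs E ?W w))" using deg by (intro sum_mono)
      finally have "2 ^ (r + 1) * card ?W \<le> card (Sigma ?W (nbrs E ?W))"
        using card_arcs[OF finW, of E] by simp
      then have "clique_model r ?W E" using outer[OF finW _ loop] v by blast
      then obtain B where B: "\<forall>i<r. B i \<subseteq> ?W \<and> connected_in E (B i)"
        and d: "\<forall>i<r. \<forall>j<r. i \<noteq> j \<longrightarrow> B i \<inter> B j = {} \<and> (\<exists>x\<in>B i. \<exists>y\<in>B j. {x, y} \<in> E)"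
        unfolding clique_model_def by blast
      have vW: "v \<notin> ?W" using loop unfolding nbrs_def by auto
      have vB: "v \<notin> B i \<and> (\<exists>x\<in>B i. {v, x} \<in> E)" if "i < r" for i
      proof -
        have "B i \<subseteq> ?W" "B i \<noteq> {}" using B that unfolding connected_in_def by auto
        then show ?thesis using vW unfolding nbrs_def by auto
      qed
      show ?thesis unfolding clique_model_def
      \<comment> \<open>All branch sets of the smaller model lie in the neighbourhood of
        \<open>v\<close>, so \<open>{v}\<close> is adjacent to each of them.\<close>
      proof (intro exI[of _ "B(r := {v})"] conjI allI impI)
        fix i assume "i < Suc r"
        then show "(B(r := {v})) i \<subseteq> V" "connected_in E ((B(r := {v})) i)"
          using B WV v connected_in_singleton by (auto simp: less_Suc_eq)
      next
        fix i j assume ij: "i < Suc r" "j < Suc r" "i \<noteq> j"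
        then consider "i < r" "j < r" | "i = r" "j < r" | "i < r" "j = r" by linarith
        then have "(B(r := {v})) i \<inter> (B(r := {v})) j = {} \<and>
          (\<exists>x\<in>(B(r := {v})) i. \<exists>y\<in>(B(r := {v})) j. {x, y} \<in> E)"
        proof cases
          case 1 then show ?thesis using d ij by simp
        next
          case 2 then show ?thesis using vB[of j] by simp
        next
          case 3 then show ?thesis using vB[of i] by (auto simp: insert_commute)
        qed
        then show "(B(r := {v})) i \<inter> (B(r := {v})) j = {}"
          "\<exists>x\<in>(B(r := {v})) i. \<exists>y\<in>(B(r := {v})) j. {x, y} \<in> E" by auto
      qed
    qed
  qed
qed

section \<open>Structural consequences of excluding a complete minor\<close>

lemma exists_low_degree_vertex:
  assumes wf: "wf_graph V E" and nm: "\<not> has_complete_minor r V E" and W: "W \<subseteq> V" "W \<noteq> {}"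
  shows "\<exists>v\<in>W. card (nbrs E W v) \<le> 2 ^ (r + 1)"
proof (rule ccontr)
  assume "\<not> ?thesis"
  then have big: "\<forall>v\<in>W. 2 ^ (r + 1) \<le> card (nbrs E W v)" by (auto simp: not_le)
  have finW: "finite W" using wf W finite_subset unfolding wf_graph_def by blast
  have "2 ^ (r + 1) * card W = (\<Sum>w\<in>W. 2 ^ (r + 1))" by simp
  also have "\<dots> \<le> (\<Sum>w\<in>W. card (nbrs E W w))" using big by (intro sum_mono) auto
  finally have "2 ^ (r + 1) * card W \<le> card (Sigma W (nbrs E W))"
    using card_arcs[OF finW, of E] by simp
  then have "clique_model r W E"
    using clique_model_of_many_arcs[OF finW W(2)] wf_graph_no_loop[OF wf] by blast
  then have "clique_model r V E" using W(1) clique_model_mono by blast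
  then show False using nm has_complete_minor_of_clique_model[OF wf] by blast
qed

text \<open>Matching the vertices of \<open>K\<close> with common neighbours makes \<open>K\<close> a clique of branch sets.\<close>
lemma clique_model_of_common_nbrs:
  assumes fin: "finite V" and K: "K \<subseteq> V" "card K = k" and C: "C \<subseteq> V - K"
    and adj: "\<And>a c. a \<in> K \<Longrightarrow> c \<in> C \<Longrightarrow> {a, c} \<in> E"
    and S: "connected_in E S" "connected_in E S'" "S \<subseteq> V - K" "S' \<subseteq> V - K" "S \<inter> S' = {}"
      "S \<inter> C \<noteq> {}" "S' \<inter> C \<noteq> {}" "\<exists>x\<in>S. \<exists>y\<in>S'. {x, y} \<in> E"
    and big: "k \<le> card (C - S - S')"
  shows "clique_model (k + 2) V E"
proof -
  have finK: "finite K" using K(1) fin by (rule finite_subset)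
  have "C - S - S' \<subseteq> V" using C by blast
  then have finC: "finite (C - S - S')" using fin by (rule finite_subset)
  obtain a where a: "bij_betw a {0..<k} K"
    using ex_bij_betw_nat_finite[OF finK] K(2) by blast
  obtain M where M: "M \<subseteq> C - S - S'" "card M = k" using big by (meson obtain_subset_with_card_n)
  have "finite M" using M(1) finC by (rule finite_subset)
  then obtain b where b: "bij_betw b {0..<k} M" using ex_bij_betw_nat_finite M(2) by blast
  have aK: "a i \<in> K" if "i < k" for i using bij_betwE[OF a] that by simp
  have bM: "b i \<in> C" "b i \<notin> S" "b i \<notin> S'" if i: "i < k" for i
  proof -
    have "b i \<in> M" using bij_betwE[OF b] i by simp
    then show "b i \<in> C" "b i \<notin> S" "b i \<notin> S'" using M(1) by blast+
  qed
  have ainj: "a i = a j \<longleftrightarrow> i = j" if "i < k" "j < k" for i j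
    using inj_on_eq_iff[OF bij_betw_imp_inj_on[OF a]] that by simp
  have binj: "b i = b j \<longleftrightarrow> i = j" if "i < k" "j < k" for i j
    using inj_on_eq_iff[OF bij_betw_imp_inj_on[OF b]] that by simp
  \<comment> \<open>Two pairs are joined by the edge from \<open>a i\<close> to \<open>b j\<close>,
    and a pair is joined to \<open>S\<close> and to \<open>S'\<close> because both of these meet
    \<open>C\<close>. So \<open>S\<close> and \<open>S'\<close> supply the two branch sets beyond
    the \<open>k\<close> pairs.\<close>
  define B where "B i = (if i < k then {a i, b i} else if i = k then S else S')" for i
  have KC: "x \<notin> C" if "x \<in> K" for x using C that by auto
  show ?thesis unfolding clique_model_def
  proof (intro exI[of _ B] conjI allI impI)
    fix i assume "i < k + 2"
    then consider "i < k" | "i = k" | "i = k + 1" by linarith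
    then have "B i \<subseteq> V \<and> connected_in E (B i)"
    proof cases
      case 1
      have "connected_in E {a i, b i}" using adj aK[OF 1] bM(1)[OF 1] by (intro connected_in_pair)
      then show ?thesis using 1 aK[OF 1] bM(1)[OF 1] K C unfolding B_def by auto
    qed (use S in \<open>auto simp: B_def\<close>)
    then show "B i \<subseteq> V" "connected_in E (B i)" by auto
  next
    have S_adj: "\<exists>x\<in>S. {a i, x} \<in> E" "\<exists>x\<in>S'. {a i, x} \<in> E" if "i < k" for i
      using S adj aK[OF that] by blast+
    fix i j assume ij: "i < k + 2" "j < k + 2" "i \<noteq> j"
    have main: "B i \<inter> B j = {} \<and> (\<exists>x\<in>B i. \<exists>y\<in>B j. {x, y} \<in> E)"
      if lt: "i < j" "j < k + 2" for i j
    proof -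
      consider "j < k" | "i < k" "j = k" | "i < k" "j = k + 1" | "i = k" "j = k + 1"
        using lt by linarith
      then show ?thesis
      proof cases
        case 1
        then have ik: "i < k" using lt by simp
        have "a i \<noteq> b j" "b i \<noteq> a j" using KC aK bM 1 ik by metis+
        then show ?thesis using 1 ik lt ainj binj adj aK bM unfolding B_def by auto
      next
        case 2
        have "a i \<notin> S" using S aK 2 by auto
        then show ?thesis using 2 S_adj bM unfolding B_def by auto
      next
        case 3
        have "a i \<notin> S'" using S aK 3 by auto
        then show ?thesis using 3 S_adj bM unfolding B_def by auto
      next
        case 4
        then show ?thesis using S unfolding B_def by auto
      qed
    qed
    show "B i \<inter> B j = {}"
      using main[of i j] main[of j i] ij by (metis Int_commute linorder_neqE_nat)
    show "\<exists>x\<in>B i. \<exists>y\<in>B j. {x, y} \<in> E"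
      using main[of i j] main[of j i] ij by (metis insert_commute linorder_neqE_nat)
  qed
qed

text \<open>Two adjacent common neighbours would be the two extra branch sets; the bound
  \<open>k + 2\<close> leaves \<open>k\<close> further ones for the matching.\<close>

lemma common_nbrs_independent:
  assumes wf: "wf_graph V E" and nm: "\<not> has_complete_minor (k + 2) V E"
    and K: "K \<subseteq> V" "card K = k" and C: "C \<subseteq> V - K"
    and adj: "\<And>a c. a \<in> K \<Longrightarrow> c \<in> C \<Longrightarrow> {a, c} \<in> E"
    and big: "k + 2 \<le> card C" and c: "c \<in> C" "c' \<in> C"
  shows "{c, c'} \<notin> E"
proof
  assume e: "{c, c'} \<in> E"
  then have ne: "c \<noteq> c'" using wf_graph_no_loop[OF wf] by auto
  have fin: "finite V" using wf unfolding wf_graph_def by auto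
  have "C \<subseteq> V" using C by blast
  then have "finite C" using fin by (rule finite_subset)
  then have "k \<le> card (C - {c} - {c'})" using big c ne by (simp add: card_Diff_singleton)
  then have "clique_model (k + 2) V E"
    using c C e ne connected_in_singleton
    by (intro clique_model_of_common_nbrs[OF fin K C adj, where S = "{c}" and S' = "{c'}"]) auto
  then show False using nm has_complete_minor_of_clique_model[OF wf] by blast
qed

text \<open>If \<open>v\<close> had two neighbours \<open>c\<close> and \<open>c'\<close> in
  \<open>C\<close>, then \<open>{c, v}\<close> and \<open>{c'}\<close> would be adjacent branch
  sets, both meeting \<open>C\<close>.\<close>

lemma common_nbrs_at_most_one:
  assumes wf: "wf_graph V E" and nm: "\<not> has_complete_minor (k + 2) V E"
    and K: "K \<subseteq> V" "card K = k" and C: "C \<subseteq> V - K"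
    and adj: "\<And>a c. a \<in> K \<Longrightarrow> c \<in> C \<Longrightarrow> {a, c} \<in> E"
    and big: "k + 2 \<le> card C" and v: "v \<in> V - K" "v \<notin> C"
  shows "card (nbrs E C v) \<le> 1"
proof (rule ccontr)
  assume not: "\<not> ?thesis"
  have fin: "finite V" using wf unfolding wf_graph_def by auto
  have "C \<subseteq> V" using C by blast
  then have finC: "finite C" using fin by (rule finite_subset)
  then have "finite (nbrs E C v)" unfolding nbrs_def by auto
  then have "\<not> (\<forall>x\<in>nbrs E C v. \<forall>y\<in>nbrs E C v. x = y)"
    using not card_le_Suc0_iff_eq[of "nbrs E C v"] by simp
  then obtain c c' where cc: "c \<in> nbrs E C v" "c' \<in> nbrs E C v" "c \<noteq> c'" by blast
  then have c: "c \<in> C" "c' \<in> C" "{c, v} \<in> E" "{v, c'} \<in> E"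
    unfolding nbrs_def by (simp_all add: insert_commute)
  have "C - {c, v} - {c'} = C - {c} - {c'}" using v by auto
  then have "k \<le> card (C - {c, v} - {c'})" using big c cc(3) finC by (simp add: card_Diff_singleton)
  then have "clique_model (k + 2) V E"
    using c C v cc(3) connected_in_singleton connected_in_pair[OF c(3)]
    by (intro clique_model_of_common_nbrs[OF fin K C adj, where S = "{c, v}" and S' = "{c'}"]) auto
  then show False using nm has_complete_minor_of_clique_model[OF wf] by blast
qed

section \<open>Quadratic forms of degenerate graphs\<close>

lemma sum_squared_le_card: "finite A \<Longrightarrow> (\<Sum>i\<in>A. x i)\<^sup>2 \<le> real (card A) * (\<Sum>i\<in>A. (x i :: real)\<^sup>2)"
  using Cauchy_Schwarz_ineq_sum[of "\<lambda>_. 1" x A] by simp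

lemma two_mult_le_weighted:
  fixes x y s :: real assumes "s > 0" shows "2 * \<bar>x * y\<bar> \<le> s * x\<^sup>2 + y\<^sup>2 / s"
proof -
  have "0 \<le> (s * \<bar>x\<bar> - \<bar>y\<bar>)\<^sup>2 / s" using assms by simp
  also have "\<dots> = s * x\<^sup>2 + y\<^sup>2 / s - 2 * \<bar>x * y\<bar>"
    using assms by (simp add: power2_diff field_simps power2_eq_square abs_mult)
  finally show ?thesis by simp
qed

text \<open>Adjacency is a real 0-1 weight, so that row sums are degrees and enter quadratic forms
  directly. The pointwise axioms hold for all arguments, which saves membership conditions.
  Degeneracy is required for every \<open>W\<close>, because vertices are peeled off one at a
  time.\<close>

locale degenerate_graph =
  fixes V :: "'a set" and a :: "'a \<Rightarrow> 'a \<Rightarrow> real" and D :: real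
  assumes fin: "finite V"
    and sym: "a i j = a j i"
    and diag: "a i i = 0"
    and zero_one: "a i j = 0 \<or> a i j = 1"
    and degenerate: "W \<subseteq> V \<Longrightarrow> W \<noteq> {} \<Longrightarrow> \<exists>v\<in>W. (\<Sum>u\<in>W. a v u) \<le> D"
begin

lemma nonneg: "0 \<le> a i j" and le_one: "a i j \<le> 1" and square: "(a i j)\<^sup>2 = a i j"
  using zero_one[of i j] by auto

lemma finite_sub: "W \<subseteq> V \<Longrightarrow> finite W"
  using fin finite_subset by auto

text \<open>Remove a vertex \<open>v\<close> of degree at most \<open>D\<close> and split each of
  its cross terms as \<open>\<theta> * (x v)\<^sup>2 + (x j)\<^sup>2 / \<theta>\<close>. Every
  vertex pays \<open>\<theta> * D\<close> once, when it is removed, and \<open>1 / \<theta>\<close>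
  for each neighbour that is removed before it.\<close>

lemma form_le_weighted:
  fixes x :: "'a \<Rightarrow> real"
  assumes "W \<subseteq> V" "\<theta> > 0"
  shows "(\<Sum>i\<in>W. \<Sum>j\<in>W. a i j * (\<bar>x i\<bar> * \<bar>x j\<bar>)) \<le>
    (\<Sum>i\<in>W. (\<theta> * D + (\<Sum>j\<in>W. a i j) / \<theta>) * (x i)\<^sup>2)"
  using assms(1)
proof (induction "card W" arbitrary: W rule: less_induct)
  case less
  show ?case
  proof (cases "W = {}")
    case False
    then obtain v where v: "v \<in> W" "(\<Sum>u\<in>W. a v u) \<le> D" using degenerate less.prems by blast
    let ?W = "W - {v}"
    have finW: "finite W" using less.prems finite_sub by auto
    have fin': "finite ?W" using finW by auto
    have split: "sum f W = f v + sum f ?W" for f :: "'a \<Rightarrow> real"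
      using finW v(1) by (simp add: sum.remove)
    have IH: "(\<Sum>i\<in>?W. \<Sum>j\<in>?W. a i j * (\<bar>x i\<bar> * \<bar>x j\<bar>)) \<le>
      (\<Sum>i\<in>?W. (\<theta> * D + (\<Sum>j\<in>?W. a i j) / \<theta>) * (x i)\<^sup>2)"
      using less.prems finW v by (intro less.hyps card_Diff1_less) auto
    have d: "(\<Sum>j\<in>?W. a v j) \<le> D" using v split[of "a v"] diag by simp
    have "(\<Sum>i\<in>W. \<Sum>j\<in>W. a i j * (\<bar>x i\<bar> * \<bar>x j\<bar>)) =
      (\<Sum>j\<in>?W. a v j * (2 * \<bar>x v * x j\<bar>)) + (\<Sum>i\<in>?W. \<Sum>j\<in>?W. a i j * (\<bar>x i\<bar> * \<bar>x j\<bar>))"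
      unfolding split diag
      by (simp add: sum.distrib sym[of _ v] abs_mult sum_distrib_left mult_ac)
    also have "(\<Sum>j\<in>?W. a v j * (2 * \<bar>x v * x j\<bar>)) \<le>
        (\<Sum>j\<in>?W. a v j * (\<theta> * (x v)\<^sup>2 + (x j)\<^sup>2 / \<theta>))"
      using two_mult_le_weighted[OF assms(2)] nonneg by (intro sum_mono mult_left_mono) auto
    also have "\<dots> = (\<Sum>j\<in>?W. a v j) * (\<theta> * (x v)\<^sup>2) + (\<Sum>j\<in>?W. a v j * ((x j)\<^sup>2 / \<theta>))"
      by (simp add: sum.distrib distrib_left sum_distrib_right)
    also have "(\<Sum>j\<in>?W. a v j) * (\<theta> * (x v)\<^sup>2) \<le> D * (\<theta> * (x v)\<^sup>2)"
      using d assms(2) by (intro mult_right_mono) auto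
    also note IH
    also have "D * (\<theta> * (x v)\<^sup>2) + (\<Sum>j\<in>?W. a v j * ((x j)\<^sup>2 / \<theta>)) +
      (\<Sum>i\<in>?W. (\<theta> * D + (\<Sum>j\<in>?W. a i j) / \<theta>) * (x i)\<^sup>2) =
      \<theta> * D * (x v)\<^sup>2 + (\<Sum>i\<in>?W. (\<theta> * D + (\<Sum>j\<in>W. a i j) / \<theta>) * (x i)\<^sup>2)"
      unfolding split using sym[of _ v]
      by (simp add: sum.distrib algebra_simps add_divide_distrib)
    also have "\<dots> \<le> (\<Sum>i\<in>W. (\<theta> * D + (\<Sum>j\<in>W. a i j) / \<theta>) * (x i)\<^sup>2)"
    proof -
      have "0 \<le> (\<Sum>j\<in>W. a v j) / \<theta> * (x v)\<^sup>2" using nonneg assms(2) by (simp add: sum_nonneg)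
      then show ?thesis by (subst split[of "\<lambda>i. (\<theta> * D + (\<Sum>j\<in>W. a i j) / \<theta>) * (x i)\<^sup>2"]) (simp add: algebra_simps)
    qed
    finally show ?thesis by simp
  qed simp
qed

text \<open>With \<theta> of order sqrt \<Delta> the factor has order sqrt \<Delta> for fixed
  \<open>D\<close>, much less than the trivial bound \<Delta>. This is what makes the low-degree
  part of the graph negligible.\<close>

lemma form_le_of_max_degree:
  fixes x :: "'a \<Rightarrow> real"
  assumes "W \<subseteq> V" "\<theta> > 0" "\<And>i. i \<in> W \<Longrightarrow> (\<Sum>j\<in>W. a i j) \<le> \<Delta>"
  shows "\<bar>\<Sum>i\<in>W. \<Sum>j\<in>W. a i j * (x i * x j)\<bar> \<le> (\<theta> * D + \<Delta> / \<theta>) * (\<Sum>i\<in>W. (x i)\<^sup>2)"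
proof -
  have "\<bar>\<Sum>i\<in>W. \<Sum>j\<in>W. a i j * (x i * x j)\<bar> \<le> (\<Sum>i\<in>W. \<Sum>j\<in>W. \<bar>a i j * (x i * x j)\<bar>)"
    by (intro order_trans[OF sum_abs] sum_mono sum_abs)
  also have "\<dots> = (\<Sum>i\<in>W. \<Sum>j\<in>W. a i j * (\<bar>x i\<bar> * \<bar>x j\<bar>))" using nonneg by (simp add: abs_mult)
  also have "\<dots> \<le> (\<Sum>i\<in>W. (\<theta> * D + (\<Sum>j\<in>W. a i j) / \<theta>) * (x i)\<^sup>2)"
    using form_le_weighted assms by blast
  also have "\<dots> \<le> (\<Sum>i\<in>W. (\<theta> * D + \<Delta> / \<theta>) * (x i)\<^sup>2)"
    using assms by (intro sum_mono mult_right_mono add_left_mono divide_right_mono) auto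
  finally show ?thesis by (simp add: sum_distrib_left)
qed

text \<open>For the constant vector and \<theta> = 2 the right side contains half of the left side,
  which is absorbed.\<close>

lemma total_degree_le:
  assumes "W \<subseteq> V" shows "(\<Sum>i\<in>W. \<Sum>j\<in>W. a i j) \<le> 4 * D * card W"
proof -
  have "(\<Sum>i\<in>W. \<Sum>j\<in>W. a i j) \<le> (\<Sum>i\<in>W. 2 * D + (\<Sum>j\<in>W. a i j) / 2)"
    using form_le_weighted[OF assms, of 2 "\<lambda>_. 1"] by simp
  also have "\<dots> = 2 * D * card W + (\<Sum>i\<in>W. \<Sum>j\<in>W. a i j) / 2"
    by (simp add: sum.distrib sum_divide_distrib)
  finally show ?thesis by simp
qed

end

section \<open>Stability of large eigenvalues\<close>

text \<open>By Cauchy-Schwarz a sum over at most \<open>k - 1\<close> entries has square at most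
  \<open>(k - 1) * X\<close>, far below the hypothesis; this gives the cardinality. It also forces
  nearly all the mass of \<open>x\<close> onto \<open>T\<close>, so an element of \<open>S\<close>
  outside \<open>T\<close> would carry a negligible entry, and the remaining \<open>k - 1\<close>
  elements of \<open>S\<close> could not reach the required value.\<close>

lemma concentrated_sets_eq:
  fixes x :: "'a \<Rightarrow> real"
  assumes H: "finite H" "S \<subseteq> H" "T \<subseteq> H" and k: "k \<ge> 1" "card S \<le> k" "card T \<le> k"
    and X: "X = (\<Sum>i\<in>H. (x i)\<^sup>2)" "X > 0"
    and S: "real k * X - X / 8 \<le> (\<Sum>i\<in>S. x i)\<^sup>2" and T: "real k * X - X / 8 \<le> (\<Sum>i\<in>T. x i)\<^sup>2"
  shows "S = T \<and> card S = k"
proof -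
  have sub: "(\<Sum>i\<in>A. (x i)\<^sup>2) \<le> X" if "A \<subseteq> H" for A
    unfolding X using H(1) that by (intro sum_mono2) auto
  have finA: "finite A" if "A \<subseteq> H" for A using H(1) that finite_subset by auto
  have CS: "(\<Sum>i\<in>A. x i)\<^sup>2 \<le> real m * (\<Sum>i\<in>A. (x i)\<^sup>2)" if "A \<subseteq> H" "card A \<le> m" for A m
  proof -
    have "(\<Sum>i\<in>A. x i)\<^sup>2 \<le> real (card A) * (\<Sum>i\<in>A. (x i)\<^sup>2)"
      using sum_squared_le_card finA that by blast
    also have "\<dots> \<le> real m * (\<Sum>i\<in>A. (x i)\<^sup>2)"
      using that by (intro mult_right_mono) (auto simp: sum_nonneg)
    finally show ?thesis .
  qed
  have cardk: "card A = k" if A: "A \<subseteq> H" "card A \<le> k" "real k * X - X / 8 \<le> (\<Sum>i\<in>A. x i)\<^sup>2" for A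
  proof (rule ccontr)
    assume "card A \<noteq> k"
    then have "card A \<le> k - 1" using A(2) by simp
    then have "(\<Sum>i\<in>A. x i)\<^sup>2 \<le> real (k - 1) * (\<Sum>i\<in>A. (x i)\<^sup>2)" using CS A(1) by blast
    also have "\<dots> \<le> real (k - 1) * X" using sub A(1) by (intro mult_left_mono) auto
    also have "\<dots> = real k * X - X" using k by (simp add: of_nat_diff algebra_simps)
    finally show False using A(3) X(2) by linarith
  qed
  have cS: "card S = k" "card T = k" using cardk H k S T by auto
  have "S = T"
  proof (rule ccontr)
    assume "S \<noteq> T"
    then have "\<not> S \<subseteq> T" using cS finA H by (metis card_subset_eq)
    then obtain s where s: "s \<in> S" "s \<notin> T" by blast
    have kpos: "real k > 0" using k by simp
    have "real k * X - X / 8 \<le> real k * (\<Sum>i\<in>T. (x i)\<^sup>2)" using T CS[OF H(3)] cS by force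
    moreover have "(\<Sum>i\<in>T. (x i)\<^sup>2) + (x s)\<^sup>2 \<le> X"
      using sub[of "insert s T"] s H finA[OF H(3)] by auto
    then have "real k * ((\<Sum>i\<in>T. (x i)\<^sup>2) + (x s)\<^sup>2) \<le> real k * X"
      using kpos by (intro mult_left_mono) auto
    ultimately have xs: "real k * (x s)\<^sup>2 \<le> X / 8" by (simp add: algebra_simps)
    define z where "z = (\<Sum>i\<in>S - {s}. x i)"
    have "card (S - {s}) \<le> k - 1" using s cS finA[OF H(2)] by simp
    then have "z\<^sup>2 \<le> real (k - 1) * (\<Sum>i\<in>S - {s}. (x i)\<^sup>2)" unfolding z_def using CS H(2) by blast
    also have "\<dots> \<le> real (k - 1) * X" using sub[of "S - {s}"] H(2) by (intro mult_left_mono) auto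
    finally have z: "z\<^sup>2 \<le> (real k - 1) * X" using k by (simp add: of_nat_diff)
    have "(\<Sum>i\<in>S. x i) = x s + z" unfolding z_def using s finA[OF H(2)] by (simp add: sum.remove)
    then have "(\<Sum>i\<in>S. x i)\<^sup>2 = (x s)\<^sup>2 + z\<^sup>2 + 2 * (x s * z)" by (simp add: power2_sum)
    \<comment> \<open>With weight \<open>2 * k\<close> the first new term is at most
      \<open>X / 4\<close> and the second at most \<open>X / 2 - X / (2 * k)\<close>. Together with
      \<open>(k - 1) * X\<close> for \<open>z\<^sup>2\<close> this stays below
      \<open>k * X - X / 8\<close>.\<close>
    also have "\<dots> \<le> (x s)\<^sup>2 + z\<^sup>2 + (2 * real k * (x s)\<^sup>2 + z\<^sup>2 / (2 * real k))"
      using two_mult_le_weighted[of "2 * real k" "x s" z] kpos by linarith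
    finally have 1: "real k * X - X / 8 \<le> (x s)\<^sup>2 + z\<^sup>2 + (2 * real k * (x s)\<^sup>2 + z\<^sup>2 / (2 * real k))"
      using S by linarith
    have "z\<^sup>2 / (2 * real k) \<le> ((real k - 1) * X) / (2 * real k)"
      using z kpos by (intro divide_right_mono) auto
    also have "\<dots> = X / 2 - X / (2 * real k)" using kpos by (simp add: field_simps)
    finally have 2: "z\<^sup>2 / (2 * real k) \<le> X / 2 - X / (2 * real k)" .
    have "(x s)\<^sup>2 \<le> X / (8 * real k)" using xs kpos by (simp add: field_simps)
    also have "\<dots> \<le> X / (2 * real k)" using kpos X(2) by (simp add: field_simps)
    finally have 3: "(x s)\<^sup>2 \<le> X / (2 * real k)" .
    show False using 1 2 3 z xs X(2) by (simp add: algebra_simps)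
  qed
  then show ?thesis using cS by simp
qed

text \<open>Here \<open>X\<close> is the mass of a unit eigenvector on the high-degree vertices,
  \<open>b\<close> the number of vertices falling short of the optimum, and \<open>g\<close>,
  \<open>h\<close> are error terms. The weight \<open>s = q / 2\<close> lowers the part of the bound
  that does not involve \<open>X\<close>, so \<open>X\<close> cannot be small. At
  \<open>s = q\<close> the main terms add up to exactly \<open>q\<close>, so the deficit caused by
  \<open>b\<close> has to fit into the error.\<close>

lemma stability_numeric:
  fixes q X Y g h b c l :: real
  assumes q: "q > 0" and X: "0 \<le> X" "X \<le> 1" and b: "0 \<le> b" and h: "0 \<le> h"
    and cg: "0 \<le> c + g"
    and l: "q - c \<le> l" and upper: "\<And>s. s > 0 \<Longrightarrow> l \<le> g + s * (1 - X) + Y / s"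
    and Y: "Y \<le> q\<^sup>2 * X - X * b / 8 + h * X"
    and small: "g + c \<le> q / 8" "h \<le> q\<^sup>2 / 2"
  shows "X \<ge> 1 / 8" "b \<le> 64 * q * (c + g) + 8 * h"
proof -
  have "h * X \<le> q\<^sup>2 / 2 * X" using small X by (intro mult_right_mono)
  moreover have "0 \<le> X * b / 8" using X b by simp
  ultimately have "Y \<le> 3 / 2 * q\<^sup>2 * X" using Y by linarith
  then have "Y / (q / 2) \<le> (3 / 2 * q\<^sup>2 * X) / (q / 2)" using q by (intro divide_right_mono) auto
  also have "\<dots> = 3 * q * X" using q by (simp add: power2_eq_square)
  finally have "l \<le> g + q / 2 * (1 - X) + 3 * q * X" using upper[of "q / 2"] q by linarith
  also have "\<dots> \<le> g + q / 2 + 3 * q * X" using q X by (simp add: algebra_simps)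
  finally have "q * (3 / 8) \<le> q * (3 * X)" using l small by (simp add: algebra_simps)
  then show X8: "X \<ge> 1 / 8" using q by (simp add: mult_le_cancel_left_pos)
  have "Y / q \<le> (q\<^sup>2 * X - X * b / 8 + h * X) / q" using Y q by (intro divide_right_mono) auto
  also have "\<dots> = q * X - (X * b / 8) / q + h * X / q"
    using q by (simp add: power2_eq_square diff_divide_distrib add_divide_distrib)
  finally have "l \<le> g + q * (1 - X) + (q * X - (X * b / 8) / q + h * X / q)"
    using upper[of q] q by linarith
  then have "(X * b / 8) / q \<le> (c + g) + h * X / q" using l by (simp add: algebra_simps)
  then have "(X * b / 8) / q * q \<le> ((c + g) + h * X / q) * q" using q by (intro mult_right_mono) auto
  then have 1: "X * b \<le> 8 * (q * (c + g)) + X * (8 * h)" using q by (simp add: algebra_simps)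
  have "0 \<le> X * b" using X b by simp
  show "b \<le> 64 * q * (c + g) + 8 * h"
  proof (rule ccontr)
    assume "\<not> ?thesis"
    then have lt: "64 * q * (c + g) < b - 8 * h" by simp
    moreover have "0 \<le> 64 * q * (c + g)" using q cg by simp
    ultimately have "1 / 8 * (b - 8 * h) \<le> X * (b - 8 * h)" using X8 by (intro mult_right_mono) auto
    then show False using 1 lt by (simp add: algebra_simps)
  qed
qed

context degenerate_graph
begin

lemma few_high_degree:
  fixes \<epsilon> :: real
  assumes "\<epsilon> > 0" "V \<noteq> {}"
  shows "card {v\<in>V. \<epsilon> * card V \<le> (\<Sum>u\<in>V. a v u)} \<le> 4 * D / \<epsilon>"
proof -
  let ?H = "{v\<in>V. \<epsilon> * card V \<le> (\<Sum>u\<in>V. a v u)}"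
  have n: "real (card V) > 0" using assms(2) fin by (simp add: card_gt_0_iff)
  have "card ?H * (\<epsilon> * card V) = (\<Sum>v\<in>?H. \<epsilon> * card V)" by simp
  also have "\<dots> \<le> (\<Sum>v\<in>?H. \<Sum>u\<in>V. a v u)" by (intro sum_mono) auto
  also have "\<dots> \<le> (\<Sum>v\<in>V. \<Sum>u\<in>V. a v u)"
    using fin by (intro sum_mono2) (auto simp: nonneg sum_nonneg)
  also have "\<dots> \<le> 4 * D * card V" using total_degree_le by blast
  finally have "(card ?H * \<epsilon>) * card V \<le> 4 * D * card V" by (simp add: mult_ac)
  then have "card ?H * \<epsilon> \<le> 4 * D" using n by (simp add: mult_le_cancel_right)
  then show ?thesis using assms(1) by (simp add: field_simps)
qed

text \<open>A vertex with more than \<open>k\<close> neighbours in \<open>H\<close> is a common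
  neighbour of some subset of \<open>H\<close> of size \<open>k + 1\<close>; there are at most
  \<open>2 ^ card H\<close> such subsets.\<close>

lemma few_exceptional:
  assumes H: "H \<subseteq> V"
    and common: "\<And>S. S \<subseteq> V \<Longrightarrow> card S = k + 1 \<Longrightarrow> card {v\<in>V - S. \<forall>i\<in>S. a i v = 1} \<le> m"
  shows "card {v\<in>V - H. k < card {i\<in>H. a v i = 1}} \<le> 2 ^ card H * m"
proof -
  let ?P = "{S. S \<subseteq> H \<and> card S = k + 1}"
  have finH: "finite H" using H finite_sub by auto
  have "{v\<in>V - H. k < card {i\<in>H. a v i = 1}} \<subseteq> (\<Union>S\<in>?P. {v\<in>V - S. \<forall>i\<in>S. a i v = 1})"
  proof
    fix v assume v: "v \<in> {v\<in>V - H. k < card {i\<in>H. a v i = 1}}"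
    then have "k + 1 \<le> card {i\<in>H. a v i = 1}" by auto
    then obtain S where S: "S \<subseteq> {i\<in>H. a v i = 1}" "card S = k + 1"
      by (meson obtain_subset_with_card_n)
    then have "S \<in> ?P" "v \<in> {v\<in>V - S. \<forall>i\<in>S. a i v = 1}" using v sym by auto
    then show "v \<in> (\<Union>S\<in>?P. {v\<in>V - S. \<forall>i\<in>S. a i v = 1})" by blast
  qed
  moreover have "finite ?P" using finH by simp
  moreover have "finite (\<Union>S\<in>?P. {v\<in>V - S. \<forall>i\<in>S. a i v = 1})"
    by (rule finite_subset[OF _ fin]) auto
  ultimately have "card {v\<in>V - H. k < card {i\<in>H. a v i = 1}} \<le>
      (\<Sum>S\<in>?P. card {v\<in>V - S. \<forall>i\<in>S. a i v = 1})"
    by (intro order_trans[OF card_mono card_UN_le])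
  also have "\<dots> \<le> (\<Sum>S\<in>?P. m)" using common H by (intro sum_mono) auto
  also have "\<dots> = card ?P * m" by simp
  also have "card ?P \<le> card (Pow H)" using finH by (intro card_mono) auto
  finally show ?thesis using finH by (simp add: card_Pow)
qed

text \<open>Inside \<open>H\<close> the form is at most the size of \<open>H\<close>, and among
  low-degree vertices degeneracy controls it. Only the mixed part can reach the order of sqrt n, so
  it alone keeps a free weight \<open>s\<close>.\<close>

lemma eigenvalue_le_split:
  fixes x :: "'a \<Rightarrow> real"
  assumes H: "H \<subseteq> V" and eig: "\<And>i. i \<in> V \<Longrightarrow> (\<Sum>j\<in>V. a i j * x j) = l * x i"
    and unit: "(\<Sum>i\<in>V. (x i)\<^sup>2) = 1"
    and low: "\<And>i. i \<in> V - H \<Longrightarrow> (\<Sum>j\<in>V. a i j) \<le> \<Delta>" and \<Delta>: "\<Delta> \<ge> 0" and \<theta>: "\<theta> > 0" and s: "s > 0"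
  shows "\<bar>l\<bar> \<le> card H + (\<theta> * D + \<Delta> / \<theta>) + s * (1 - (\<Sum>i\<in>H. (x i)\<^sup>2)) +
    (\<Sum>v\<in>V - H. (\<Sum>i\<in>H. a v i * x i)\<^sup>2) / s"
proof -
  let ?L = "V - H"
  let ?q = "\<lambda>i j. a i j * (x i * x j)"
  have split: "(\<Sum>i\<in>V. f i) = (\<Sum>i\<in>H. f i) + (\<Sum>i\<in>?L. f i)" for f :: "'a \<Rightarrow> real"
    using sum.subset_diff[OF H fin, of f] by simp
  have X: "(\<Sum>i\<in>H. (x i)\<^sup>2) + (\<Sum>i\<in>?L. (x i)\<^sup>2) = 1" using unit split[of "\<lambda>i. (x i)\<^sup>2"] by simp
  have L0: "0 \<le> (\<Sum>i\<in>?L. (x i)\<^sup>2)" "0 \<le> (\<Sum>i\<in>H. (x i)\<^sup>2)" by (simp_all add: sum_nonneg)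
  have comm: "?q i j = ?q j i" for i j by (simp add: sym[of i j] mult.commute[of "x i"])
  have "l = (\<Sum>i\<in>V. x i * (l * x i))"
    using unit by (simp add: sum_distrib_left[symmetric] mult.left_commute power2_eq_square)
  also have "\<dots> = (\<Sum>i\<in>V. x i * (\<Sum>j\<in>V. a i j * x j))" using eig by simp
  also have "\<dots> = (\<Sum>i\<in>V. \<Sum>j\<in>V. ?q i j)" by (simp add: sum_distrib_left mult_ac)
  also have "\<dots> = (\<Sum>i\<in>H. \<Sum>j\<in>H. ?q i j) + (\<Sum>i\<in>H. \<Sum>j\<in>?L. ?q i j) +
      ((\<Sum>i\<in>?L. \<Sum>j\<in>H. ?q i j) + (\<Sum>i\<in>?L. \<Sum>j\<in>?L. ?q i j))"
    unfolding split by (simp add: sum.distrib)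
  also have "(\<Sum>i\<in>H. \<Sum>j\<in>?L. ?q i j) = (\<Sum>i\<in>?L. \<Sum>j\<in>H. ?q i j)"
    by (subst sum.swap) (intro sum.cong HOL.refl comm)
  finally have l: "l = (\<Sum>i\<in>H. \<Sum>j\<in>H. ?q i j) + 2 * (\<Sum>i\<in>?L. \<Sum>j\<in>H. ?q i j) +
      (\<Sum>i\<in>?L. \<Sum>j\<in>?L. ?q i j)" by simp
  have "\<bar>\<Sum>i\<in>H. \<Sum>j\<in>H. ?q i j\<bar> \<le> (\<Sum>i\<in>H. \<Sum>j\<in>H. \<bar>?q i j\<bar>)"
    by (intro order_trans[OF sum_abs] sum_mono sum_abs)
  also have "\<dots> \<le> (\<Sum>i\<in>H. \<Sum>j\<in>H. \<bar>x i\<bar> * \<bar>x j\<bar>)"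
    using nonneg le_one by (intro sum_mono) (auto simp: abs_mult intro!: mult_left_le_one_le)
  also have "\<dots> = (\<Sum>i\<in>H. \<bar>x i\<bar>)\<^sup>2" by (simp add: power2_eq_square sum_product)
  also have "\<dots> \<le> card H * (\<Sum>i\<in>H. \<bar>x i\<bar>\<^sup>2)" using H finite_sub by (intro sum_squared_le_card)
  also have "\<dots> \<le> real (card H) * 1" using X L0 by (intro mult_left_mono) auto
  finally have HH: "\<bar>\<Sum>i\<in>H. \<Sum>j\<in>H. ?q i j\<bar> \<le> card H" by simp
  have degL: "(\<Sum>j\<in>?L. a i j) \<le> \<Delta>" if "i \<in> ?L" for i
    using low[OF that] split[of "a i"] sum_nonneg[of H "a i"] nonneg by auto
  have "V \<noteq> {}" using unit by auto
  then obtain v where "(\<Sum>u\<in>V. a v u) \<le> D" using degenerate[of V] by blast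
  then have "0 \<le> D" using sum_nonneg[of V "a v"] nonneg by auto
  then have nn: "0 \<le> \<theta> * D + \<Delta> / \<theta>" using \<theta> \<Delta> by simp
  have "\<bar>\<Sum>i\<in>?L. \<Sum>j\<in>?L. ?q i j\<bar> \<le> (\<theta> * D + \<Delta> / \<theta>) * (\<Sum>i\<in>?L. (x i)\<^sup>2)"
    using degL \<theta> by (intro form_le_of_max_degree) auto
  also have "\<dots> \<le> (\<theta> * D + \<Delta> / \<theta>) * 1" using nn X L0 by (intro mult_left_mono) auto
  finally have LL: "\<bar>\<Sum>i\<in>?L. \<Sum>j\<in>?L. ?q i j\<bar> \<le> \<theta> * D + \<Delta> / \<theta>" by simp
  let ?y = "\<lambda>v. \<Sum>i\<in>H. a v i * x i"
  have "\<bar>2 * (\<Sum>i\<in>?L. \<Sum>j\<in>H. ?q i j)\<bar> = \<bar>\<Sum>v\<in>?L. 2 * (x v * ?y v)\<bar>"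
    by (simp add: sum_distrib_left mult_ac)
  also have "\<dots> \<le> (\<Sum>v\<in>?L. \<bar>2 * (x v * ?y v)\<bar>)" by (rule sum_abs)
  also have "\<dots> \<le> (\<Sum>v\<in>?L. s * (x v)\<^sup>2 + (?y v)\<^sup>2 / s)"
    using two_mult_le_weighted[OF s] by (intro sum_mono) (auto simp: abs_mult)
  also have "\<dots> = s * (\<Sum>v\<in>?L. (x v)\<^sup>2) + (\<Sum>v\<in>?L. (?y v)\<^sup>2) / s"
    by (simp add: sum.distrib sum_distrib_left sum_divide_distrib)
  also have "(\<Sum>v\<in>?L. (x v)\<^sup>2) = 1 - (\<Sum>i\<in>H. (x i)\<^sup>2)" using X by simp
  finally have HL: "\<bar>2 * (\<Sum>i\<in>?L. \<Sum>j\<in>H. ?q i j)\<bar> \<le>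
    s * (1 - (\<Sum>i\<in>H. (x i)\<^sup>2)) + (\<Sum>v\<in>?L. (?y v)\<^sup>2) / s" .
  have "\<bar>l\<bar> \<le> c + d + e + f" if "l = A + B + C" "\<bar>A\<bar> \<le> c" "\<bar>C\<bar> \<le> d" "\<bar>B\<bar> \<le> e + f"
    for A B C c d e f :: real using that by arith
  from this[OF l HH LL HL] show ?thesis .
qed

end

context degenerate_graph
begin

text \<open>With \<open>H\<close> the set of vertices of linear degree and \<open>y v\<close> the part of the eigenvalue equation at \<open>v\<close>
  that comes from \<open>H\<close>, nearly all vertices \<open>v\<close> outside \<open>H\<close> have \<open>(y v)\<^sup>2\<close> close to its maximum
  \<open>k X\<close>, so they all have the same \<open>k\<close> neighbours in \<open>H\<close>.\<close>
lemma common_nbrs_of_large_eigenvalue: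
  fixes x :: "'a \<Rightarrow> real" and k m N :: nat and \<epsilon> \<delta> :: real
  defines "n \<equiv> card V"
  defines "q \<equiv> sqrt (real k * real n)"
  defines "g \<equiv> real N + sqrt (\<epsilon> * n) * (D + 1)" and "M \<equiv> real (2 ^ N * m)"
  assumes k: "k \<ge> 1" and eig: "\<And>i. i \<in> V \<Longrightarrow> (\<Sum>j\<in>V. a i j * x j) = l * x i"
    and unit: "(\<Sum>i\<in>V. (x i)\<^sup>2) = 1"
    and common: "\<And>S. S \<subseteq> V \<Longrightarrow> card S = k + 1 \<Longrightarrow> card {v\<in>V - S. \<forall>i\<in>S. a i v = 1} \<le> m"
    and \<epsilon>: "\<epsilon> > 0" and N: "4 * D / \<epsilon> \<le> real N" and \<delta>: "\<delta> < 1"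
    and l: "q - real k \<le> \<bar>l\<bar>"
    and small: "g + real k \<le> q / 8" "real N * M \<le> q\<^sup>2 / 2"
      "64 * q * (real k + g) + 8 * (real N * M) + real N + M \<le> \<delta> * n"
  shows "\<exists>K\<subseteq>V. card K = k \<and> (1 - \<delta>) * n \<le> card {v\<in>V - K. \<forall>i\<in>K. a i v = 1}"
proof -
  have Vne: "V \<noteq> {}" using unit by auto
  then have n: "real n > 0" unfolding n_def using fin by (simp add: card_gt_0_iff)
  obtain v0 where "(\<Sum>u\<in>V. a v0 u) \<le> D" using degenerate[of V] Vne by blast
  then have D: "0 \<le> D" using sum_nonneg[of V "a v0"] nonneg by auto
  have q: "q > 0" unfolding q_def using k n by simp
  have q2: "q\<^sup>2 = real k * n" unfolding q_def using k n by simp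
  define H where "H = {v\<in>V. \<epsilon> * card V \<le> (\<Sum>u\<in>V. a v u)}"
  have HV: "H \<subseteq> V" unfolding H_def by auto
  have finH: "finite H" using HV finite_sub by auto
  have hN: "real (card H) \<le> real N" using few_high_degree[OF \<epsilon> Vne] N unfolding H_def by linarith
  define y where "y v = (\<Sum>i\<in>H. a v i * x i)" for v
  define nb where "nb v = {i\<in>H. a v i = 1}" for v
  define X where "X = (\<Sum>i\<in>H. (x i)\<^sup>2)"
  define Y where "Y = (\<Sum>v\<in>V - H. (y v)\<^sup>2)"
  \<comment> \<open>For vertices outside \<open>Exc\<close> Cauchy-Schwarz gives
    \<open>(y v)\<^sup>2 \<le> k * X\<close>; those in \<open>Exc\<close> are few and cost at most
    \<open>N * X\<close> each. The margin \<open>X / 8\<close> in \<open>Bad\<close> is the one that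
    \<open>concentrated_sets_eq\<close> tolerates.\<close>
  define Exc where "Exc = {v\<in>V - H. k < card (nb v)}"
  define Bad where "Bad = {v\<in>V - H. (y v)\<^sup>2 < real k * X - X / 8}"
  have X0: "0 \<le> X" unfolding X_def by (simp add: sum_nonneg)
  have X1: "X \<le> 1" unfolding X_def using unit sum_mono2[OF fin HV, of "\<lambda>i. (x i)\<^sup>2"] by simp
  have finEB: "finite Exc" "finite Bad" using fin unfolding Exc_def Bad_def by auto
  have "card Exc \<le> 2 ^ card H * m"
    unfolding Exc_def nb_def using few_exceptional[OF HV common] .
  also have "\<dots> \<le> 2 ^ N * m" using hN by (intro mult_right_mono power_increasing) auto
  finally have Exc: "real (card Exc) \<le> M" unfolding M_def by (simp only: of_nat_le_iff)
  have M0: "0 \<le> M" unfolding M_def by simp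
  have y_nb: "y v = (\<Sum>i\<in>nb v. x i)" for v
  proof -
    have "y v = (\<Sum>i\<in>H. if a v i = 1 then x i else 0)"
      unfolding y_def using zero_one by (intro sum.cong) fastforce+
    then show ?thesis unfolding nb_def using finH by (simp add: sum.If_cases Int_def)
  qed
  have nbH: "nb v \<subseteq> H" for v unfolding nb_def by auto
  have ysq: "(y v)\<^sup>2 \<le> real (card (nb v)) * X" for v
  proof -
    have "(y v)\<^sup>2 \<le> real (card (nb v)) * (\<Sum>i\<in>nb v. (x i)\<^sup>2)"
      unfolding y_nb using finite_subset[OF nbH finH] by (intro sum_squared_le_card)
    also have "(\<Sum>i\<in>nb v. (x i)\<^sup>2) \<le> X" unfolding X_def using nbH finH by (intro sum_mono2) auto
    finally show ?thesis by (simp add: mult_left_mono)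
  qed
  have yv: "(y v)\<^sup>2 \<le> real k * X - X / 8 * of_bool (v \<in> Bad) + real N * X * of_bool (v \<in> Exc)"
    if v: "v \<in> V - H" for v
  proof (cases "v \<in> Exc")
    case False
    then have "real (card (nb v)) \<le> real k" using v unfolding Exc_def by auto
    then have "(y v)\<^sup>2 \<le> real k * X" using ysq[of v] X0 by (meson mult_right_mono order_trans)
    then show ?thesis using False unfolding Bad_def by auto
  next
    case True
    have "card (nb v) \<le> card H" using nbH finH by (intro card_mono)
    then have "real (card (nb v)) \<le> real N" using hN by linarith
    then have "(y v)\<^sup>2 \<le> real N * X" using ysq[of v] X0 by (meson mult_right_mono order_trans)
    moreover have "1 * X \<le> real k * X" using k X0 by (intro mult_right_mono) auto
    ultimately show ?thesis using True X0 by (cases "v \<in> Bad") auto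
  qed
  have "Y \<le> (\<Sum>v\<in>V - H. real k * X - X / 8 * of_bool (v \<in> Bad) + real N * X * of_bool (v \<in> Exc))"
    unfolding Y_def by (intro sum_mono yv)
  also have "\<dots> = card (V - H) * (real k * X) - X / 8 * card Bad + real N * X * card Exc"
  proof -
    have ob: "(\<Sum>v\<in>V - H. c * of_bool (v \<in> B)) = c * card B" if "B \<subseteq> V - H" for c :: real and B
    proof -
      have "(V - H) \<inter> {v. v \<in> B} = B" using that by auto
      then show ?thesis using fin by (simp add: sum_distrib_left[symmetric] of_bool_def sum.If_cases)
    qed
    have "Bad \<subseteq> V - H" "Exc \<subseteq> V - H" unfolding Bad_def Exc_def by auto
    from this[THEN ob] show ?thesis by (simp only: sum.distrib sum_subtractf sum_constant)
  qed
  also have "\<dots> \<le> q\<^sup>2 * X - X * card Bad / 8 + real N * M * X"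
  proof -
    have "card (V - H) \<le> n" unfolding n_def using fin by (intro card_mono) auto
    then have "card (V - H) * (real k * X) \<le> n * (real k * X)"
      using X0 by (intro mult_right_mono) auto
    moreover have "real N * X * card Exc \<le> real N * X * M"
      using Exc X0 by (intro mult_left_mono) auto
    ultimately show ?thesis unfolding q2 by (simp add: mult_ac)
  qed
  finally have Yle: "Y \<le> q\<^sup>2 * X - X * card Bad / 8 + real N * M * X" .
  have upper: "\<bar>l\<bar> \<le> g + s * (1 - X) + Y / s" if s: "s > 0" for s
  proof -
    \<comment> \<open>Vertices outside \<open>H\<close> have degree below
      \<open>\<epsilon> * n\<close>, so this value of \<theta> makes
      \<open>\<theta> * D + \<epsilon> * n / \<theta>\<close> equal to the
      \<open>sqrt (\<epsilon> * n) * (D + 1)\<close> in \<open>g\<close>.\<close>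
    let ?t = "sqrt (\<epsilon> * n)"
    have t: "?t > 0" "\<epsilon> * n / ?t = ?t" using \<epsilon> n by (simp_all add: real_div_sqrt)
    have "\<bar>l\<bar> \<le> card H + (?t * D + (\<epsilon> * n) / ?t) + s * (1 - X) + Y / s"
      unfolding X_def Y_def y_def
      by (rule eigenvalue_le_split[OF HV eig unit]) (use \<epsilon> n t s in \<open>auto simp: H_def n_def\<close>)
    also have "\<dots> \<le> g + s * (1 - X) + Y / s"
      using hN t(2) unfolding g_def by (simp add: algebra_simps)
    finally show ?thesis .
  qed
  have g0: "0 \<le> g" unfolding g_def using \<epsilon> n D by simp
  have X8: "X \<ge> 1 / 8" and b: "card Bad \<le> 64 * q * (real k + g) + 8 * (real N * M)"
    using stability_numeric[OF q X0 X1 _ _ _ l upper Yle small(1,2)] g0 M0 by simp_all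
  define W where "W = V - H - Exc - Bad"
  have "n \<le> card W + (card H + card Exc + card Bad)"
  proof -
    have "V \<subseteq> W \<union> (H \<union> Exc \<union> Bad)" unfolding W_def by auto
    then have "n \<le> card (W \<union> (H \<union> Exc \<union> Bad))"
      unfolding n_def using fin finH finEB by (intro card_mono) (auto simp: W_def)
    also have "\<dots> \<le> card W + (card H + card Exc + card Bad)"
      by (meson add_left_mono add_right_mono card_Un_le order_trans)
    finally show ?thesis .
  qed
  then have "real n \<le> card W + (card H + card Exc + card Bad)" by linarith
  then have W: "(1 - \<delta>) * n \<le> card W" using hN Exc b small(3) by (simp add: algebra_simps)
  then have "card W > 0" using \<delta> n by (smt (verit) mult_pos_pos of_nat_0_less_iff)
  then obtain w where w: "w \<in> W" by fastforce
  have Xpos: "X > 0" using X8 by simp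
  \<comment> \<open>The fixed vertex \<open>w\<close> serves as reference: all vertices of
    \<open>W\<close> are concentrated on neighbourhoods with respect to the same vector
    \<open>x\<close>, hence on the same one.\<close>
  have same: "nb w = nb v \<and> card (nb w) = k" if v: "v \<in> W" for v
    using concentrated_sets_eq[OF finH nbH nbH k _ _ X_def Xpos, of w v] v w
    unfolding W_def Exc_def Bad_def y_nb by auto
  have "W \<subseteq> {v\<in>V - nb w. \<forall>i\<in>nb w. a i v = 1}"
  proof
    fix v assume v: "v \<in> W"
    have "v \<in> V - nb w" using v nbH unfolding W_def by auto
    moreover have "\<forall>i\<in>nb w. a i v = 1" using same[OF v] sym unfolding nb_def by auto
    ultimately show "v \<in> {v\<in>V - nb w. \<forall>i\<in>nb w. a i v = 1}" by simp
  qed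
  then have "card W \<le> card {v\<in>V - nb w. \<forall>i\<in>nb w. a i v = 1}" using fin by (intro card_mono) auto
  then have "(1 - \<delta>) * n \<le> card {v\<in>V - nb w. \<forall>i\<in>nb w. a i v = 1}" using W by linarith
  then show ?thesis using same[OF w] nbH[of w] HV by (intro exI[of _ "nb w"]) auto
qed

end

section \<open>Thresholds for the stability statement\<close>

lemma sqrt_eventually_ge: "\<exists>n0::nat. \<forall>n\<ge>n0. Q \<le> sqrt (real n)"
proof (intro exI allI impI)
  fix n assume n: "n \<ge> nat \<lceil>Q\<^sup>2\<rceil>"
  have "Q\<^sup>2 \<le> real n" using n by linarith
  then have "\<bar>Q\<bar> \<le> sqrt (real n)" using real_le_rsqrt by fastforce
  then show "Q \<le> sqrt (real n)" by simp
qed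

text \<open>What is added here is uniformity: \<open>n0\<close> depends only on \<open>k\<close>,
  \<open>m\<close>, \<open>D\<close> and \<delta>. The hypothesis concerns the square of
  \<open>l\<close>, so it can be met at either end of the spectrum.\<close>

theorem stability:
  fixes k m :: nat and D \<delta> :: real
  assumes k: "k \<ge> 1" and \<delta>: "0 < \<delta>" "\<delta> < 1" and D: "0 \<le> D"
  shows "\<exists>n0. \<forall>(V :: 'a set) a x l. degenerate_graph V a D \<and> n0 \<le> card V \<and>
    (\<forall>S. S \<subseteq> V \<and> card S = k + 1 \<longrightarrow> card {v\<in>V - S. \<forall>i\<in>S. a i v = 1} \<le> m) \<and>
    (\<forall>i\<in>V. (\<Sum>j\<in>V. a i j * x j) = l * x i) \<and> (\<Sum>i\<in>V. (x i)\<^sup>2) = 1 \<and>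
    real k * (real (card V) - real k) \<le> l\<^sup>2 \<longrightarrow>
    (\<exists>K\<subseteq>V. card K = k \<and> (1 - \<delta>) * card V \<le> card {v\<in>V - K. \<forall>i\<in>K. a i v = 1})"
proof -
  \<comment> \<open>The only contribution of order n to the vertices lost is
    \<open>64 * q * sqrt (\<epsilon> * n) * (D + 1)\<close> with
    \<open>\<epsilon> = e\<^sup>2\<close>. Since \<open>q\<close> is at most \<open>k\<close> times
    sqrt n, this \<open>e\<close> keeps it below \<open>\<delta> / 4 * n\<close>.\<close>
  define e where "e = \<delta> / (256 * k * (D + 1))"
  have e: "0 < e" unfolding e_def using k \<delta> D by simp
  have kr: "real k \<ge> 1" using k by simp
  have e_le: "e * (D + 1) \<le> 1 / 16" "128 * real k * (e * (D + 1)) = \<delta> / 2"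
  proof -
    have "e * (D + 1) = \<delta> / (256 * k)" unfolding e_def using D by simp
    also have "\<dots> \<le> 1 / 16" using \<delta> kr by (simp add: field_simps)
    finally show "e * (D + 1) \<le> 1 / 16" .
    show "128 * real k * (e * (D + 1)) = \<delta> / 2" unfolding e_def using D kr by simp
  qed
  define N where "N = nat \<lceil>4 * D / e\<^sup>2\<rceil>"
  have N: "4 * D / e\<^sup>2 \<le> real N" unfolding N_def by linarith
  define M where "M = real (2 ^ N * m)"
  \<comment> \<open>All other contributions are at most of order sqrt n. Each summand of
    \<open>Q\<close> is a lower bound on sqrt n demanded by one of the smallness conditions.\<close>
  define Q where "Q = 16 * (real N + k) + 2 * real N * M + 1 +
    (128 * k * (k + real N) + 8 * real N * M + N + M) / (\<delta> / 4)"
  obtain n0 where n0: "\<forall>n\<ge>n0. Q \<le> sqrt (real n)" using sqrt_eventually_ge by blast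
  show ?thesis
  proof (intro exI[of _ n0] allI impI, elim conjE)
    fix V :: "'a set" and a x l
    assume dg: "degenerate_graph V a D" and n: "n0 \<le> card V"
      and common: "\<forall>S. S \<subseteq> V \<and> card S = k + 1 \<longrightarrow> card {v\<in>V - S. \<forall>i\<in>S. a i v = 1} \<le> m"
      and eig: "\<forall>i\<in>V. (\<Sum>j\<in>V. a i j * x j) = l * x i" and unit: "(\<Sum>i\<in>V. (x i)\<^sup>2) = 1"
      and l: "real k * (real (card V) - real k) \<le> l\<^sup>2"
    interpret degenerate_graph V a D by fact
    let ?n = "real (card V)"
    define r where "r = sqrt ?n"
    have M0: "0 \<le> M" unfolding M_def by simp
    have P: "0 \<le> (128 * k * (k + real N) + 8 * real N * M + N + M) / (\<delta> / 4)"
      using \<delta> M0 by simp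
    have rQ: "Q \<le> r" unfolding r_def using n0 n by blast
    have r1: "1 \<le> r" "16 * (real N + k) \<le> r" "2 * real N * M \<le> r"
      "(128 * k * (k + real N) + 8 * real N * M + N + M) / (\<delta> / 4) \<le> r"
      using rQ P M0 unfolding Q_def by (auto intro: order_trans[rotated])
    define q where "q = sqrt (real k * ?n)"
    define g where "g = real N + sqrt (e\<^sup>2 * ?n) * (D + 1)"
    have q: "q = sqrt k * r" unfolding q_def r_def by (simp add: real_sqrt_mult)
    have g: "g = real N + r * (e * (D + 1))" unfolding g_def r_def using e by (simp add: real_sqrt_mult)
    have r2: "r * r = ?n" unfolding r_def by simp
    have qr: "r \<le> q" "q \<le> real k * r"
    proof -
      have "1 * r \<le> sqrt k * r" using kr r1(1) by (intro mult_right_mono) auto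
      then show "r \<le> q" unfolding q by simp
      have "sqrt k \<le> real k" using kr by (intro real_le_lsqrt) (auto simp: power2_eq_square)
      then show "q \<le> real k * r" unfolding q using r1(1) by (intro mult_right_mono) auto
    qed
    have er: "r * (e * (D + 1)) \<le> r * (1 / 16)" using e_le(1) r1(1) by (intro mult_left_mono) auto
    then have c2: "g + real k \<le> q / 8" using r1(2) qr(1) unfolding g by simp
    have "real N * M \<le> r / 2" using r1(3) by simp
    also have "\<dots> \<le> q\<^sup>2 / 2"
    proof -
      have "1 * r \<le> q * q" using qr r1 by (intro mult_mono) auto
      then show ?thesis by (simp add: power2_eq_square)
    qed
    finally have c3: "real N * M \<le> q\<^sup>2 / 2" .
    have "64 * q * (real k + g) \<le> 64 * (real k * r) * (real k + g)"
      using qr(2) r1(1) e D unfolding g by (intro mult_right_mono) auto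
    also have "\<dots> = 64 * k * (k + real N) * r + (128 * real k * (e * (D + 1))) * (r * r) / 2"
      unfolding g by (simp add: algebra_simps)
    also have "\<dots> = 64 * k * (k + real N) * r + \<delta> / 4 * (r * r)" unfolding e_le by simp
    finally have t1: "64 * q * (real k + g) \<le> 64 * k * (k + real N) * r + \<delta> / 4 * (r * r)" .
    have "(8 * real N * M + N + M) * 1 \<le> (8 * real N * M + N + M) * r"
      using r1(1) M0 by (intro mult_left_mono) auto
    moreover have "(128 * k * (k + real N) + 8 * real N * M + N + M) * r \<le> (r * (\<delta> / 4)) * r"
      using r1(1,4) \<delta> by (intro mult_right_mono) (auto simp: pos_divide_le_eq)
    moreover have "0 \<le> 64 * k * (k + real N) * r" "0 \<le> \<delta> * (r * r)" using r1(1) \<delta> by auto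
    ultimately have c4: "64 * q * (real k + g) + 8 * (real N * M) + real N + M \<le> \<delta> * (r * r)"
      using t1 by (simp add: algebra_simps)
    have lq: "q - real k \<le> \<bar>l\<bar>"
    proof (cases "q \<le> k")
      case False
      \<comment> \<open>For \<open>q > k\<close> the cross term outweighs the square of
        \<open>k\<close> twice, so the threshold \<open>k * (n - k)\<close> in place of
        \<open>k * n\<close> lowers the bound on \<open>\<bar>l\<bar>\<close> by at most
        \<open>k\<close>.\<close>
      have "(q - k)\<^sup>2 = real k * ?n + (real k)\<^sup>2 - 2 * (q * k)"
        unfolding power2_diff q_def by simp
      also have "\<dots> \<le> real k * ?n + (real k)\<^sup>2 - 2 * (k * k)"
        using False mult_right_mono[of "real k" q "real k"] by simp
      also have "\<dots> \<le> l\<^sup>2" using l by (simp add: power2_eq_square algebra_simps)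
      finally show ?thesis using abs_le_square_iff[of "q - k" l] by simp
    qed simp
    show "\<exists>K\<subseteq>V. card K = k \<and> (1 - \<delta>) * card V \<le> card {v\<in>V - K. \<forall>i\<in>K. a i v = 1}"
      by (rule common_nbrs_of_large_eigenvalue[where \<epsilon> = "e\<^sup>2" and N = N and m = m and l = l and x = x])
        (use k eig unit common e N \<delta> lq c2 c3 c4 r2 in \<open>simp_all add: q_def g_def M_def\<close>)
  qed
qed

section \<open>Perturbation of a dominating clique\<close>

context degenerate_graph
begin

abbreviation deg :: "'a set \<Rightarrow> 'a \<Rightarrow> real" where "deg W i \<equiv> (\<Sum>j\<in>W. a i j)"

text \<open>A form of de Caen's inequality, from projecting the edge indicator onto the functions
  \<open>c + g i + g j\<close> on pairs. Multiplying by \<open>card K - 1\<close> makes \<open>card K = 1\<close> harmless.\<close>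
lemma degree_variance_le:
  fixes d :: real
  assumes K: "finite K" "K \<noteq> {}" and avg: "d * card K = (\<Sum>i\<in>K. deg K i)"
  shows "(\<Sum>i\<in>K. (deg K i - d)\<^sup>2) \<le> (real (card K) - 1) * (d * (real (card K) - 1 - d)) / 2"
proof -
  define k where "k = real (card K)"
  define D' where "D' = k - 1"
  define g where "g i = deg K i - d" for i
  define W where "W = (\<Sum>i\<in>K. (g i)\<^sup>2)"
  have k: "k \<ge> 1" unfolding k_def using K by (simp add: Suc_leI card_gt_0_iff)
  have sg: "(\<Sum>i\<in>K. g i) = 0" unfolding g_def using avg by (simp add: sum_subtractf mult.commute)
  have sa: "(\<Sum>i\<in>K. \<Sum>j\<in>K. a i j) = k * d" using avg unfolding k_def by (simp add: mult.commute)
  have sag: "(\<Sum>i\<in>K. \<Sum>j\<in>K. a i j * g i) = W"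
  proof -
    have "(\<Sum>i\<in>K. \<Sum>j\<in>K. a i j * g i) = (\<Sum>i\<in>K. (g i + d) * g i)"
      unfolding g_def by (simp add: sum_distrib_right)
    also have "\<dots> = W + d * (\<Sum>i\<in>K. g i)"
      unfolding W_def by (simp add: algebra_simps power2_eq_square sum.distrib sum_distrib_left)
    finally show ?thesis using sg by simp
  qed
  have sag': "(\<Sum>i\<in>K. \<Sum>j\<in>K. a i j * g j) = W"
    unfolding sag[symmetric] by (subst sum.swap) (intro sum.cong HOL.refl, simp add: sym)
  have sgg: "(\<Sum>i\<in>K. \<Sum>j\<in>K. g i * g j) = 0" by (simp only: sum_product[symmetric] sg)
  have s1: "(\<Sum>i\<in>K. \<Sum>j\<in>K. g i) = 0" "(\<Sum>i\<in>K. \<Sum>j\<in>K. g j) = 0"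
    using sg by (simp_all flip: sum_distrib_left)
  have s2: "(\<Sum>i\<in>K. \<Sum>j\<in>K. (g i)\<^sup>2) = k * W" "(\<Sum>i\<in>K. \<Sum>j\<in>K. (g j)\<^sup>2) = k * W"
    unfolding W_def k_def by (simp_all flip: sum_distrib_left)
  let ?f = "\<lambda>i j. (D' * a i j - d - g i - g j)\<^sup>2"
  have sq: "?f i j = (D'\<^sup>2 - 2 * D' * d) * a i j - 2 * D' * (a i j * g i) - 2 * D' * (a i j * g j)
      + d\<^sup>2 + (g i)\<^sup>2 + (g j)\<^sup>2 + 2 * d * g i + 2 * d * g j + 2 * (g i * g j)" for i j
  proof -
    have "?f i j = D'\<^sup>2 * (a i j)\<^sup>2 - 2 * D' * d * a i j - 2 * D' * (a i j * g i) - 2 * D' * (a i j * g j)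
      + d\<^sup>2 + (g i)\<^sup>2 + (g j)\<^sup>2 + 2 * d * g i + 2 * d * g j + 2 * (g i * g j)"
      by (simp add: power2_eq_square algebra_simps)
    then show ?thesis unfolding square by (simp add: algebra_simps)
  qed
  have "(\<Sum>i\<in>K. \<Sum>j\<in>K. ?f i j) = (D'\<^sup>2 - 2 * D' * d) * (k * d) - 4 * D' * W + k * k * d\<^sup>2 + 2 * k * W"
    unfolding sq sum.distrib sum_subtractf sum_distrib_left[symmetric] sa sag sag' sgg s1 s2
    by (simp add: sg k_def algebra_simps)
  moreover have "(\<Sum>i\<in>K. ?f i i) = k * d\<^sup>2 + 4 * W"
  proof -
    have "?f i i = d\<^sup>2 + 4 * (g i)\<^sup>2 + 4 * d * g i" for i
      unfolding diag by (simp add: power2_eq_square algebra_simps)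
    then show ?thesis
      by (simp only: sum.distrib sum_distrib_left[symmetric] sg) (simp add: k_def W_def)
  qed
  \<comment> \<open>The inequality is the nonnegativity of the squares off the diagonal. The
    diagonal is subtracted because \<open>a i i = 0\<close> holds by convention and says nothing
    about a pair of vertices.\<close>
  moreover have "(\<Sum>i\<in>K. ?f i i) \<le> (\<Sum>i\<in>K. \<Sum>j\<in>K. ?f i j)"
    using K by (intro sum_mono member_le_sum) auto
  ultimately have "k * (2 * W) \<le> k * (D' * (d * (D' - d)))"
    unfolding D'_def by (simp add: power2_eq_square algebra_simps)
  then have "2 * W \<le> D' * (d * (D' - d))" using k by (simp add: mult_le_cancel_left)
  then show ?thesis unfolding W_def g_def D'_def k_def by simp
qed

lemma form_shift:
  fixes u :: "'a \<Rightarrow> real" and p :: real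
  shows
  "(\<Sum>i\<in>W. \<Sum>j\<in>W. a i j * ((p + u i) * (p + u j))) =
    p\<^sup>2 * (\<Sum>i\<in>W. deg W i) + 2 * (\<Sum>i\<in>W. p * deg W i * u i) + (\<Sum>i\<in>W. \<Sum>j\<in>W. a i j * (u i * u j))"
proof -
  have "(\<Sum>i\<in>W. \<Sum>j\<in>W. a i j * (p * u j)) = (\<Sum>i\<in>W. \<Sum>j\<in>W. a i j * (p * u i))"
    by (subst sum.swap) (intro sum.cong HOL.refl, simp add: sym)
  then show ?thesis
    by (simp add: algebra_simps sum.distrib sum_distrib_left sum_distrib_right power2_eq_square)
qed

lemma form_le_card:
  fixes u :: "'a \<Rightarrow> real"
  assumes "finite W"
  shows "\<bar>\<Sum>i\<in>W. \<Sum>j\<in>W. a i j * (u i * u j)\<bar> \<le> card W * (\<Sum>i\<in>W. (u i)\<^sup>2)"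
proof -
  have "\<bar>\<Sum>i\<in>W. \<Sum>j\<in>W. a i j * (u i * u j)\<bar> \<le> (\<Sum>i\<in>W. \<Sum>j\<in>W. \<bar>a i j * (u i * u j)\<bar>)"
    by (intro order_trans[OF sum_abs] sum_mono sum_abs)
  also have "\<dots> \<le> (\<Sum>i\<in>W. \<Sum>j\<in>W. \<bar>u i\<bar> * \<bar>u j\<bar>)"
    using nonneg le_one by (intro sum_mono) (auto simp: abs_mult intro!: mult_left_le_one_le)
  also have "\<dots> = (\<Sum>i\<in>W. \<bar>u i\<bar>)\<^sup>2" by (simp add: power2_eq_square sum_product)
  also have "\<dots> \<le> card W * (\<Sum>i\<in>W. \<bar>u i\<bar>\<^sup>2)" using assms by (intro sum_squared_le_card)
  finally show ?thesis by simp
qed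

end

section \<open>The quadratic form in terms of means and deviations\<close>

lemma two_abs_sum_le_weighted:
  fixes f g :: "'a \<Rightarrow> real"
  assumes "s > 0"
  shows "2 * \<bar>\<Sum>i\<in>A. f i * g i\<bar> \<le> s * (\<Sum>i\<in>A. (f i)\<^sup>2) + (\<Sum>i\<in>A. (g i)\<^sup>2) / s"
proof -
  have "2 * \<bar>\<Sum>i\<in>A. f i * g i\<bar> \<le> 2 * (\<Sum>i\<in>A. \<bar>f i * g i\<bar>)"
    by (intro mult_left_mono sum_abs) auto
  also have "\<dots> = (\<Sum>i\<in>A. 2 * \<bar>f i * g i\<bar>)" by (simp only: sum_distrib_left)
  also have "\<dots> \<le> (\<Sum>i\<in>A. s * (f i)\<^sup>2 + (g i)\<^sup>2 / s)"
    by (intro sum_mono two_mult_le_weighted assms)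
  finally show ?thesis by (simp add: sum.distrib sum_distrib_left sum_divide_distrib)
qed

context degenerate_graph
begin

text \<open>Here \<open>p\<close> and \<open>q\<close> are the means of a vector over \<open>K\<close> and \<open>R\<close>, with deviations \<open>u\<close> and \<open>w\<close>;
  \<open>z\<close> counts the missing edges between \<open>K\<close> and \<open>R\<close>.\<close>
lemma form_le_of_means:
  fixes u w :: "'a \<Rightarrow> real" and K R :: "'a set" and \<epsilon> p q d t S \<kappa> \<omega> \<eta> \<tau> \<theta> \<sigma> :: real
  defines "k \<equiv> real (card K)" and "m \<equiv> real (card R)"
  defines "z \<equiv> (\<Sum>i\<in>K. \<Sum>v\<in>R. 1 - a i v)"
  defines "U \<equiv> (\<Sum>i\<in>K. (u i)\<^sup>2)" and "W \<equiv> (\<Sum>v\<in>R. (w v)\<^sup>2)"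
  assumes KR: "K \<subseteq> V" "R \<subseteq> V" and \<epsilon>: "\<epsilon> = 1 \<or> \<epsilon> = - 1"
    and u: "(\<Sum>i\<in>K. u i) = 0" and w: "(\<Sum>v\<in>R. w v) = 0"
    and avg: "d * card K = (\<Sum>i\<in>K. deg K i)"
    and degR: "\<And>v. v \<in> R \<Longrightarrow> deg R v \<le> t" and miss: "\<And>i. i \<in> K \<Longrightarrow> (\<Sum>v\<in>R. 1 - a i v) \<le> t"
    and S: "(\<Sum>v\<in>R. deg R v) \<le> S" and t: "t \<ge> 0"
    and pos: "\<kappa> > 0" "\<omega> > 0" "\<tau> > 0" "\<theta> > 0" "\<sigma> > 0" "\<eta> > 0"
  shows "\<epsilon> * ((\<Sum>i\<in>K. \<Sum>j\<in>K. a i j * ((p + u i) * (p + u j))) +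
      2 * (\<Sum>i\<in>K. \<Sum>v\<in>R. a i v * ((p + u i) * (q + w v))) +
      (\<Sum>i\<in>R. \<Sum>j\<in>R. a i j * ((q + w i) * (q + w j)))) \<le>
    \<epsilon> * (d * k) * p\<^sup>2 + 2 * (k * m - z) * \<bar>p * q\<bar>
    + p\<^sup>2 * ((\<Sum>i\<in>K. (deg K i - d)\<^sup>2) / \<kappa> + k * z / \<sigma>)
    + q\<^sup>2 * (k * t\<^sup>2 / \<omega> + S + t * S / \<eta>)
    + (\<kappa> + k + \<omega> + t * \<tau>) * U
    + (\<sigma> + k / \<tau> + \<eta> + (\<theta> * D + t / \<theta>)) * W"
proof -
  let ?b = "\<lambda>i v. 1 - a i v"
  let ?zv = "\<lambda>v. \<Sum>i\<in>K. ?b i v" and ?ri = "\<lambda>i. \<Sum>v\<in>R. ?b i v"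
  let ?N = "\<Sum>i\<in>K. (deg K i - d)\<^sup>2"
  have finK: "finite K" and finR: "finite R" using KR finite_sub by auto
  have b01: "0 \<le> ?b i v" "?b i v \<le> 1" for i v using nonneg[of i v] le_one[of i v] by auto
  have k0: "0 \<le> k" and m0: "0 \<le> m" unfolding k_def m_def by auto
  have z0: "0 \<le> k * m - z"
  proof -
    have "z \<le> (\<Sum>i\<in>K. \<Sum>v\<in>R. 1)" unfolding z_def using b01 by (intro sum_mono) auto
    then show ?thesis unfolding k_def m_def by simp
  qed
  have U0: "0 \<le> U" "0 \<le> W" unfolding U_def W_def by (simp_all add: sum_nonneg)
  define KK where "KK = (\<Sum>i\<in>K. p * deg K i * u i)"
  define uu where "uu = (\<Sum>i\<in>K. \<Sum>j\<in>K. a i j * (u i * u j))"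
  define RR where "RR = (\<Sum>v\<in>R. q * deg R v * w v)"
  define ww where "ww = (\<Sum>i\<in>R. \<Sum>j\<in>R. a i j * (w i * w j))"
  define b1 where "b1 = (\<Sum>i\<in>K. q * ?ri i * u i)"
  define b2 where "b2 = (\<Sum>v\<in>R. p * ?zv v * w v)"
  define b3 where "b3 = (\<Sum>i\<in>K. \<Sum>v\<in>R. ?b i v * (u i * w v))"
  have kk: "(\<Sum>i\<in>K. \<Sum>j\<in>K. a i j * ((p + u i) * (p + u j))) = d * k * p\<^sup>2 + 2 * KK + uu"
    unfolding form_shift KK_def uu_def avg[symmetric] k_def by simp
  have rr: "(\<Sum>i\<in>R. \<Sum>j\<in>R. a i j * ((q + w i) * (q + w j))) =
      q\<^sup>2 * (\<Sum>v\<in>R. deg R v) + 2 * RR + ww"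
    unfolding form_shift RR_def ww_def by simp
  \<comment> \<open>Write \<open>a\<close> as 1 minus the missing edges. The constant part sees only
    the means, since \<open>u\<close> and \<open>w\<close> sum to zero; every error comes from
    missing edges.\<close>
  have kr: "(\<Sum>i\<in>K. \<Sum>v\<in>R. a i v * ((p + u i) * (q + w v))) = (k * m - z) * (p * q) - b1 - b2 - b3"
  proof -
    have "(\<Sum>i\<in>K. \<Sum>v\<in>R. a i v * ((p + u i) * (q + w v))) =
      (\<Sum>i\<in>K. \<Sum>v\<in>R. (p + u i) * (q + w v)) - (\<Sum>i\<in>K. \<Sum>v\<in>R. ?b i v * ((p + u i) * (q + w v)))"
      unfolding sum_subtractf[symmetric] by (intro sum.cong HOL.refl) (simp add: algebra_simps)
    also have "(\<Sum>i\<in>K. \<Sum>v\<in>R. (p + u i) * (q + w v)) = (\<Sum>i\<in>K. p + u i) * (\<Sum>v\<in>R. q + w v)"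
      by (simp only: sum_product)
    also have "\<dots> = k * m * (p * q)" using u w by (simp add: sum.distrib k_def m_def)
    also have "(\<Sum>i\<in>K. \<Sum>v\<in>R. ?b i v * ((p + u i) * (q + w v))) =
       (\<Sum>i\<in>K. \<Sum>v\<in>R. (p * q) * ?b i v + q * ?b i v * u i + p * ?b i v * w v + ?b i v * (u i * w v))"
      by (intro sum.cong HOL.refl) (simp add: algebra_simps)
    also have "\<dots> = (p * q) * z + b1 + (\<Sum>i\<in>K. \<Sum>v\<in>R. p * ?b i v * w v) + b3"
      unfolding b1_def b3_def z_def by (simp only: sum.distrib sum_distrib_left sum_distrib_right)
    also have "(\<Sum>i\<in>K. \<Sum>v\<in>R. p * ?b i v * w v) = b2"
      unfolding b2_def by (subst sum.swap) (simp only: sum_distrib_left sum_distrib_right)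
    finally show ?thesis by (simp add: algebra_simps)
  qed
  have B1: "2 * \<bar>KK\<bar> \<le> \<kappa> * U + p\<^sup>2 * (?N / \<kappa>)"
  proof -
    \<comment> \<open>As \<open>u\<close> sums to zero, the degrees may be centred at
      \<open>d\<close>, so that only their variance is paid.\<close>
    have "KK = (\<Sum>i\<in>K. u i * (p * (deg K i - d))) + p * d * (\<Sum>i\<in>K. u i)"
      unfolding KK_def by (simp add: algebra_simps sum.distrib sum_subtractf sum_distrib_left)
    then have "KK = (\<Sum>i\<in>K. u i * (p * (deg K i - d)))" using u by simp
    then show ?thesis
      using two_abs_sum_le_weighted[OF pos(1), of u "\<lambda>i. p * (deg K i - d)" K]
      unfolding U_def by (simp add: power_mult_distrib sum_distrib_left[symmetric])
  qed
  have B2: "\<bar>uu\<bar> \<le> k * U" unfolding uu_def U_def k_def using form_le_card finK by blast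
  have B3: "2 * \<bar>b1\<bar> \<le> \<omega> * U + q\<^sup>2 * (k * t\<^sup>2 / \<omega>)"
  proof -
    have "(\<Sum>i\<in>K. (q * ?ri i)\<^sup>2) \<le> (\<Sum>i\<in>K. q\<^sup>2 * t\<^sup>2)"
    proof (intro sum_mono)
      fix i assume "i \<in> K"
      then have "(?ri i)\<^sup>2 \<le> t\<^sup>2" using miss b01 by (intro power_mono sum_nonneg) auto
      then show "(q * ?ri i)\<^sup>2 \<le> q\<^sup>2 * t\<^sup>2" by (simp add: power_mult_distrib mult_left_mono)
    qed
    then have "(\<Sum>i\<in>K. (q * ?ri i)\<^sup>2) / \<omega> \<le> (k * (q\<^sup>2 * t\<^sup>2)) / \<omega>"
      using pos unfolding k_def by (intro divide_right_mono) auto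
    moreover have "b1 = (\<Sum>i\<in>K. u i * (q * ?ri i))" unfolding b1_def by (intro sum.cong) auto
    ultimately show ?thesis
      using two_abs_sum_le_weighted[OF pos(2), of u "\<lambda>i. q * ?ri i" K]
      unfolding U_def by (simp add: mult_ac)
  qed
  have B4: "2 * \<bar>b2\<bar> \<le> \<sigma> * W + p\<^sup>2 * (k * z / \<sigma>)"
  proof -
    \<comment> \<open>A vertex misses at most \<open>k\<close> edges to \<open>K\<close>, so the
      squares of these numbers add up to at most \<open>k * z\<close>. A cost linear in
      \<open>z\<close> is essential, because the gain is linear in \<open>z\<close> as well.\<close>
    have "(\<Sum>v\<in>R. (p * ?zv v)\<^sup>2) \<le> (\<Sum>v\<in>R. p\<^sup>2 * (k * ?zv v))"
    proof (intro sum_mono)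
      fix v assume "v \<in> R"
      have "?zv v \<le> (\<Sum>i\<in>K. 1)" using b01 by (intro sum_mono) auto
      then have "?zv v * ?zv v \<le> k * ?zv v"
        using b01 unfolding k_def by (intro mult_right_mono sum_nonneg) auto
      then show "(p * ?zv v)\<^sup>2 \<le> p\<^sup>2 * (k * ?zv v)"
        by (simp add: power_mult_distrib mult_left_mono power2_eq_square[of "?zv v"])
    qed
    also have "\<dots> = p\<^sup>2 * (k * z)"
      unfolding z_def by (subst sum.swap) (simp only: sum_distrib_left)
    finally have "(\<Sum>v\<in>R. (p * ?zv v)\<^sup>2) / \<sigma> \<le> p\<^sup>2 * (k * z) / \<sigma>"
      using pos by (intro divide_right_mono) auto
    moreover have "b2 = (\<Sum>v\<in>R. w v * (p * ?zv v))" unfolding b2_def by (intro sum.cong) auto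
    ultimately show ?thesis
      using two_abs_sum_le_weighted[OF pos(5), of w "\<lambda>v. p * ?zv v" R]
      unfolding W_def by simp
  qed
  have B5: "2 * \<bar>b3\<bar> \<le> t * \<tau> * U + k / \<tau> * W"
  proof -
    have "2 * \<bar>b3\<bar> \<le> (\<Sum>i\<in>K. \<Sum>v\<in>R. 2 * \<bar>?b i v * (u i * w v)\<bar>)"
      unfolding b3_def sum_distrib_left[symmetric]
      by (intro mult_left_mono order_trans[OF sum_abs] sum_mono sum_abs) auto
    also have "\<dots> \<le> (\<Sum>i\<in>K. \<Sum>v\<in>R. ?b i v * (\<tau> * (u i)\<^sup>2) + (w v)\<^sup>2 / \<tau>)"
    proof (intro sum_mono)
      fix i v
      have "2 * \<bar>?b i v * (u i * w v)\<bar> = ?b i v * (2 * \<bar>u i * w v\<bar>)" using b01 by (simp add: abs_mult)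
      also have "\<dots> \<le> ?b i v * (\<tau> * (u i)\<^sup>2 + (w v)\<^sup>2 / \<tau>)"
        using b01 pos by (intro mult_left_mono two_mult_le_weighted) auto
      also have "\<dots> \<le> ?b i v * (\<tau> * (u i)\<^sup>2) + 1 * ((w v)\<^sup>2 / \<tau>)"
        unfolding distrib_left using b01[of i v] pos by (intro add_left_mono mult_right_mono) auto
      finally show "2 * \<bar>?b i v * (u i * w v)\<bar> \<le> ?b i v * (\<tau> * (u i)\<^sup>2) + (w v)\<^sup>2 / \<tau>" by simp
    qed
    also have "\<dots> = (\<Sum>i\<in>K. ?ri i * (\<tau> * (u i)\<^sup>2)) + k / \<tau> * W"
      unfolding W_def k_def
      by (simp add: sum.distrib sum_distrib_right sum_divide_distrib[symmetric])
    also have "(\<Sum>i\<in>K. ?ri i * (\<tau> * (u i)\<^sup>2)) \<le> (\<Sum>i\<in>K. t * (\<tau> * (u i)\<^sup>2))"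
      using miss pos by (intro sum_mono mult_right_mono) auto
    finally show ?thesis unfolding U_def by (simp add: sum_distrib_left mult_ac)
  qed
  have B6: "2 * \<bar>RR\<bar> \<le> \<eta> * W + q\<^sup>2 * (t * S / \<eta>)"
  proof -
    \<comment> \<open>In the same way the squared degrees in \<open>R\<close> are at most
      \<open>t\<close> times the degrees, which turns the bound on their sum into one on the sum of
      squares.\<close>
    have "(\<Sum>v\<in>R. (q * deg R v)\<^sup>2) \<le> (\<Sum>v\<in>R. q\<^sup>2 * (t * deg R v))"
    proof (intro sum_mono)
      fix v assume "v \<in> R"
      then have "deg R v * deg R v \<le> t * deg R v"
        using degR nonneg by (intro mult_right_mono sum_nonneg) auto
      then show "(q * deg R v)\<^sup>2 \<le> q\<^sup>2 * (t * deg R v)"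
        by (simp add: power_mult_distrib mult_left_mono power2_eq_square[of "deg R v"])
    qed
    also have "\<dots> = q\<^sup>2 * (t * (\<Sum>v\<in>R. deg R v))" by (simp only: sum_distrib_left)
    also have "\<dots> \<le> q\<^sup>2 * (t * S)" using S t by (intro mult_left_mono) auto
    finally have "(\<Sum>v\<in>R. (q * deg R v)\<^sup>2) / \<eta> \<le> q\<^sup>2 * (t * S) / \<eta>"
      using pos by (intro divide_right_mono) auto
    moreover have "RR = (\<Sum>v\<in>R. w v * (q * deg R v))" unfolding RR_def by (intro sum.cong) auto
    ultimately show ?thesis
      using two_abs_sum_le_weighted[OF pos(6), of w "\<lambda>v. q * deg R v" R]
      unfolding W_def by simp
  qed
  have B7: "\<bar>ww\<bar> \<le> (\<theta> * D + t / \<theta>) * W"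
    unfolding ww_def W_def using form_le_of_max_degree KR(2) pos(4) degR by blast
  have B8: "q\<^sup>2 * (\<Sum>v\<in>R. deg R v) \<le> q\<^sup>2 * S" "0 \<le> q\<^sup>2 * (\<Sum>v\<in>R. deg R v)"
    using S nonneg by (auto intro!: mult_left_mono mult_nonneg_nonneg sum_nonneg)
  have B9: "\<bar>(k * m - z) * (p * q)\<bar> = (k * m - z) * \<bar>p * q\<bar>" using z0 by (simp add: abs_mult)
  \<comment> \<open>The sign matters only in the term with \<open>d * k\<close>; every other term is
    estimated in absolute value, so both directions of the bound on the eigenvalue share one
    computation.\<close>
  have sgn: "\<epsilon> * y \<le> \<bar>y\<bar>" for y using \<epsilon> by auto
  have "\<epsilon> * (d * k * p\<^sup>2 + 2 * KK + uu + 2 * ((k * m - z) * (p * q) - b1 - b2 - b3) +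
      (q\<^sup>2 * (\<Sum>v\<in>R. deg R v) + 2 * RR + ww)) \<le> \<epsilon> * (d * k) * p\<^sup>2 + (2 * \<bar>KK\<bar> + \<bar>uu\<bar> +
      2 * ((k * m - z) * \<bar>p * q\<bar>) + 2 * \<bar>b1\<bar> + 2 * \<bar>b2\<bar> + 2 * \<bar>b3\<bar> + q\<^sup>2 * S + 2 * \<bar>RR\<bar> + \<bar>ww\<bar>)"
    (is "\<epsilon> * ?F \<le> _ + ?G")
  proof -
    have "\<epsilon> * ?F = \<epsilon> * (d * k) * p\<^sup>2 + \<epsilon> * (?F - d * k * p\<^sup>2)" by (simp add: algebra_simps)
    moreover have "\<bar>?F - d * k * p\<^sup>2\<bar> \<le> ?G"
    proof -
      have aux: "\<bar>A + 2 * x1 + x2 + 2 * (c - x3 - x4 - x5) + (s + 2 * x6 + x7) - A\<bar> \<le>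
          2 * y1 + y2 + 2 * c' + 2 * y3 + 2 * y4 + 2 * y5 + s' + 2 * y6 + y7"
        if "c \<le> c'" "- c \<le> c'" "s \<le> s'" "0 \<le> s"
          "x1 \<le> y1" "- x1 \<le> y1" "x2 \<le> y2" "- x2 \<le> y2" "x3 \<le> y3" "- x3 \<le> y3" "x4 \<le> y4" "- x4 \<le> y4"
          "x5 \<le> y5" "- x5 \<le> y5" "x6 \<le> y6" "- x6 \<le> y6" "x7 \<le> y7" "- x7 \<le> y7"
        for A c c' s s' x1 x2 x3 x4 x5 x6 x7 y1 y2 y3 y4 y5 y6 y7 :: real
        using that unfolding right_diff_distrib by (intro abs_leI) linarith+
      show ?thesis
        using B8 abs_ge_self[of "(k * m - z) * (p * q)"] abs_ge_minus_self[of "(k * m - z) * (p * q)"]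
        unfolding B9 by (intro aux abs_ge_self abs_ge_minus_self) assumption+
    qed
    ultimately show ?thesis using sgn[of "?F - d * k * p\<^sup>2"] by linarith
  qed
  also have "\<dots> \<le> \<epsilon> * (d * k) * p\<^sup>2 + ((\<kappa> * U + p\<^sup>2 * (?N / \<kappa>)) + k * U + 2 * ((k * m - z) * \<bar>p * q\<bar>) +
     (\<omega> * U + q\<^sup>2 * (k * t\<^sup>2 / \<omega>)) + (\<sigma> * W + p\<^sup>2 * (k * z / \<sigma>)) + (t * \<tau> * U + k / \<tau> * W) +
     q\<^sup>2 * S + (\<eta> * W + q\<^sup>2 * (t * S / \<eta>)) + (\<theta> * D + t / \<theta>) * W)"
    by (intro add_mono order_refl B1 B2 B3 B4 B5 B6 B7)
  finally show ?thesis unfolding kk kr rr by (simp add: algebra_simps)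
qed

end

section \<open>Positivity of the binary form in the two means\<close>

lemma binary_form_nonneg:
  fixes \<alpha> \<beta> \<rho> p q :: real
  assumes "\<alpha> > 0" "\<rho>\<^sup>2 \<le> \<alpha> * \<beta>"
  shows "0 \<le> \<alpha> * p\<^sup>2 + \<beta> * q\<^sup>2 - 2 * \<rho> * \<bar>p * q\<bar>"
    and "\<rho>\<^sup>2 < \<alpha> * \<beta> \<Longrightarrow> p \<noteq> 0 \<or> q \<noteq> 0 \<Longrightarrow> 0 < \<alpha> * p\<^sup>2 + \<beta> * q\<^sup>2 - 2 * \<rho> * \<bar>p * q\<bar>"
proof -
  have eq: "\<alpha> * (\<alpha> * p\<^sup>2 + \<beta> * q\<^sup>2 - 2 * \<rho> * \<bar>p * q\<bar>) =
      (\<alpha> * \<bar>p\<bar> - \<rho> * \<bar>q\<bar>)\<^sup>2 + (\<alpha> * \<beta> - \<rho>\<^sup>2) * q\<^sup>2"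
    by (simp add: power2_diff power_mult_distrib abs_mult algebra_simps) (simp add: power2_eq_square)
  have "0 \<le> \<alpha> * (\<alpha> * p\<^sup>2 + \<beta> * q\<^sup>2 - 2 * \<rho> * \<bar>p * q\<bar>)" unfolding eq using assms by simp
  then show "0 \<le> \<alpha> * p\<^sup>2 + \<beta> * q\<^sup>2 - 2 * \<rho> * \<bar>p * q\<bar>"
    using assms(1) by (simp only: zero_le_mult_iff) linarith
  assume lt: "\<rho>\<^sup>2 < \<alpha> * \<beta>" and pq: "p \<noteq> 0 \<or> q \<noteq> 0"
  have "0 < \<alpha> * (\<alpha> * p\<^sup>2 + \<beta> * q\<^sup>2 - 2 * \<rho> * \<bar>p * q\<bar>)"
  proof (cases "q = 0")
    case True
    then show ?thesis unfolding eq using pq assms(1) by simp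
  next
    case False
    then have "0 < (\<alpha> * \<beta> - \<rho>\<^sup>2) * q\<^sup>2" using lt by simp
    then show ?thesis unfolding eq by (simp add: add_nonneg_pos)
  qed
  then show "0 < \<alpha> * p\<^sup>2 + \<beta> * q\<^sup>2 - 2 * \<rho> * \<bar>p * q\<bar>"
    using assms(1) by (simp only: zero_less_mult_iff) linarith
qed

text \<open>The quantities are those of \<open>form_le_of_means\<close>, with \<open>v\<close> the degree variance of \<open>K\<close> and
  \<open>c\<close> half its average degree.\<close>
lemma perturbed_determinant:
  fixes k m z t v c \<sigma> E \<delta> h \<epsilon> :: real
  defines "B \<equiv> k * t\<^sup>2 / (h * \<sigma> / 4) + E * t + t * (E * t) / (\<sigma> / 32)"
  defines "\<alpha> \<equiv> k * (\<sigma> - \<epsilon> * c) - (k * v / (\<sigma> * (1 - h)) + k * z / (3 / 4 * \<sigma>))"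
    and "\<beta> \<equiv> m * (\<sigma> + \<epsilon> * c) - B"
  assumes k: "k \<ge> 1" and m: "m > 0" and \<sigma>: "\<sigma> > 0" "\<sigma>\<^sup>2 = k * m + (k - 1)\<^sup>2 / 4"
    and \<epsilon>: "\<epsilon> = 1 \<or> \<epsilon> = - 1" and c: "0 \<le> c" "2 * c \<le> k - 1"
    and v: "0 \<le> v" "v \<le> c * (k - 1 - 2 * c)"
    and gap: "2 * c = k - 1 \<or> 2 / k \<le> k - 1 - 2 * c"
    and t: "0 \<le> t" "t \<le> \<delta> * m" "t \<le> z" "z \<le> k * t" and E: "0 \<le> E"
    and h: "h = 1 / (4 * k ^ 4)" and small: "k \<le> h / 16 * \<sigma>"
      "\<delta> \<le> 1 / 24" "8 * k * \<delta> / h \<le> 1 / 24" "64 * E * \<delta> \<le> 1 / 24" "2 * E * \<sigma> \<le> m / 24"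
  shows "\<alpha> > 0" "(k * m - z)\<^sup>2 \<le> \<alpha> * \<beta>" "z > 0 \<or> 2 * c < k - 1 \<Longrightarrow> (k * m - z)\<^sup>2 < \<alpha> * \<beta>"
proof -
  have h0: "0 < h" "h \<le> 1 / 4"
  proof -
    have "1 \<le> k ^ 4" using k by simp
    then show "0 < h" "h \<le> 1 / 4" unfolding h using k by (auto simp: field_simps)
  qed
  have z0: "0 \<le> z" using t by linarith
  have k2: "1 \<le> k\<^sup>2" using k by simp
  have c': "c \<le> h / 32 * \<sigma>" using c small by linarith
  have hs: "h / 32 * \<sigma> \<le> \<sigma> / 128" using h0 \<sigma> by simp
  have \<epsilon>c: "\<sigma> + \<epsilon> * c \<le> \<sigma> * (1 + h / 32)" "\<sigma> - \<epsilon> * c \<le> 2 * \<sigma>" "\<sigma> / 2 \<le> \<sigma> - \<epsilon> * c" "0 \<le> \<sigma> + \<epsilon> * c"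
  proof -
    have "c \<le> \<sigma> / 128" using c' hs by linarith
    then show "\<sigma> + \<epsilon> * c \<le> \<sigma> * (1 + h / 32)" "\<sigma> - \<epsilon> * c \<le> 2 * \<sigma>" "\<sigma> / 2 \<le> \<sigma> - \<epsilon> * c" "0 \<le> \<sigma> + \<epsilon> * c"
      using \<epsilon> c c' \<sigma>(1) by (auto simp: algebra_simps)
  qed
  have vk: "v \<le> k\<^sup>2 / 2"
  proof -
    have "c * (k - 1 - 2 * c) \<le> (k / 2) * k" using c k by (intro mult_mono) auto
    then show ?thesis using v by (simp add: power2_eq_square)
  qed
  define \<alpha>' where "\<alpha>' = \<sigma> - \<epsilon> * c - (v / (\<sigma> * (1 - h)) + z / (3 / 4 * \<sigma>))"
  define \<beta>' where "\<beta>' = \<sigma> + \<epsilon> * c - B / m"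
  have \<alpha>': "\<alpha> = k * \<alpha>'" unfolding \<alpha>_def \<alpha>'_def by (simp add: algebra_simps)
  have \<beta>': "\<beta> = m * \<beta>'" unfolding \<beta>_def \<beta>'_def using m by (simp add: algebra_simps)
  have zm: "z \<le> \<delta> * (k * m)"
  proof -
    have "k * t \<le> k * (\<delta> * m)" using t k by (intro mult_left_mono) auto
    then show ?thesis using t by (simp add: mult_ac)
  qed
  have km: "0 < k * m" "k * m \<le> \<sigma>\<^sup>2" using k m \<sigma>(2) by auto
  have \<delta>0: "0 \<le> \<delta>" using t m by (smt (verit) mult_neg_pos)
  have k4: "16 * k \<le> h * \<sigma>" using small(1) by simp
  \<comment> \<open>The size of \<open>h\<close> is dictated by this product: with
    \<open>v \<le> k\<^sup>2 / 2\<close> the relative error \<open>2 * h\<close> costs at most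
    \<open>1 / (4 * k\<^sup>2)\<close>, a quarter of what a single edge missing in \<open>K\<close>
    gains.\<close>
  have hk: "h * k\<^sup>2 * k\<^sup>2 = 1 / 4" unfolding h using k by (simp add: field_simps power_numeral_reduce)
  have vs: "v / (\<sigma> * (1 - h)) \<le> \<sigma> / 8"
  proof -
    have "k * (16 * k) \<le> k * (h * \<sigma>)" using k4 k by (intro mult_left_mono) auto
    also have "\<dots> \<le> k\<^sup>2 * k\<^sup>2 * (h * \<sigma>)"
    proof -
      have "k * 1 \<le> k\<^sup>2 * k\<^sup>2" using k k2 by (intro mult_mono) (auto simp: power2_eq_square)
      then show ?thesis using h0 \<sigma> by (intro mult_right_mono) auto
    qed
    also have "\<dots> = (h * k\<^sup>2 * k\<^sup>2) * \<sigma>" by simp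
    finally have "64 * k\<^sup>2 \<le> \<sigma>" unfolding hk by (simp add: power2_eq_square)
    then have "32 * v \<le> \<sigma>" using vk k2 by linarith
    moreover have "1 \<le> \<sigma>" using \<open>64 * k\<^sup>2 \<le> \<sigma>\<close> k2 by linarith
    then have "\<sigma> * 1 \<le> \<sigma> * \<sigma>" using \<sigma> by (intro mult_left_mono) auto
    moreover have "0 < \<sigma> * \<sigma>" using \<sigma> by simp
    ultimately have "v \<le> \<sigma> * \<sigma> * (3 / 4) / 8" by (simp add: field_simps)
    also have "\<dots> \<le> \<sigma> * \<sigma> * (1 - h) / 8" using h0 \<sigma> by (intro divide_right_mono mult_left_mono) auto
    finally show ?thesis using \<sigma> h0 by (simp add: field_simps)
  qed
  have zs: "z / (3 / 4 * \<sigma>) \<le> \<sigma> / 8"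
  proof -
    have "z \<le> 1 / 24 * \<sigma>\<^sup>2"
    proof -
      have "\<delta> * (k * m) \<le> 1 / 24 * \<sigma>\<^sup>2" using km small(2) \<delta>0 by (intro mult_mono) auto
      then show ?thesis using zm by linarith
    qed
    moreover have "0 \<le> \<sigma>\<^sup>2" by simp
    ultimately have "z \<le> 3 / 32 * \<sigma>\<^sup>2" by linarith
    then show ?thesis using \<sigma>(1) by (simp add: field_simps power2_eq_square)
  qed
  have \<alpha>'0: "0 < \<alpha>'" unfolding \<alpha>'_def using \<epsilon>c vs zs \<sigma> by linarith
  then show "\<alpha> > 0" unfolding \<alpha>' using k by simp
  define A where "A = v / (\<sigma> * (1 - h)) + z / (3 / 4 * \<sigma>)"
  have A0: "0 \<le> A" unfolding A_def using v z0 \<sigma> h0 by simp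
  have B0: "0 \<le> B / m" unfolding B_def using t E \<sigma> h0 k m by simp
  have "\<alpha>' * \<beta>' = \<sigma>\<^sup>2 - (\<epsilon> * c)\<^sup>2 - (\<sigma> + \<epsilon> * c) * A - (\<sigma> - \<epsilon> * c) * (B / m) + A * (B / m)"
    unfolding \<alpha>'_def \<beta>'_def A_def[symmetric] by (simp add: algebra_simps power2_eq_square)
  moreover have "(\<epsilon> * c)\<^sup>2 = c\<^sup>2" using \<epsilon> by auto
  moreover have "0 \<le> A * (B / m)" using A0 B0 by (rule mult_nonneg_nonneg)
  ultimately have ab: "\<sigma>\<^sup>2 - c\<^sup>2 - (\<sigma> + \<epsilon> * c) * A - (\<sigma> - \<epsilon> * c) * (B / m) \<le> \<alpha>' * \<beta>'" by linarith
  have A1: "(\<sigma> + \<epsilon> * c) * A \<le> v * (1 + 2 * h) + 3 / 2 * z"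
  proof -
    have "(\<sigma> + \<epsilon> * c) * A \<le> (\<sigma> * (1 + h / 32)) * A" using \<epsilon>c A0 by (intro mult_right_mono)
    also have "\<dots> = v * ((1 + h / 32) / (1 - h)) + (1 + h / 32) * (4 / 3) * z"
      unfolding A_def using \<sigma>(1) h0 by (simp add: field_simps)
    also have "\<dots> \<le> v * (1 + 2 * h) + 3 / 2 * z"
    proof (intro add_mono mult_left_mono mult_right_mono z0 v(1))
      have "0 \<le> h * (1 - 2 * h - 1 / 32)" using h0 by (intro mult_nonneg_nonneg) auto
      then show "(1 + h / 32) / (1 - h) \<le> 1 + 2 * h" using h0 by (simp add: field_simps)
      show "(1 + h / 32) * (4 / 3) \<le> 3 / 2" using h0 by simp
    qed
    finally show ?thesis .
  qed
  have B1: "(\<sigma> - \<epsilon> * c) * (B / m) \<le> t / 8"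
  proof -
    have "(\<sigma> - \<epsilon> * c) * (B / m) \<le> (2 * \<sigma>) * (B / m)" using \<epsilon>c B0 by (intro mult_right_mono)
    also have "\<dots> = t * ((8 * k / h + 64 * E) * (t / m) + (2 * E * \<sigma>) / m)"
      unfolding B_def using \<sigma>(1) h0 m by (simp add: field_simps power2_eq_square)
    also have "\<dots> \<le> t * ((8 * k / h + 64 * E) * \<delta> + 1 / 24)"
    proof (intro mult_left_mono add_mono t(1))
      show "t / m \<le> \<delta>" using t m by (simp add: field_simps)
      show "0 \<le> 8 * k / h + 64 * E" using k h0 E by simp
      show "2 * E * \<sigma> / m \<le> 1 / 24" using small(5) m by (simp add: field_simps)
    qed
    also have "\<dots> \<le> t * (1 / 8)"
    proof (intro mult_left_mono t(1))
      have "(8 * k / h + 64 * E) * \<delta> = 8 * k * \<delta> / h + 64 * E * \<delta>" by (simp add: algebra_simps)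
      then show "(8 * k / h + 64 * E) * \<delta> + 1 / 24 \<le> 1 / 8" using small(3,4) by linarith
    qed
    finally show ?thesis by simp
  qed
  have C1: "(k * m - z)\<^sup>2 / (k * m) \<le> k * m - 2 * z + \<delta> * z"
  proof -
    have "z * z \<le> (\<delta> * (k * m)) * z" using zm z0 by (intro mult_right_mono)
    then have "(k * m - z)\<^sup>2 \<le> (k * m - 2 * z + \<delta> * z) * (k * m)"
      by (simp add: algebra_simps power2_eq_square)
    then show ?thesis using km(1) by (simp only: pos_divide_le_eq)
  qed
  \<comment> \<open>After the bound on \<open>v\<close> the gain minus the loss inside
    \<open>K\<close> is the perfect square \<open>(k - 1 - 2 * c)\<^sup>2 / 4\<close>. By
    \<open>gap\<close> it either vanishes, and then \<open>v = 0\<close>, or is at least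
    \<open>1 / k\<^sup>2\<close>, which leaves room for the error from \<open>h\<close>.\<close>
  have G: "0 \<le> (k - 1)\<^sup>2 / 4 - c\<^sup>2 - v * (1 + 2 * h)"
    "2 * c < k - 1 \<Longrightarrow> 0 < (k - 1)\<^sup>2 / 4 - c\<^sup>2 - v * (1 + 2 * h)"
  proof -
    have "0 < (k - 1)\<^sup>2 / 4 - c\<^sup>2 - v * (1 + 2 * h)" if lt: "2 * c < k - 1"
    proof -
      have "2 / k \<le> k - 1 - 2 * c" using gap lt by auto
      then have "(2 / k)\<^sup>2 \<le> (k - 1 - 2 * c)\<^sup>2" using k by (intro power_mono) auto
      moreover have "(k - 1)\<^sup>2 / 4 - c\<^sup>2 - c * (k - 1 - 2 * c) = (k - 1 - 2 * c)\<^sup>2 / 4"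
        by (simp add: power2_eq_square field_simps)
      ultimately have 1: "1 / k\<^sup>2 \<le> (k - 1)\<^sup>2 / 4 - c\<^sup>2 - v" using v by (simp add: power_divide)
      have "v * (2 * h) \<le> k\<^sup>2 / 2 * (2 * h)" using vk h0 by (intro mult_right_mono) auto
      also have "\<dots> = (h * k\<^sup>2 * k\<^sup>2) / k\<^sup>2" using k by simp
      also have "\<dots> = 1 / k\<^sup>2 / 4" unfolding hk by simp
      also have "\<dots> < 1 / k\<^sup>2"
      proof -
        have "y / 4 < y" if "0 < y" for y :: real using that by simp
        moreover have "0 < 1 / k\<^sup>2" using k by simp
        ultimately show ?thesis by blast
      qed
      finally show ?thesis using 1 by (simp add: algebra_simps)
    qed
    moreover have "(k - 1)\<^sup>2 / 4 - c\<^sup>2 - v * (1 + 2 * h) = 0" if eq: "2 * c = k - 1"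
    proof -
      have "v = 0" using v eq by simp
      moreover have "(k - 1)\<^sup>2 / 4 = c\<^sup>2" unfolding eq[symmetric] by (simp add: power2_eq_square)
      ultimately show ?thesis by simp
    qed
    ultimately show "0 \<le> (k - 1)\<^sup>2 / 4 - c\<^sup>2 - v * (1 + 2 * h)"
      "2 * c < k - 1 \<Longrightarrow> 0 < (k - 1)\<^sup>2 / 4 - c\<^sup>2 - v * (1 + 2 * h)"
      using c(2) by (cases "2 * c = k - 1"; force)+
  qed
  have dz: "\<delta> * z \<le> 1 / 24 * z" using small(2) z0 by (intro mult_right_mono)
  \<comment> \<open>The balance of missing edges: \<open>(k * m - z)\<^sup>2\<close> brings a gain
    of \<open>2 * z\<close>, against losses of \<open>3 / 2 * z\<close> from \<open>A1\<close>,
    \<open>t / 8 \<le> z / 8\<close> from \<open>B1\<close> and \<open>z / 24\<close> from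
    \<open>C1\<close>. At least \<open>z / 4\<close> remains.\<close>
  have main: "((k - 1)\<^sup>2 / 4 - c\<^sup>2 - v * (1 + 2 * h)) + z / 4 \<le> \<alpha>' * \<beta>' - (k * m - z)\<^sup>2 / (k * m)"
    using ab A1 B1 C1 dz \<sigma>(2) t(3) z0 by linarith
  have conv: "\<alpha> * \<beta> - (k * m - z)\<^sup>2 = k * m * (\<alpha>' * \<beta>' - (k * m - z)\<^sup>2 / (k * m))"
    unfolding \<alpha>' \<beta>' using k m by (simp add: right_diff_distrib)
  have nn: "0 \<le> \<alpha>' * \<beta>' - (k * m - z)\<^sup>2 / (k * m)" using main G(1) z0 by linarith
  have "0 \<le> \<alpha> * \<beta> - (k * m - z)\<^sup>2" unfolding conv using less_imp_le[OF km(1)] nn by (rule mult_nonneg_nonneg)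
  then show "(k * m - z)\<^sup>2 \<le> \<alpha> * \<beta>" by simp
  assume "z > 0 \<or> 2 * c < k - 1"
  then have pp: "0 < \<alpha>' * \<beta>' - (k * m - z)\<^sup>2 / (k * m)"
  proof
    assume "z > 0" then show ?thesis using main G(1) by linarith
  next
    assume "2 * c < k - 1" then show ?thesis using main G(2) z0 by linarith
  qed
  have "0 < \<alpha> * \<beta> - (k * m - z)\<^sup>2" unfolding conv using km(1) pp by (rule mult_pos_pos)
  then show "(k * m - z)\<^sup>2 < \<alpha> * \<beta>" by simp
qed

context degenerate_graph
begin

text \<open>One missing edge lowers the degree sum by 2. Hence the average degree is either that of
  a clique or smaller by a fixed amount, and the gain inside \<open>K\<close> cannot be arbitrarily
  small.\<close>

lemma average_degree_gap:
  fixes d :: real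
  assumes K: "finite K" "K \<noteq> {}" and avg: "d * card K = (\<Sum>i\<in>K. deg K i)"
  shows "d \<le> real (card K) - 1"
    and "(\<forall>i\<in>K. \<forall>j\<in>K. i \<noteq> j \<longrightarrow> a i j = 1) \<Longrightarrow> d = real (card K) - 1"
    and "\<not> (\<forall>i\<in>K. \<forall>j\<in>K. i \<noteq> j \<longrightarrow> a i j = 1) \<Longrightarrow> 2 / card K \<le> real (card K) - 1 - d"
proof -
  let ?f = "\<lambda>i j. of_bool (i \<noteq> j) - a i j"
  have k: "real (card K) > 0" using K by (simp add: card_gt_0_iff)
  have f0: "0 \<le> ?f i j" for i j using diag le_one by (cases "i = j") auto
  have "(\<Sum>i\<in>K. \<Sum>j\<in>K. of_bool (i \<noteq> j)) = (\<Sum>i\<in>K. real (card K) - 1)"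
  proof (intro sum.cong HOL.refl)
    fix i assume i: "i \<in> K"
    have "(\<Sum>j\<in>K. of_bool (i \<noteq> j)) = (\<Sum>j\<in>K - {i}. 1 :: real)"
      using K by (intro sum.mono_neutral_cong_right) auto
    then show "(\<Sum>j\<in>K. of_bool (i \<noteq> j)) = real (card K) - 1"
      using i K k by (simp add: card_Diff_singleton of_nat_diff Suc_leI)
  qed
  then have tot: "(\<Sum>i\<in>K. \<Sum>j\<in>K. ?f i j) = card K * (real (card K) - 1 - d)"
    unfolding sum_subtractf avg[symmetric] by (simp add: sum_subtractf avg[symmetric] algebra_simps)
  have "0 \<le> (\<Sum>i\<in>K. \<Sum>j\<in>K. ?f i j)" using f0 by (intro sum_nonneg)
  then show "d \<le> real (card K) - 1" unfolding tot using k by (simp add: zero_le_mult_iff)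
  {
    assume "\<forall>i\<in>K. \<forall>j\<in>K. i \<noteq> j \<longrightarrow> a i j = 1"
    then have "(\<Sum>i\<in>K. \<Sum>j\<in>K. ?f i j) = 0" using diag by (intro sum.neutral ballI) auto
    then show "d = real (card K) - 1" unfolding tot using k by simp
  next
    assume "\<not> (\<forall>i\<in>K. \<forall>j\<in>K. i \<noteq> j \<longrightarrow> a i j = 1)"
    then obtain i j where ij: "i \<in> K" "j \<in> K" "i \<noteq> j" "a i j = 0" using zero_one by blast
    have "2 = (\<Sum>(i, j)\<in>{(i, j), (j, i)}. ?f i j)" using ij sym[of i j] by simp
    also have "\<dots> \<le> (\<Sum>(i, j)\<in>K \<times> K. ?f i j)"
      using ij K f0 by (intro sum_mono2) (auto simp del: of_bool_not_iff)
    also have "\<dots> = (\<Sum>i\<in>K. \<Sum>j\<in>K. ?f i j)" by (simp only: sum.cartesian_product)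
    finally show "2 / card K \<le> real (card K) - 1 - d" unfolding tot using k by (simp add: field_simps)
  }
qed

lemma sum_squares_shift:
  fixes u :: "'a \<Rightarrow> real" and p :: real
  assumes "(\<Sum>i\<in>K. u i) = 0"
  shows "(\<Sum>i\<in>K. (p + u i)\<^sup>2) = card K * p\<^sup>2 + (\<Sum>i\<in>K. (u i)\<^sup>2)"
proof -
  have "(\<Sum>i\<in>K. (p + u i)\<^sup>2) = card K * p\<^sup>2 + (\<Sum>i\<in>K. (u i)\<^sup>2) + 2 * p * (\<Sum>i\<in>K. u i)"
    by (simp add: power2_sum sum.distrib sum_distrib_left)
  then show ?thesis using assms by simp
qed

text \<open>For a unit vector, \<sigma> minus the signed distance of \<open>l\<close> from
  \<open>c\<close> is at least a binary form in the means plus positive multiples of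
  \<open>U\<close> and \<open>W\<close>. The determinant settles the binary form. For strictness,
  either one of the means is nonzero and the determinant is strictly positive, or all the mass lies
  in \<open>U\<close> and \<open>W\<close>.\<close>

lemma eigenvalue_near_center:
  fixes K R :: "'a set" and x :: "'a \<Rightarrow> real" and l c t \<delta> h E \<sigma> :: real
  defines "k \<equiv> real (card K)" and "m \<equiv> real (card R)"
  defines "z \<equiv> (\<Sum>i\<in>K. \<Sum>v\<in>R. 1 - a i v)"
  assumes V: "V = K \<union> R" "K \<inter> R = {}" "K \<noteq> {}" "R \<noteq> {}"
    and eig: "\<And>i. i \<in> V \<Longrightarrow> (\<Sum>j\<in>V. a i j * x j) = l * x i" and x: "(\<Sum>i\<in>V. (x i)\<^sup>2) = 1"
    and avg: "2 * c * k = (\<Sum>i\<in>K. deg K i)"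
    and degR: "\<And>v. v \<in> R \<Longrightarrow> deg R v \<le> t" and miss: "\<And>i. i \<in> K \<Longrightarrow> (\<Sum>v\<in>R. 1 - a i v) \<le> t"
    and S: "(\<Sum>v\<in>R. deg R v) \<le> E * t"
    and \<sigma>: "\<sigma> > 0" "\<sigma>\<^sup>2 = k * m + (k - 1)\<^sup>2 / 4"
    and t: "0 \<le> t" "t \<le> \<delta> * m" "t \<le> z" "z \<le> k * t" and E: "0 \<le> E"
    and h: "h = 1 / (4 * k ^ 4)" and small: "k \<le> h / 16 * \<sigma>"
      "\<delta> \<le> 1 / 24" "8 * k * \<delta> / h \<le> 1 / 24" "64 * E * \<delta> \<le> 1 / 24" "2 * E * \<sigma> \<le> m / 24"
      "64 * (D + 1) * \<delta> \<le> 1 / 32"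
  shows "\<bar>l - c\<bar> \<le> \<sigma>"
    and "z > 0 \<or> \<not> (\<forall>i\<in>K. \<forall>j\<in>K. i \<noteq> j \<longrightarrow> a i j = 1) \<Longrightarrow> \<bar>l - c\<bar> < \<sigma>"
proof -
  have KR: "K \<subseteq> V" "R \<subseteq> V" using V by auto
  have finK: "finite K" and finR: "finite R" using KR finite_sub by auto
  have k: "k \<ge> 1" unfolding k_def using finK V(3) by (simp add: Suc_leI card_gt_0_iff)
  have m: "m > 0" unfolding m_def using finR V(4) by (simp add: card_gt_0_iff)
  obtain v0 where "deg V v0 \<le> D" using degenerate[of V] V by auto
  then have D: "0 \<le> D" using sum_nonneg[of V "a v0"] nonneg by force
  define v where "v = (\<Sum>i\<in>K. (deg K i - 2 * c)\<^sup>2) / k"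
  have kv: "k * v = (\<Sum>i\<in>K. (deg K i - 2 * c)\<^sup>2)" unfolding v_def using k by simp
  have v0: "0 \<le> v" unfolding v_def using k by (simp add: sum_nonneg)
  have "0 \<le> (\<Sum>i\<in>K. deg K i)" using nonneg by (intro sum_nonneg)
  then have c0: "0 \<le> c" unfolding avg[symmetric] using k by (simp add: zero_le_mult_iff)
  note gap = average_degree_gap[OF finK V(3), of "2 * c", folded k_def, OF avg]
  have "k * v \<le> (k - 1) * (2 * c * (k - 1 - 2 * c)) / 2"
    unfolding kv using degree_variance_le[OF finK V(3), of "2 * c", folded k_def, OF avg] .
  also have "\<dots> \<le> k * (c * (k - 1 - 2 * c))"
  proof -
    have "(k - 1) * (c * (k - 1 - 2 * c)) \<le> k * (c * (k - 1 - 2 * c))"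
      using c0 gap(1) k by (intro mult_right_mono mult_nonneg_nonneg) auto
    then show ?thesis by simp
  qed
  finally have vc: "v \<le> c * (k - 1 - 2 * c)" using k by (simp add: mult_le_cancel_left)
  have gap': "2 * c = k - 1 \<or> 2 / k \<le> k - 1 - 2 * c" using gap(2,3) by blast
  have h0: "0 < h" "h \<le> 1 / 4"
  proof -
    have "1 \<le> k ^ 4" using k by simp
    then show "0 < h" "h \<le> 1 / 4" unfolding h using k by (auto simp: field_simps)
  qed
  define p where "p = (\<Sum>i\<in>K. x i) / k"
  define q where "q = (\<Sum>v\<in>R. x v) / m"
  define u where "u i = x i - p" for i
  define w where "w v = x v - q" for v
  have u: "(\<Sum>i\<in>K. u i) = 0" unfolding u_def p_def using k by (simp add: sum_subtractf k_def)
  have w: "(\<Sum>v\<in>R. w v) = 0" unfolding w_def q_def using m by (simp add: sum_subtractf m_def)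
  have xu: "x i = p + u i" and xw: "x i = q + w i" for i unfolding u_def w_def by auto
  define U where "U = (\<Sum>i\<in>K. (u i)\<^sup>2)"
  define W where "W = (\<Sum>v\<in>R. (w v)\<^sup>2)"
  have UW: "0 \<le> U" "0 \<le> W" unfolding U_def W_def by (simp_all add: sum_nonneg)
  have split: "(\<Sum>i\<in>V. f i) = (\<Sum>i\<in>K. f i) + (\<Sum>i\<in>R. f i)" for f :: "'a \<Rightarrow> real"
    unfolding V(1) using finK finR V(2) by (intro sum.union_disjoint)
  have one: "1 = k * p\<^sup>2 + U + (m * q\<^sup>2 + W)"
  proof -
    have "1 = (\<Sum>i\<in>K. (p + u i)\<^sup>2) + (\<Sum>i\<in>R. (q + w i)\<^sup>2)"
      using x unfolding split xu[symmetric] xw[symmetric] by simp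
    then show ?thesis unfolding sum_squares_shift[OF u] sum_squares_shift[OF w] U_def W_def k_def m_def .
  qed
  let ?Q = "\<lambda>i j. a i j * (x i * x j)"
  have "l = (\<Sum>i\<in>V. x i * (l * x i))"
    using x by (simp add: sum_distrib_left[symmetric] mult.left_commute power2_eq_square)
  also have "\<dots> = (\<Sum>i\<in>V. x i * (\<Sum>j\<in>V. a i j * x j))" using eig by simp
  also have "\<dots> = (\<Sum>i\<in>V. \<Sum>j\<in>V. ?Q i j)" by (simp add: sum_distrib_left mult_ac)
  also have "\<dots> = (\<Sum>i\<in>K. \<Sum>j\<in>K. ?Q i j) + (\<Sum>i\<in>K. \<Sum>j\<in>R. ?Q i j) +
      ((\<Sum>i\<in>R. \<Sum>j\<in>K. ?Q i j) + (\<Sum>i\<in>R. \<Sum>j\<in>R. ?Q i j))"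
    unfolding split by (simp add: sum.distrib)
  also have "(\<Sum>i\<in>R. \<Sum>j\<in>K. ?Q i j) = (\<Sum>i\<in>K. \<Sum>j\<in>R. ?Q i j)"
  proof -
    have "?Q i j = ?Q j i" for i j by (simp add: sym[of i j] mult.commute[of "x i"])
    then show ?thesis by (subst sum.swap) (intro sum.cong HOL.refl)
  qed
  finally have l: "l = (\<Sum>i\<in>K. \<Sum>j\<in>K. a i j * (x i * x j)) +
      2 * (\<Sum>i\<in>K. \<Sum>v\<in>R. a i v * (x i * x v)) + (\<Sum>i\<in>R. \<Sum>j\<in>R. a i j * (x i * x j))" by simp
  have lF: "l = (\<Sum>i\<in>K. \<Sum>j\<in>K. a i j * ((p + u i) * (p + u j))) +
      2 * (\<Sum>i\<in>K. \<Sum>v\<in>R. a i v * ((p + u i) * (q + w v))) +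
      (\<Sum>i\<in>R. \<Sum>j\<in>R. a i j * ((q + w i) * (q + w j)))"
    unfolding xu[symmetric] xw[symmetric] by (rule l)
  \<comment> \<open>The weights share out the budget of about \<sigma> for \<open>U\<close> and for
    \<open>W\<close>. The variance loss must stay within a factor \<open>1 + 2 * h\<close>, so its
    weight takes \<open>\<sigma> * (1 - h)\<close> and the rest of \<open>cU\<close> has to fit into
    \<open>h * \<sigma>\<close>. In \<open>cW\<close> the weight \<open>3 / 4 * \<sigma>\<close>
    already keeps the cost of missing edges below \<open>2 * z\<close>, and the small remaining
    weights use the last quarter.\<close>
  let ?\<theta> = "\<sigma> / (64 * (D + 1))" and ?\<tau> = "32 * k / \<sigma>"
  define cU where "cU = \<sigma> * (1 - h) + k + h * \<sigma> / 4 + t * ?\<tau>"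
  define cW where "cW = 3 / 4 * \<sigma> + k / ?\<tau> + \<sigma> / 32 + (?\<theta> * D + t / ?\<theta>)"
  define B where "B = k * t\<^sup>2 / (h * \<sigma> / 4) + E * t + t * (E * t) / (\<sigma> / 32)"
  have main: "\<epsilon> * l \<le> \<epsilon> * (2 * c * k) * p\<^sup>2 + 2 * (k * m - z) * \<bar>p * q\<bar>
    + p\<^sup>2 * (k * v / (\<sigma> * (1 - h)) + k * z / (3 / 4 * \<sigma>)) + q\<^sup>2 * B + cU * U + cW * W"
    if "\<epsilon> = 1 \<or> \<epsilon> = - 1" for \<epsilon> :: real
    unfolding kv unfolding cU_def cW_def B_def lF U_def W_def z_def k_def m_def
    by (rule form_le_of_means[OF KR that u w])
      (use avg degR miss S t \<sigma> h0 k D in \<open>simp_all add: k_def\<close>)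
  have mk: "m \<le> \<sigma>\<^sup>2" "k * m \<le> \<sigma>\<^sup>2"
  proof -
    have "1 * m \<le> k * m" using k m by (intro mult_right_mono) auto
    then show "m \<le> \<sigma>\<^sup>2" "k * m \<le> \<sigma>\<^sup>2" unfolding \<sigma>(2) by (auto intro: order_trans[of _ "k * m"])
  qed
  have \<delta>0: "0 \<le> \<delta>" using t m by (smt (verit) mult_neg_pos)
  have hs: "h * \<sigma> \<le> \<sigma> / 4" using h0 \<sigma> by simp
  have c1: "c \<le> k / 2" "c \<le> \<sigma> / 128" using gap(1) small(1) hs by simp_all
  have cU: "0 < \<sigma> + \<epsilon> * c - cU" if "\<epsilon> = 1 \<or> \<epsilon> = - 1" for \<epsilon> :: real
  proof -
    have "k * t \<le> k * (\<delta> * m)" using t k by (intro mult_left_mono) auto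
    also have "\<dots> = \<delta> * (k * m)" by simp
    also have "\<dots> \<le> \<delta> * \<sigma>\<^sup>2" using mk \<delta>0 by (intro mult_left_mono)
    finally have "t * ?\<tau> \<le> 32 * (\<delta> * \<sigma>)" using \<sigma>(1) by (simp add: field_simps power2_eq_square)
    also have "\<dots> \<le> h / 6 * \<sigma>"
    proof -
      have "8 * \<delta> \<le> 8 * k * \<delta>" using k \<delta>0 mult_right_mono[of 1 k "8 * \<delta>"] by simp
      also have "\<dots> \<le> h / 24" using small(3) h0 by (simp add: field_simps)
      finally have "32 * \<delta> \<le> h / 6" by simp
      then have "32 * \<delta> * \<sigma> \<le> h / 6 * \<sigma>" using \<sigma> by (intro mult_right_mono) auto
      then show ?thesis by simp
    qed
    finally have "t * ?\<tau> \<le> h / 6 * \<sigma>" .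
    moreover have "0 < h * \<sigma>" using h0 \<sigma> by simp
    moreover have "- c \<le> \<epsilon> * c" using that c0 by auto
    ultimately show ?thesis unfolding cU_def using small(1) c1 by (simp add: algebra_simps)
  qed
  have cW: "0 < \<sigma> + \<epsilon> * c - cW" if "\<epsilon> = 1 \<or> \<epsilon> = - 1" for \<epsilon> :: real
  proof -
    have "t \<le> \<delta> * \<sigma>\<^sup>2" using t mk \<delta>0 mult_left_mono[of m "\<sigma>\<^sup>2" \<delta>] by linarith
    then have "t * (64 * (D + 1)) \<le> \<delta> * \<sigma>\<^sup>2 * (64 * (D + 1))" using D by (intro mult_right_mono) auto
    also have "\<dots> = (64 * (D + 1) * \<delta>) * \<sigma>\<^sup>2" by simp
    also have "\<dots> \<le> 1 / 32 * \<sigma>\<^sup>2" using small(6) by (intro mult_right_mono) auto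
    finally have "t / ?\<theta> \<le> \<sigma> / 32" using \<sigma>(1) by (simp add: field_simps power2_eq_square)
    moreover have "?\<theta> * D \<le> \<sigma> / 64" using \<sigma>(1) D by (simp add: field_simps)
    moreover have "k / ?\<tau> = \<sigma> / 32" using k by simp
    moreover have "- c \<le> \<epsilon> * c" using that c0 by auto
    ultimately show ?thesis unfolding cW_def using \<sigma>(1) c1 by linarith
  qed
  \<comment> \<open>The unit norm \<open>one\<close>, multiplied by
    \<open>\<sigma> + \<epsilon> * c\<close>, is distributed over \<open>p\<close>,
    \<open>q\<close>, \<open>U\<close> and \<open>W\<close> before \<open>main\<close> is
    subtracted. On \<open>p\<close> this leaves \<open>\<sigma> - \<epsilon> * c\<close>, since the
    average degree is \<open>2 * c\<close>.\<close>
  have lower: "\<sigma> - \<epsilon> * (l - c) \<ge>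
      ((k * (\<sigma> - \<epsilon> * c) - (k * v / (\<sigma> * (1 - h)) + k * z / (3 / 4 * \<sigma>))) * p\<^sup>2
        + (m * (\<sigma> + \<epsilon> * c) - B) * q\<^sup>2 - 2 * (k * m - z) * \<bar>p * q\<bar>)
      + ((\<sigma> + \<epsilon> * c - cU) * U + (\<sigma> + \<epsilon> * c - cW) * W)"
    if \<epsilon>: "\<epsilon> = 1 \<or> \<epsilon> = - 1" for \<epsilon> :: real
  proof -
    have "(\<sigma> + \<epsilon> * c) * (k * p\<^sup>2 + U + (m * q\<^sup>2 + W)) = \<sigma> + \<epsilon> * c"
      unfolding one[symmetric] by simp
    then show ?thesis using main[OF \<epsilon>] by (simp add: algebra_simps)
  qed
  note det = perturbed_determinant[OF k m \<sigma> _ c0 gap(1) v0 vc gap' t E h small(1-5), folded B_def]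
  have weak: "0 \<le> \<sigma> - \<epsilon> * (l - c)" if \<epsilon>: "\<epsilon> = 1 \<or> \<epsilon> = - 1" for \<epsilon> :: real
  proof -
    have "0 \<le> (\<sigma> + \<epsilon> * c - cU) * U + (\<sigma> + \<epsilon> * c - cW) * W"
      using cU[OF \<epsilon>] cW[OF \<epsilon>] UW by (intro add_nonneg_nonneg mult_nonneg_nonneg) auto
    then show ?thesis using lower[OF \<epsilon>] binary_form_nonneg(1)[OF det(1,2)[OF \<epsilon>], of p q] by linarith
  qed
  show "\<bar>l - c\<bar> \<le> \<sigma>" using weak[of 1] weak[of "-1"] by auto
  assume "z > 0 \<or> \<not> (\<forall>i\<in>K. \<forall>j\<in>K. i \<noteq> j \<longrightarrow> a i j = 1)"
  moreover have "2 * c < k - 1" if "\<not> (\<forall>i\<in>K. \<forall>j\<in>K. i \<noteq> j \<longrightarrow> a i j = 1)"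
  proof -
    have "0 < 2 / k" using k by simp
    then show ?thesis using gap(3)[OF that] by linarith
  qed
  ultimately have ne: "z > 0 \<or> 2 * c < k - 1" by blast
  have strict: "0 < \<sigma> - \<epsilon> * (l - c)" if \<epsilon>: "\<epsilon> = 1 \<or> \<epsilon> = - 1" for \<epsilon> :: real
  proof (cases "p \<noteq> 0 \<or> q \<noteq> 0")
    case True
    have "0 \<le> (\<sigma> + \<epsilon> * c - cU) * U + (\<sigma> + \<epsilon> * c - cW) * W"
      using cU[OF \<epsilon>] cW[OF \<epsilon>] UW by (intro add_nonneg_nonneg mult_nonneg_nonneg) auto
    then show ?thesis
      using lower[OF \<epsilon>] binary_form_nonneg(2)[OF det(1,2)[OF \<epsilon>] det(3)[OF \<epsilon> ne] True] by linarith
  next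
    case False
    then have "U + W = 1" using one by simp
    then have "0 < U \<or> 0 < W" using UW by auto
    then have "0 < (\<sigma> + \<epsilon> * c - cU) * U + (\<sigma> + \<epsilon> * c - cW) * W"
      using cU[OF \<epsilon>] cW[OF \<epsilon>] UW by (auto intro: add_pos_nonneg add_nonneg_pos)
    then show ?thesis using lower[OF \<epsilon>] False by simp
  qed
  show "\<bar>l - c\<bar> < \<sigma>" using strict[of 1] strict[of "-1"] by auto
qed

end

section \<open>From common neighbours to a centred spectrum\<close>

definition clique_joined :: "'a set \<Rightarrow> ('a \<Rightarrow> 'a \<Rightarrow> real) \<Rightarrow> nat \<Rightarrow> bool" where
  "clique_joined V a k \<longleftrightarrow> (\<exists>K\<subseteq>V. card K = k \<and>
     (\<forall>i\<in>V. \<forall>j\<in>V. i \<noteq> j \<longrightarrow> (a i j = 1 \<longleftrightarrow> i \<in> K \<or> j \<in> K)))"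

text \<open>Besides degeneracy, the spectral part uses only these two consequences of excluding a complete minor
  on \<open>k + 2\<close> vertices.\<close>
locale few_common_nbrs = degenerate_graph V a D
  for V :: "'a set" and a :: "'a \<Rightarrow> 'a \<Rightarrow> real" and D :: real +
  fixes k :: nat
  assumes independent: "K \<subseteq> V \<Longrightarrow> card K = k \<Longrightarrow> C \<subseteq> V - K \<Longrightarrow> (\<And>i c. i \<in> K \<Longrightarrow> c \<in> C \<Longrightarrow> a i c = 1)
      \<Longrightarrow> k + 2 \<le> card C \<Longrightarrow> c \<in> C \<Longrightarrow> c' \<in> C \<Longrightarrow> a c c' = 0"
    and at_most_one: "K \<subseteq> V \<Longrightarrow> card K = k \<Longrightarrow> C \<subseteq> V - K \<Longrightarrow> (\<And>i c. i \<in> K \<Longrightarrow> c \<in> C \<Longrightarrow> a i c = 1)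
      \<Longrightarrow> k + 2 \<le> card C \<Longrightarrow> v \<in> V - K - C \<Longrightarrow> (\<Sum>c\<in>C. a v c) \<le> 1"
begin

text \<open>Otherwise any \<open>s\<close> in \<open>S\<close> is adjacent to at least
  \<open>k + 2\<close> common neighbours of the other \<open>k\<close> vertices, against
  \<open>at_most_one\<close>. This supplies the bound \<open>m\<close> for
  \<open>stability\<close>.\<close>

lemma common_nbrs_card_le:
  assumes S: "S \<subseteq> V" "card S = k + 1"
  shows "card {v\<in>V - S. \<forall>i\<in>S. a i v = 1} \<le> k + 1"
proof (rule ccontr)
  let ?C = "{v\<in>V - S. \<forall>i\<in>S. a i v = 1}"
  assume "\<not> ?thesis"
  then have C: "k + 2 \<le> card ?C" by simp
  obtain s where s: "s \<in> S" using S(2) by fastforce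
  have "finite S" using S finite_sub by auto
  then have "card (S - {s}) = k" using s S(2) by simp
  then have "(\<Sum>c\<in>?C. a s c) \<le> 1"
    using S s C by (intro at_most_one[of "S - {s}" ?C s]) auto
  moreover have "(\<Sum>c\<in>?C. a s c) = (\<Sum>c\<in>?C. 1)" using s by (intro sum.cong) auto
  ultimately show False using C by simp
qed

text \<open>The perturbation is measured by the set \<open>T\<close> of vertices outside
  \<open>K\<close> that are not joined to all of \<open>K\<close>. As \<open>C\<close> is
  independent, every edge inside \<open>R\<close> has an end in \<open>T\<close>; edges between
  \<open>T\<close> and \<open>C\<close> contribute at most \<open>2 * t\<close> to the degree sum
  and those inside \<open>T\<close> at most \<open>4 * D * t\<close>, whence \<open>E\<close>. Each
  vertex of \<open>T\<close> misses between 1 and \<open>k\<close> edges to \<open>K\<close>, so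
  \<open>z\<close> and \<open>t\<close> are comparable.\<close>

lemma eigenvalue_near_center_of_common_nbrs:
  fixes K :: "'a set" and x :: "'a \<Rightarrow> real" and l c \<delta> h \<sigma> :: real
  defines "n \<equiv> real (card V)" and "E \<equiv> 4 * D + 2"
  assumes k: "k \<ge> 1" and K: "K \<subseteq> V" "card K = k"
    and large: "(1 - \<delta>) * n \<le> card {v\<in>V - K. \<forall>i\<in>K. a i v = 1}"
      "k + 2 \<le> card {v\<in>V - K. \<forall>i\<in>K. a i v = 1}"
    and eig: "\<And>i. i \<in> V \<Longrightarrow> (\<Sum>j\<in>V. a i j * x j) = l * x i" and x: "(\<Sum>i\<in>V. (x i)\<^sup>2) = 1"
    and avg: "2 * c * real k = (\<Sum>i\<in>K. deg K i)"
    and \<sigma>: "\<sigma> > 0" "\<sigma>\<^sup>2 = real k * (n - k) + (real k - 1)\<^sup>2 / 4"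
    and h: "h = 1 / (4 * real k ^ 4)" and small: "real k \<le> h / 16 * \<sigma>"
      "\<delta> \<le> 1 / 24" "8 * real k * \<delta> / h \<le> 1 / 24" "64 * E * \<delta> \<le> 1 / 24" "2 * E * \<sigma> \<le> (n - k) / 24"
      "64 * (D + 1) * \<delta> \<le> 1 / 32"
  shows "\<bar>l - c\<bar> \<le> \<sigma>" and "\<not> clique_joined V a k \<Longrightarrow> \<bar>l - c\<bar> < \<sigma>"
proof -
  define C where "C = {v\<in>V - K. \<forall>i\<in>K. a i v = 1}"
  define R where "R = V - K"
  define T where "T = R - C"
  define t where "t = real (card T)"
  define z where "z = (\<Sum>i\<in>K. \<Sum>v\<in>R. 1 - a i v)"
  have finK: "finite K" and finR: "finite R" and finC: "finite C" and finT: "finite T"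
    using K finite_sub fin unfolding R_def C_def T_def by auto
  have CR: "C \<subseteq> V - K" "C \<subseteq> R" unfolding C_def R_def by auto
  have adj: "a i c = 1" if "i \<in> K" "c \<in> C" for i c using that unfolding C_def by auto
  have big: "k + 2 \<le> card C" using large(2) unfolding C_def by simp
  have ind: "a c c' = 0" if "c \<in> C" "c' \<in> C" for c c'
    using independent[OF K CR(1) adj big that] .
  have one: "(\<Sum>c\<in>C. a v c) \<le> 1" if "v \<in> T" for v
    using at_most_one[OF K CR(1) adj big] that unfolding T_def R_def by auto
  have V: "V = K \<union> R" "K \<inter> R = {}" "K \<noteq> {}" "R \<noteq> {}"
    using K k CR big unfolding R_def by (auto simp: card_gt_0_iff)
  have m: "real (card R) = n - k"
    unfolding R_def n_def using K finK fin card_mono[OF fin K(1)] by (simp add: card_Diff_subset of_nat_diff)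
  have RT: "R = C \<union> T" "C \<inter> T = {}" using CR unfolding T_def by auto
  have split: "(\<Sum>v\<in>R. f v) = (\<Sum>v\<in>C. f v) + (\<Sum>v\<in>T. f v)" for f :: "'a \<Rightarrow> real"
    unfolding RT(1) using finC finT RT(2) by (intro sum.union_disjoint)
  have t0: "0 \<le> t" unfolding t_def by simp
  have degC: "deg R v \<le> t" if v: "v \<in> C" for v
  proof -
    have "(\<Sum>u\<in>C. a v u) = 0" using ind v by (intro sum.neutral) auto
    moreover have "(\<Sum>u\<in>T. a v u) \<le> (\<Sum>u\<in>T. 1)" using le_one by (intro sum_mono)
    ultimately show ?thesis unfolding split t_def by simp
  qed
  \<comment> \<open>At most \<open>t - 1\<close> neighbours in \<open>T\<close> and one in
    \<open>C\<close>, so \<open>t\<close> bounds the degrees on both parts of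
    \<open>R\<close>.\<close>
  have degT: "deg R v \<le> t" if v: "v \<in> T" for v
  proof -
    have "(\<Sum>u\<in>T. a v u) = (\<Sum>u\<in>T - {v}. a v u)" using v finT diag by (simp add: sum.remove)
    also have "\<dots> \<le> (\<Sum>u\<in>T - {v}. 1)" using le_one by (intro sum_mono)
    also have "\<dots> = t - 1" unfolding t_def using v finT card_gt_0_iff[of T]
      by (auto simp: card_Diff_singleton of_nat_diff Suc_leI)
    finally show ?thesis using one[OF v] unfolding split by linarith
  qed
  have degR: "deg R v \<le> t" if "v \<in> R" for v using that degC degT RT by blast
  have b0: "0 \<le> 1 - a i v" "1 - a i v \<le> 1" for i v using nonneg[of i v] le_one[of i v] by auto
  have missC: "(\<Sum>v\<in>R. 1 - a i v) = (\<Sum>v\<in>T. 1 - a i v)" if "i \<in> K" for i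
    unfolding split using adj[OF that] by simp
  have miss: "(\<Sum>v\<in>R. 1 - a i v) \<le> t" if "i \<in> K" for i
  proof -
    have "(\<Sum>v\<in>T. 1 - a i v) \<le> (\<Sum>v\<in>T. 1)" using b0 by (intro sum_mono)
    then show ?thesis unfolding missC[OF that] t_def by simp
  qed
  have S: "(\<Sum>v\<in>R. deg R v) \<le> E * t"
  proof -
    have CC: "(\<Sum>v\<in>C. \<Sum>u\<in>C. a v u) = 0" using ind by (intro sum.neutral ballI) auto
    have CT: "(\<Sum>v\<in>C. \<Sum>u\<in>T. a v u) = (\<Sum>v\<in>T. \<Sum>u\<in>C. a v u)"
      by (subst sum.swap) (intro sum.cong HOL.refl, simp add: sym)
    have "(\<Sum>v\<in>T. \<Sum>u\<in>C. a v u) \<le> (\<Sum>v\<in>T. 1)" using one by (intro sum_mono)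
    moreover have "(\<Sum>v\<in>T. \<Sum>u\<in>T. a v u) \<le> 4 * D * t"
      unfolding t_def by (rule total_degree_le) (auto simp: T_def R_def)
    ultimately show ?thesis
      unfolding split sum.distrib CC CT E_def t_def by (simp add: algebra_simps)
  qed
  have tm: "t \<le> \<delta> * card R"
  proof -
    have "card R = card C + card T" unfolding RT(1) using finC finT RT(2) by (intro card_Un_disjoint)
    then have "t = (n - k) - card C" unfolding t_def m[symmetric] by simp
    also have "\<dots> \<le> (n - k) - (1 - \<delta>) * n" using large(1) unfolding C_def by simp
    also have "\<dots> = \<delta> * n - k" by (simp add: algebra_simps)
    also have "\<dots> \<le> \<delta> * n - \<delta> * k"
    proof -
      have "\<delta> * real k \<le> 1 * real k" using small(2) by (intro mult_right_mono) auto
      then show ?thesis by simp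
    qed
    finally show ?thesis unfolding m by (simp add: algebra_simps)
  qed
  have z: "z = (\<Sum>v\<in>T. \<Sum>i\<in>K. 1 - a i v)"
  proof -
    have "z = (\<Sum>i\<in>K. \<Sum>v\<in>T. 1 - a i v)" unfolding z_def by (intro sum.cong missC HOL.refl)
    also have "\<dots> = (\<Sum>v\<in>T. \<Sum>i\<in>K. 1 - a i v)" by (rule sum.swap)
    finally show ?thesis .
  qed
  have tz: "t \<le> z"
  proof -
    have "(\<Sum>v\<in>T. 1) \<le> (\<Sum>v\<in>T. \<Sum>i\<in>K. 1 - a i v)"
    proof (intro sum_mono)
      fix v assume "v \<in> T"
      then obtain i where i: "i \<in> K" "a i v \<noteq> 1" unfolding T_def C_def R_def by auto
      then have "a i v = 0" using zero_one by blast
      then have "1 = 1 - a i v" by simp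
      also have "\<dots> \<le> (\<Sum>i\<in>K. 1 - a i v)" using i b0 finK by (intro member_le_sum) auto
      finally show "1 \<le> (\<Sum>i\<in>K. 1 - a i v)" .
    qed
    then show ?thesis unfolding z t_def by simp
  qed
  have zt: "z \<le> k * t"
  proof -
    have "(\<Sum>v\<in>T. \<Sum>i\<in>K. 1 - a i v) \<le> (\<Sum>v\<in>T. \<Sum>i\<in>K. 1)" using b0 by (intro sum_mono)
    then show ?thesis unfolding z t_def using K by (simp add: mult.commute)
  qed
  have "deg V v \<ge> 0" for v using nonneg by (simp add: sum_nonneg)
  moreover obtain v0 where "deg V v0 \<le> D" using degenerate[of V] V by auto
  ultimately have "0 \<le> D" using order_trans by blast
  then have E0: "0 \<le> E" unfolding E_def by simp
  note near = eigenvalue_near_center[OF V eig x, of c t E \<sigma> \<delta> h, unfolded K(2) m, folded z_def,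
      OF _ avg degR miss S \<sigma> t0 tm[unfolded m] tz zt E0 h small]
  show "\<bar>l - c\<bar> \<le> \<sigma>" by (rule near(1))
  assume nj: "\<not> clique_joined V a k"
  \<comment> \<open>If \<open>K\<close> is complete and \<open>z = 0\<close>, then \<open>T\<close>
    is empty, so \<open>R = C\<close> is independent and fully joined to \<open>K\<close>.\<close>
  have "0 < z \<or> \<not> (\<forall>i\<in>K. \<forall>j\<in>K. i \<noteq> j \<longrightarrow> a i j = 1)"
  proof (rule ccontr)
    assume "\<not> (0 < z \<or> \<not> (\<forall>i\<in>K. \<forall>j\<in>K. i \<noteq> j \<longrightarrow> a i j = 1))"
    then have "t \<le> 0" and com: "\<forall>i\<in>K. \<forall>j\<in>K. i \<noteq> j \<longrightarrow> a i j = 1" using tz by auto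
    then have "T = {}" unfolding t_def using finT by simp
    then have RC: "R = C" using RT by auto
    have "clique_joined V a k" unfolding clique_joined_def
    proof (intro exI[of _ K] conjI ballI impI K)
      fix i j assume ij: "i \<in> V" "j \<in> V" "i \<noteq> j"
      show "a i j = 1 \<longleftrightarrow> i \<in> K \<or> j \<in> K"
      proof
        assume "a i j = 1"
        then show "i \<in> K \<or> j \<in> K" using ij ind[of i j] RC unfolding R_def by auto
      next
        assume "i \<in> K \<or> j \<in> K"
        then show "a i j = 1" using ij com adj sym[of i j] RC unfolding R_def by (metis DiffI)
      qed
    qed
    then show False using nj by simp
  qed
  from near(2)[OF _ _ _ this] show "\<bar>l - c\<bar> < \<sigma>" by blast
qed

end

text \<open>A single eigenvalue that is large in absolute value suffices to find \<open>K\<close>;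
  the centre obtained from \<open>K\<close> then serves all eigenvalues of the graph.\<close>

theorem spectrum_centered:
  fixes k :: nat and D :: real
  assumes k: "k \<ge> 1" and D: "0 \<le> D"
  shows "\<exists>n0. \<forall>(V :: 'a set) a. few_common_nbrs V a D k \<and> n0 \<le> card V \<longrightarrow>
    (\<exists>c. \<forall>x l. (\<forall>i\<in>V. (\<Sum>j\<in>V. a i j * x j) = l * x i) \<and> (\<Sum>i\<in>V. (x i)\<^sup>2) = 1 \<longrightarrow>
      \<bar>l - c\<bar> \<le> sqrt (real k * (real (card V) - k) + (real k - 1)\<^sup>2 / 4) \<and>
      (\<not> clique_joined V a k \<longrightarrow>
        \<bar>l - c\<bar> < sqrt (real k * (real (card V) - k) + (real k - 1)\<^sup>2 / 4)))"
proof -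
  define E where "E = 4 * D + 2"
  define h where "h = 1 / (4 * real k ^ 4)"
  have kr: "real k \<ge> 1" using k by simp
  have h0: "0 < h" unfolding h_def using kr by simp
  \<comment> \<open>Each summand is the reciprocal bound on \<delta> from one smallness condition:
    \<open>192 = 8 * 24\<close>, \<open>1536 = 64 * 24\<close> and
    \<open>2048 = 64 * 32\<close>.\<close>
  define P where "P = 24 + 192 * real k / h + 1536 * E + 2048 * (D + 1)"
  define \<delta> where "\<delta> = 1 / P"
  have E0: "0 \<le> E" unfolding E_def using D by simp
  have parts: "24 \<le> P" "192 * real k / h \<le> P" "1536 * E \<le> P" "2048 * (D + 1) \<le> P"
    unfolding P_def using h0 E0 D kr by auto
  have P0: "P > 0" using parts(1) by simp
  have frac: "y * \<delta> \<le> 1" if "y \<le> P" for y unfolding \<delta>_def using that P0 by simp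
  have \<delta>: "0 < \<delta>" "\<delta> < 1" "\<delta> \<le> 1 / 24" "8 * real k * \<delta> / h \<le> 1 / 24" "64 * E * \<delta> \<le> 1 / 24"
    "64 * (D + 1) * \<delta> \<le> 1 / 32"
  proof -
    show "0 < \<delta>" unfolding \<delta>_def using P0 by simp
    show "\<delta> \<le> 1 / 24" using frac[OF parts(1)] by simp
    then show "\<delta> < 1" by simp
    show "8 * real k * \<delta> / h \<le> 1 / 24" using frac[OF parts(2)] h0 by (simp add: field_simps)
    show "64 * E * \<delta> \<le> 1 / 24" using frac[OF parts(3)] by simp
    show "64 * (D + 1) * \<delta> \<le> 1 / 32" using frac[OF parts(4)] by (simp add: algebra_simps)
  qed
  obtain n1 where n1: "\<forall>(V :: 'a set) a x l. degenerate_graph V a D \<and> n1 \<le> card V \<and>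
    (\<forall>S. S \<subseteq> V \<and> card S = k + 1 \<longrightarrow> card {v\<in>V - S. \<forall>i\<in>S. a i v = 1} \<le> k + 1) \<and>
    (\<forall>i\<in>V. (\<Sum>j\<in>V. a i j * x j) = l * x i) \<and> (\<Sum>i\<in>V. (x i)\<^sup>2) = 1 \<and>
    real k * (real (card V) - real k) \<le> l\<^sup>2 \<longrightarrow>
    (\<exists>K\<subseteq>V. card K = k \<and> (1 - \<delta>) * card V \<le> card {v\<in>V - K. \<forall>i\<in>K. a i v = 1})"
    using stability[OF k \<delta>(1,2) D, of "k + 1"] by (rule exE)
  \<comment> \<open>The first summand makes \<open>\<sigma>\<close> at least
    \<open>16 * k / h\<close>; the second, through \<open>\<sigma> \<le> 2 * k * sqrt m\<close>,
    makes \<open>2 * E * \<sigma>\<close> at most \<open>m / 24\<close>.\<close>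
  define Q where "Q = 16 * real k / h + 96 * E * k"
  obtain n2 where n2: "\<forall>n\<ge>n2. Q \<le> sqrt (real n)" using sqrt_eventually_ge by blast
  show ?thesis
  proof (intro exI[of _ "n1 + n2 + 4 * k + 4"] allI impI, elim conjE)
    fix V :: "'a set" and a
    assume fc: "few_common_nbrs V a D k" and n: "n1 + n2 + 4 * k + 4 \<le> card V"
    interpret few_common_nbrs V a D k by fact
    define m where "m = real (card V) - k"
    define \<sigma> where "\<sigma> = sqrt (real k * m + (real k - 1)\<^sup>2 / 4)"
    have mk: "real k \<le> m" "0 < m" unfolding m_def using n by simp_all
    have km: "0 < real k * m" using mk kr by simp
    have \<sigma>2: "\<sigma>\<^sup>2 = real k * m + (real k - 1)\<^sup>2 / 4" unfolding \<sigma>_def using km by simp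
    have \<sigma>0: "\<sigma> > 0" unfolding \<sigma>_def using km by (simp add: add_pos_nonneg)
    have "\<exists>c. \<forall>x l. (\<forall>i\<in>V. (\<Sum>j\<in>V. a i j * x j) = l * x i) \<and> (\<Sum>i\<in>V. (x i)\<^sup>2) = 1 \<longrightarrow>
      \<bar>l - c\<bar> \<le> \<sigma> \<and> (\<not> clique_joined V a k \<longrightarrow> \<bar>l - c\<bar> < \<sigma>)"
    proof (cases "\<exists>x l. (\<forall>i\<in>V. (\<Sum>j\<in>V. a i j * x j) = l * x i) \<and> (\<Sum>i\<in>V. (x i)\<^sup>2) = 1 \<and>
        real k * m \<le> l\<^sup>2")
      case False
      have "\<bar>l - 0\<bar> < \<sigma>" if "\<forall>i\<in>V. (\<Sum>j\<in>V. a i j * x j) = l * x i" "(\<Sum>i\<in>V. (x i)\<^sup>2) = 1" for x l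
      proof -
        have "l\<^sup>2 < real k * m" using False that by force
        also have "\<dots> \<le> \<sigma>\<^sup>2" unfolding \<sigma>2 by simp
        finally have "\<bar>l\<bar>\<^sup>2 < \<sigma>\<^sup>2" by simp
        then show ?thesis using \<sigma>0 by (simp add: power2_less_imp_less)
      qed
      then show ?thesis by (intro exI[of _ 0]) (auto intro: less_imp_le)
    next
      case True
      then obtain y l0 where y: "\<forall>i\<in>V. (\<Sum>j\<in>V. a i j * y j) = l0 * y i" "(\<Sum>i\<in>V. (y i)\<^sup>2) = 1"
        "real k * (real (card V) - real k) \<le> l0\<^sup>2" unfolding m_def by (elim exE conjE)
      have "n1 \<le> card V" using n by simp
      then have "\<exists>K\<subseteq>V. card K = k \<and> (1 - \<delta>) * card V \<le> card {v\<in>V - K. \<forall>i\<in>K. a i v = 1}"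
        using degenerate_graph_axioms common_nbrs_card_le y
        by (intro n1[rule_format, of V a y l0] conjI allI impI) auto
      then obtain K where K: "K \<subseteq> V" "card K = k"
        and large: "(1 - \<delta>) * card V \<le> card {v\<in>V - K. \<forall>i\<in>K. a i v = 1}"
        by (elim exE conjE)
      have "k + 2 \<le> card {v\<in>V - K. \<forall>i\<in>K. a i v = 1}"
      proof -
        have "1 / 2 * real (card V) \<le> (1 - \<delta>) * card V" using \<delta>(3) by (intro mult_right_mono) auto
        then have "real (k + 2) \<le> card {v\<in>V - K. \<forall>i\<in>K. a i v = 1}" using large n by linarith
        then show ?thesis by (simp only: of_nat_le_iff)
      qed
      note large' = large this
      define r where "r = sqrt m"
      have rr: "r * r = m" "0 < r" unfolding r_def using mk by auto
      have "n2 \<le> card V - k" using n by linarith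
      then have "Q \<le> sqrt (real (card V - k))" using n2 by blast
      then have "Q \<le> r" unfolding r_def m_def using n by (simp add: of_nat_diff)
      moreover have "0 \<le> 16 * real k / h" "0 \<le> 96 * E * k" using h0 E0 by auto
      ultimately have Q: "16 * real k / h \<le> r" "96 * E * k \<le> r" unfolding Q_def by linarith+
      have r\<sigma>: "r \<le> \<sigma>" "\<sigma> \<le> 2 * k * r"
      proof -
        have "1 * m \<le> real k * m" using kr mk by (intro mult_right_mono) auto
        then have "m \<le> real k * m + (real k - 1)\<^sup>2 / 4" by (smt (verit) zero_le_power2 divide_nonneg_nonneg)
        then show "r \<le> \<sigma>" unfolding r_def \<sigma>_def by simp
        have "(real k - 1)\<^sup>2 / 4 \<le> real k * real k"
        proof -
          have "(real k - 1)\<^sup>2 \<le> (real k)\<^sup>2" using kr by (intro power_mono) auto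
          moreover have "0 \<le> real k * real k" by simp
          ultimately show ?thesis unfolding power2_eq_square by linarith
        qed
        also have "\<dots> \<le> real k * m" using mk by (intro mult_left_mono) auto
        finally have "\<sigma>\<^sup>2 \<le> 2 * (real k * m)" unfolding \<sigma>2 by linarith
        also have "\<dots> \<le> 4 * real k * (real k * m)" using km kr by (intro mult_right_mono) auto
        also have "\<dots> = (2 * k * r)\<^sup>2" unfolding rr(1)[symmetric] by (simp add: power2_eq_square)
        finally have "\<sigma>\<^sup>2 \<le> (2 * k * r)\<^sup>2" .
        then show "\<sigma> \<le> 2 * k * r" by (rule power2_le_imp_le) (use rr(2) in simp)
      qed
      have s1: "real k \<le> h / 16 * \<sigma>"
      proof -
        have "16 * real k / h \<le> \<sigma>" using Q(1) r\<sigma> by linarith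
        then show ?thesis using h0 by (simp add: field_simps)
      qed
      have s2: "2 * E * \<sigma> \<le> m / 24"
      proof -
        have "2 * E * \<sigma> \<le> 2 * E * (2 * k * r)" using r\<sigma> E0 by (intro mult_left_mono) auto
        also have "\<dots> = (96 * E * k) * r / 24" by simp
        also have "\<dots> \<le> r * r / 24" using Q(2) rr by (intro divide_right_mono mult_right_mono) auto
        finally show ?thesis unfolding rr .
      qed
      define c where "c = (\<Sum>i\<in>K. \<Sum>j\<in>K. a i j) / (2 * k)"
      have avg: "2 * c * real k = (\<Sum>i\<in>K. \<Sum>j\<in>K. a i j)" unfolding c_def using kr by simp
      show ?thesis
      proof (intro exI[of _ c] allI impI, elim conjE)
        fix x l
        assume x: "\<forall>i\<in>V. (\<Sum>j\<in>V. a i j * x j) = l * x i" "(\<Sum>i\<in>V. (x i)\<^sup>2) = 1"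
        note near = eigenvalue_near_center_of_common_nbrs[OF k K large' _ x(2) avg \<sigma>0, of l h,
            folded m_def E_def, OF _ \<sigma>2 h_def s1 \<delta>(3,4,5) s2 \<delta>(6)]
        show "\<bar>l - c\<bar> \<le> \<sigma> \<and> (\<not> clique_joined V a k \<longrightarrow> \<bar>l - c\<bar> < \<sigma>)"
          using near x(1) by blast
      qed
    qed
    then show "\<exists>c. \<forall>x l. (\<forall>i\<in>V. (\<Sum>j\<in>V. a i j * x j) = l * x i) \<and> (\<Sum>i\<in>V. (x i)\<^sup>2) = 1 \<longrightarrow>
      \<bar>l - c\<bar> \<le> sqrt (real k * (real (card V) - k) + (real k - 1)\<^sup>2 / 4) \<and>
      (\<not> clique_joined V a k \<longrightarrow>
        \<bar>l - c\<bar> < sqrt (real k * (real (card V) - k) + (real k - 1)\<^sup>2 / 4))"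
      unfolding \<sigma>_def m_def .
  qed
qed

section \<open>Spectra of adjacency matrices\<close>

definition adj_weight :: "'a set set \<Rightarrow> 'a \<Rightarrow> 'a \<Rightarrow> real" where
  "adj_weight E i j = of_bool ({i, j} \<in> E)"

lemma sum_adj_weight: "finite W \<Longrightarrow> (\<Sum>u\<in>W. adj_weight E v u) = card (nbrs E W v)"
  unfolding adj_weight_def nbrs_def of_bool_def by (simp add: sum.If_cases Int_def)

lemma few_common_nbrs_of_minor_free:
  assumes wf: "wf_graph V E" and nm: "\<not> has_complete_minor (k + 2) V E"
  shows "few_common_nbrs V (adj_weight E) (2 ^ (k + 3)) k"
proof
  show fin: "finite V" using wf unfolding wf_graph_def by auto
  show "adj_weight E i j = adj_weight E j i" for i j unfolding adj_weight_def by (simp add: insert_commute)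
  show "adj_weight E i i = 0" for i using wf_graph_no_loop[OF wf] unfolding adj_weight_def by simp
  show "adj_weight E i j = 0 \<or> adj_weight E i j = 1" for i j unfolding adj_weight_def by simp
  fix W assume W: "W \<subseteq> V" "W \<noteq> {}"
  \<comment> \<open>The degree bound for excluded order \<open>r = k + 2\<close> is
    \<open>2 ^ (r + 1)\<close>, which explains the value of \<open>D\<close>.\<close>
  have "k + 2 + 1 = k + 3" by simp
  with exists_low_degree_vertex[OF wf nm W] obtain v where v: "v \<in> W" "card (nbrs E W v) \<le> 2 ^ (k + 3)"
    by metis
  have "finite W" using W(1) fin by (rule finite_subset)
  then have "(\<Sum>u\<in>W. adj_weight E v u) \<le> 2 ^ (k + 3)"
  proof -
    have "real (card (nbrs E W v)) \<le> real (2 ^ (k + 3))" using v(2) by (simp only: of_nat_le_iff)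
    then show ?thesis using \<open>finite W\<close> by (simp add: sum_adj_weight)
  qed
  then show "\<exists>v\<in>W. (\<Sum>u\<in>W. adj_weight E v u) \<le> 2 ^ (k + 3)" using v(1) by blast
next
  fix K C assume K: "K \<subseteq> V" "card K = k" and C: "C \<subseteq> V - K"
    and adj: "\<And>i c. i \<in> K \<Longrightarrow> c \<in> C \<Longrightarrow> adj_weight E i c = 1" and big: "k + 2 \<le> card C"
  have adj': "{i, c} \<in> E" if "i \<in> K" "c \<in> C" for i c
    using adj[OF that] unfolding adj_weight_def by (simp split: if_splits add: of_bool_def)
  show "adj_weight E c c' = 0" if "c \<in> C" "c' \<in> C" for c c'
    using common_nbrs_independent[OF wf nm K C adj' big that] unfolding adj_weight_def by simp
  show "(\<Sum>c\<in>C. adj_weight E v c) \<le> 1" if v: "v \<in> V - K - C" for v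
  proof -
    have "finite V" using wf unfolding wf_graph_def by auto
    then have "finite C" using C finite_subset[of C V] by blast
    moreover have "card (nbrs E C v) \<le> 1"
      using v by (intro common_nbrs_at_most_one[OF wf nm K C adj' big]) auto
    ultimately show ?thesis by (simp add: sum_adj_weight)
  qed
qed

lemma adj_mat_carrier: "adj_mat n E \<in> carrier_mat n n"
  unfolding adj_mat_def by simp

lemma eigenvalue_adj_mat_iff:
  "eigenvalue (adj_mat n E) l \<longleftrightarrow> (\<exists>x. (\<exists>i<n. x i \<noteq> 0) \<and>
     (\<forall>i\<in>{0..<n}. (\<Sum>j\<in>{0..<n}. adj_weight E i j * x j) = l * x i))"
proof
  assume "eigenvalue (adj_mat n E) l"
  then obtain v where v: "v \<in> carrier_vec n" "v \<noteq> 0\<^sub>v n" "adj_mat n E *\<^sub>v v = l \<cdot>\<^sub>v v"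
    unfolding eigenvalue_def eigenvector_def adj_mat_def by auto
  have "\<exists>i<n. v $ i \<noteq> 0" using v(1,2) by (metis carrier_vecD eq_vecI index_zero_vec)
  moreover have "(\<Sum>j\<in>{0..<n}. adj_weight E i j * v $ j) = l * v $ i" if "i < n" for i
  proof -
    have "(adj_mat n E *\<^sub>v v) $ i = (l \<cdot>\<^sub>v v) $ i" using v(3) by simp
    then show ?thesis using that v(1) unfolding adj_mat_def adj_weight_def
      by (simp add: scalar_prod_def of_bool_def)
  qed
  ultimately show "\<exists>x. (\<exists>i<n. x i \<noteq> 0) \<and>
     (\<forall>i\<in>{0..<n}. (\<Sum>j\<in>{0..<n}. adj_weight E i j * x j) = l * x i)"
    by (intro exI[of _ "\<lambda>i. v $ i"]) auto
next
  assume "\<exists>x. (\<exists>i<n. x i \<noteq> 0) \<and>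
     (\<forall>i\<in>{0..<n}. (\<Sum>j\<in>{0..<n}. adj_weight E i j * x j) = l * x i)"
  then obtain x where x: "\<exists>i<n. x i \<noteq> 0"
    "\<forall>i\<in>{0..<n}. (\<Sum>j\<in>{0..<n}. adj_weight E i j * x j) = l * x i" by blast
  have "eigenvector (adj_mat n E) (vec n x) l" unfolding eigenvector_def
  proof (intro conjI)
    show "vec n x \<in> carrier_vec (dim_row (adj_mat n E))" unfolding adj_mat_def by simp
    show "vec n x \<noteq> 0\<^sub>v (dim_row (adj_mat n E))"
      using x(1) unfolding adj_mat_def by (metis dim_row_mat(1) index_vec index_zero_vec(1))
    show "adj_mat n E *\<^sub>v vec n x = l \<cdot>\<^sub>v vec n x"
    proof (rule eq_vecI)
      fix i assume "i < dim_vec (l \<cdot>\<^sub>v vec n x)"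
      then have i: "i < n" by simp
      then have "(\<Sum>j\<in>{0..<n}. adj_weight E i j * x j) = l * x i" using x(2) by simp
      then show "(adj_mat n E *\<^sub>v vec n x) $ i = (l \<cdot>\<^sub>v vec n x) $ i"
        using i unfolding adj_mat_def adj_weight_def by (simp add: scalar_prod_def of_bool_def)
    qed (simp add: adj_mat_def)
  qed
  then show "eigenvalue (adj_mat n E) l" unfolding eigenvalue_def by blast
qed

lemma eigenvalue_adj_mat_unit:
  assumes "eigenvalue (adj_mat n E) l"
  obtains x where "\<forall>i\<in>{0..<n}. (\<Sum>j\<in>{0..<n}. adj_weight E i j * x j) = l * x i"
    "(\<Sum>i\<in>{0..<n}. (x i)\<^sup>2) = 1"
proof -
  obtain y where y: "\<exists>i<n. y i \<noteq> 0"
    "\<forall>i\<in>{0..<n}. (\<Sum>j\<in>{0..<n}. adj_weight E i j * y j) = l * y i"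
    using assms unfolding eigenvalue_adj_mat_iff by blast
  define s where "s = (\<Sum>i\<in>{0..<n}. (y i)\<^sup>2)"
  obtain i0 where i0: "i0 < n" "y i0 \<noteq> 0" using y(1) by blast
  have "0 < (y i0)\<^sup>2" using i0 by simp
  also have "\<dots> \<le> s" unfolding s_def using i0 by (intro member_le_sum) auto
  finally have s: "s > 0" .
  show thesis
  proof (rule that[of "\<lambda>i. y i / sqrt s"])
    show "\<forall>i\<in>{0..<n}. (\<Sum>j\<in>{0..<n}. adj_weight E i j * (y j / sqrt s)) = l * (y i / sqrt s)"
      using y(2) by (simp add: sum_divide_distrib[symmetric])
    have "(\<Sum>i\<in>{0..<n}. (y i / sqrt s)\<^sup>2) = s / s"
      unfolding power_divide using s by (simp add: s_def sum_divide_distrib[symmetric])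
    then show "(\<Sum>i\<in>{0..<n}. (y i / sqrt s)\<^sup>2) = 1" using s by simp
  qed
qed

lemma finite_eigenvalues: "finite {l. eigenvalue (adj_mat n E) l}"
  using card_finite_spectrum(1)[OF adj_mat_carrier, of n E] unfolding spectrum_def by simp

text \<open>Conjugation followed by exchanging the two indices maps the sum to itself.\<close>

lemma cnj_quadratic_form_real:
  fixes z :: "nat \<Rightarrow> complex" and a :: "nat \<Rightarrow> nat \<Rightarrow> real"
  assumes "\<And>i j. a i j = a j i"
  shows "Im (\<Sum>i\<in>A. \<Sum>j\<in>A. cnj (z i) * (of_real (a i j) * z j)) = 0"
proof -
  let ?S = "\<Sum>i\<in>A. \<Sum>j\<in>A. cnj (z i) * (of_real (a i j) * z j)"
  have "cnj ?S = (\<Sum>i\<in>A. \<Sum>j\<in>A. z i * (of_real (a i j) * cnj (z j)))" by simp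
  also have "\<dots> = (\<Sum>i\<in>A. \<Sum>j\<in>A. cnj (z j) * (of_real (a j i) * z i))"
  proof (rule sum.cong[OF HOL.refl], rule sum.cong[OF HOL.refl])
    fix i j
    show "z i * (of_real (a i j) * cnj (z j)) = cnj (z j) * (of_real (a j i) * z i)"
      by (subst assms) simp
  qed
  also have "\<dots> = ?S" by (rule sum.swap)
  finally have "cnj ?S = ?S" .
  moreover have "Im s = 0" if "cnj s = s" for s using arg_cong[OF that, of Im] by simp
  ultimately show ?thesis by blast
qed

text \<open>A complex eigenvalue is real, so the real and imaginary parts of its eigenvector are again
  eigenvectors.\<close>
lemma exists_eigenvalue:
  assumes "n > 0"
  shows "\<exists>l. eigenvalue (adj_mat n E) l"
proof -
  define A :: "complex mat" where "A = mat n n (\<lambda>(i, j). of_real (adj_weight E i j))"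
  have "A \<in> carrier_mat n n" unfolding A_def by simp
  then obtain \<mu> where "eigenvalue A \<mu>"
    using spectrum_non_empty[OF _ assms] unfolding spectrum_def by auto
  then obtain v where v: "v \<in> carrier_vec n" "v \<noteq> 0\<^sub>v n" "A *\<^sub>v v = \<mu> \<cdot>\<^sub>v v"
    unfolding eigenvalue_def eigenvector_def A_def by auto
  define z where "z i = v $ i" for i
  have eq: "(\<Sum>j\<in>{0..<n}. of_real (adj_weight E i j) * z j) = \<mu> * z i" if "i < n" for i
  proof -
    have "(A *\<^sub>v v) $ i = (\<mu> \<cdot>\<^sub>v v) $ i" using v(3) by simp
    then show ?thesis using that v(1) unfolding A_def z_def by (simp add: scalar_prod_def)
  qed
  obtain i0 where i0: "i0 < n" "z i0 \<noteq> 0"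
    using v(1,2) unfolding z_def by (metis carrier_vecD eq_vecI index_zero_vec)
  let ?N = "\<Sum>i\<in>{0..<n}. (cmod (z i))\<^sup>2"
  have "0 < (cmod (z i0))\<^sup>2" using i0 by simp
  also have "\<dots> \<le> ?N" using i0 by (intro member_le_sum) auto
  finally have N: "?N > 0" .
  \<comment> \<open>Evaluating the Hermitian form at the eigenvector gives \<mu> times the positive
    squared norm, and the form is real.\<close>
  have "(\<Sum>i\<in>{0..<n}. \<Sum>j\<in>{0..<n}. cnj (z i) * (of_real (adj_weight E i j) * z j)) =
      (\<Sum>i\<in>{0..<n}. cnj (z i) * (\<mu> * z i))"
    unfolding sum_distrib_left[symmetric] by (intro sum.cong HOL.refl) (subst eq, auto)
  also have "\<dots> = \<mu> * of_real ?N"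
    by (simp add: sum_distrib_left complex_norm_square[symmetric] mult_ac)
  finally have "Im (\<mu> * of_real ?N) = 0"
    using cnj_quadratic_form_real[of "adj_weight E" z "{0..<n}"]
    by (simp add: adj_weight_def insert_commute)
  then have \<mu>: "\<mu> = of_real (Re \<mu>)" using N by (simp add: complex_eq_iff)
  have re: "(\<Sum>j\<in>{0..<n}. adj_weight E i j * Re (z j)) = Re \<mu> * Re (z i)"
    and im: "(\<Sum>j\<in>{0..<n}. adj_weight E i j * Im (z j)) = Re \<mu> * Im (z i)" if "i < n" for i
  proof -
    have "Im \<mu> = 0" using \<mu> by (metis Im_complex_of_real)
    then show "(\<Sum>j\<in>{0..<n}. adj_weight E i j * Re (z j)) = Re \<mu> * Re (z i)"
      "(\<Sum>j\<in>{0..<n}. adj_weight E i j * Im (z j)) = Re \<mu> * Im (z i)"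
      using arg_cong[OF eq[OF that], of Re] arg_cong[OF eq[OF that], of Im] by simp_all
  qed
  have "Re (z i0) \<noteq> 0 \<or> Im (z i0) \<noteq> 0" using i0(2) complex_eq_iff by force
  then have "eigenvalue (adj_mat n E) (Re \<mu>)" unfolding eigenvalue_adj_mat_iff
  proof
    assume "Re (z i0) \<noteq> 0"
    then show "\<exists>x. (\<exists>i<n. x i \<noteq> 0) \<and>
      (\<forall>i\<in>{0..<n}. (\<Sum>j\<in>{0..<n}. adj_weight E i j * x j) = Re \<mu> * x i)"
      using i0(1) re by (intro exI[of _ "\<lambda>i. Re (z i)"]) auto
  next
    assume "Im (z i0) \<noteq> 0"
    then show "\<exists>x. (\<exists>i<n. x i \<noteq> 0) \<and>
      (\<forall>i\<in>{0..<n}. (\<Sum>j\<in>{0..<n}. adj_weight E i j * x j) = Re \<mu> * x i)"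
      using i0(1) im by (intro exI[of _ "\<lambda>i. Im (z i)"]) auto
  qed
  then show ?thesis by blast
qed

text \<open>The eigenvector is \<open>l\<close> on \<open>K\<close> and \<open>k\<close> elsewhere.
  Outside \<open>K\<close> the eigenvalue equation then holds for any \<open>l\<close>, and on
  \<open>K\<close> it becomes the assumed quadratic equation. As \<open>k < n\<close>, the value
  \<open>k\<close> is attained, so the vector is nonzero.\<close>

lemma eigenvalue_of_clique_joined:
  assumes wf: "wf_graph {0..<n} E" and cj: "clique_joined {0..<n} (adj_weight E) k"
    and k: "k \<ge> 1" "k < n" and l: "l\<^sup>2 = (real k - 1) * l + real k * (real n - real k)"
  shows "eigenvalue (adj_mat n E) l"
proof -
  let ?V = "{0..<n}"
  obtain K where K: "K \<subseteq> ?V" "card K = k"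
    and adj: "\<And>i j. i \<in> ?V \<Longrightarrow> j \<in> ?V \<Longrightarrow> i \<noteq> j \<Longrightarrow> adj_weight E i j = 1 \<longleftrightarrow> i \<in> K \<or> j \<in> K"
    using cj unfolding clique_joined_def by blast
  have finK: "finite K" using K(1) finite_subset by blast
  have w: "adj_weight E i j = of_bool (i \<noteq> j \<and> (i \<in> K \<or> j \<in> K))" if "i \<in> ?V" "j \<in> ?V" for i j
    using adj[OF that] wf_graph_no_loop[OF wf] unfolding adj_weight_def by (cases "i = j") auto
  define x where "x i = (if i \<in> K then l else real k)" for i
  have split: "(\<Sum>j\<in>?V. f j) = (\<Sum>j\<in>K. f j) + (\<Sum>j\<in>?V - K. f j)" for f :: "nat \<Rightarrow> real"
    using sum.subset_diff[OF K(1), of f] by simp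
  have cR: "real (card (?V - K)) = real n - k"
    using K k finK by (simp add: card_Diff_subset of_nat_diff)
  have "(\<Sum>j\<in>?V. adj_weight E i j * x j) = l * x i" if i: "i \<in> ?V" for i
  proof (cases "i \<in> K")
    case True
    have "(\<Sum>j\<in>K. adj_weight E i j * x j) = (\<Sum>j\<in>K - {i}. l)"
      using True K i w finK by (intro sum.mono_neutral_cong_right) (auto simp: x_def)
    also have "\<dots> = (real k - 1) * l" using True K(2) k finK by (simp add: of_nat_diff)
    finally have 1: "(\<Sum>j\<in>K. adj_weight E i j * x j) = (real k - 1) * l" .
    have "(\<Sum>j\<in>?V - K. adj_weight E i j * x j) = (\<Sum>j\<in>?V - K. real k)"
      using True i w by (intro sum.cong) (auto simp: x_def)
    also have "\<dots> = real k * (real n - k)" using cR by simp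
    finally show ?thesis unfolding split 1 using True l by (simp add: x_def power2_eq_square)
  next
    case False
    have "(\<Sum>j\<in>K. adj_weight E i j * x j) = (\<Sum>j\<in>K. l)"
      using False K i w by (intro sum.cong) (auto simp: x_def)
    moreover have "(\<Sum>j\<in>?V - K. adj_weight E i j * x j) = 0"
      using False i w by (intro sum.neutral) auto
    ultimately show ?thesis unfolding split using False K(2) by (simp add: x_def)
  qed
  moreover have "\<exists>i<n. x i \<noteq> 0"
  proof -
    have "?V - K \<noteq> {}"
    proof
      assume "?V - K = {}"
      then have "real (card (?V - K)) = 0" by (simp only: card.empty of_nat_0)
      then show False using cR k by simp
    qed
    then obtain i where "i \<in> ?V - K" by blast
    then show ?thesis using k by (intro exI[of _ i]) (simp add: x_def)
  qed
  ultimately show ?thesis unfolding eigenvalue_adj_mat_iff by blast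
qed

section \<open>Recognising the extremal graph and bounding the spread\<close>

lemma join_clique_indep_edges_iff:
  "{i, j} \<in> join_clique_indep_edges k m \<longleftrightarrow> i < k + m \<and> j < k + m \<and> i \<noteq> j \<and> (i < k \<or> j < k)"
  unfolding join_clique_indep_edges_def by (auto simp: doubleton_eq_iff)

lemma clique_joined_iff_graph_iso:
  assumes wf: "wf_graph {0..<n} E" and k: "k \<le> n"
  shows "clique_joined {0..<n} (adj_weight E) k \<longleftrightarrow>
    graph_iso {0..<n} E {0..<n} (join_clique_indep_edges k (n - k))"
proof
  let ?V = "{0..<n}"
  assume "clique_joined ?V (adj_weight E) k"
  then obtain K where K: "K \<subseteq> ?V" "card K = k"
    and adj: "\<And>i j. i \<in> ?V \<Longrightarrow> j \<in> ?V \<Longrightarrow> i \<noteq> j \<Longrightarrow> adj_weight E i j = 1 \<longleftrightarrow> i \<in> K \<or> j \<in> K"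
    unfolding clique_joined_def by blast
  have finK: "finite K" using K(1) finite_subset by blast
  have edge: "{i, j} \<in> E \<longleftrightarrow> i \<noteq> j \<and> (i \<in> K \<or> j \<in> K)" if "i \<in> ?V" "j \<in> ?V" for i j
    using adj[OF that] wf_graph_no_loop[OF wf] unfolding adj_weight_def by (cases "i = j") auto
  obtain f where f: "bij_betw f K {0..<k}" using ex_bij_betw_finite_nat[OF finK] K(2) by auto
  have "card (?V - K) = card {k..<n}" using K finK by (simp add: card_Diff_subset)
  then obtain g where g: "bij_betw g (?V - K) {k..<n}"
    using finite_same_card_bij[of "?V - K" "{k..<n}"] by auto
  define h where "h x = (if x \<in> K then f x else g x)" for x
  have "bij_betw h K {0..<k}" using f by (simp add: h_def cong: bij_betw_cong)
  moreover have "bij_betw h (?V - K) {k..<n}"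
    using g bij_betw_cong[of "?V - K" h g "{k..<n}"] by (simp add: h_def)
  ultimately have "bij_betw h (K \<union> (?V - K)) ({0..<k} \<union> {k..<n})"
    by (rule bij_betw_combine) auto
  moreover have "K \<union> (?V - K) = ?V" "{0..<k} \<union> {k..<n} = ?V" using K(1) k by auto
  ultimately have h: "bij_betw h ?V ?V" by simp
  have hk: "h x < k \<longleftrightarrow> x \<in> K" if "x \<in> ?V" for x
  proof (cases "x \<in> K")
    case True
    then show ?thesis using bij_betwE[OF f] by (simp add: h_def)
  next
    case False
    then have "g x \<in> {k..<n}" using bij_betwE[OF g] that by blast
    then show ?thesis using False by (simp add: h_def)
  qed
  have "{x, y} \<in> E \<longleftrightarrow> {h x, h y} \<in> join_clique_indep_edges k (n - k)" if xy: "x \<in> ?V" "y \<in> ?V" for x y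
  proof -
    have "h x \<in> ?V" "h y \<in> ?V" using bij_betwE[OF h] xy by blast+
    moreover have "h x = h y \<longleftrightarrow> x = y" using inj_on_eq_iff[OF bij_betw_imp_inj_on[OF h]] xy by blast
    ultimately show ?thesis
      using k edge[OF xy] hk[OF xy(1)] hk[OF xy(2)] by (simp add: join_clique_indep_edges_iff)
  qed
  then show "graph_iso ?V E ?V (join_clique_indep_edges k (n - k))"
    unfolding graph_iso_def using h by blast
next
  let ?V = "{0..<n}"
  assume "graph_iso ?V E ?V (join_clique_indep_edges k (n - k))"
  then obtain f where f: "bij_betw f ?V ?V"
    and iso: "\<And>x y. x \<in> ?V \<Longrightarrow> y \<in> ?V \<Longrightarrow> {x, y} \<in> E \<longleftrightarrow> {f x, f y} \<in> join_clique_indep_edges k (n - k)"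
    unfolding graph_iso_def by blast
  define K where "K = {x\<in>?V. f x < k}"
  have inj: "inj_on f ?V" and img: "f ` ?V = ?V" using f unfolding bij_betw_def by auto
  have "f ` K = {0..<k}"
  proof
    show "f ` K \<subseteq> {0..<k}" unfolding K_def by auto
    show "{0..<k} \<subseteq> f ` K"
    proof
      fix y assume y: "y \<in> {0..<k}"
      then have "y \<in> f ` ?V" unfolding img using k by simp
      then show "y \<in> f ` K" using y unfolding K_def by auto
    qed
  qed
  moreover have "inj_on f K" using inj by (rule inj_on_subset) (auto simp: K_def)
  then have "card (f ` K) = card K" by (rule card_image)
  ultimately have "card K = k" by simp
  moreover have "adj_weight E i j = 1 \<longleftrightarrow> i \<in> K \<or> j \<in> K" if ij: "i \<in> ?V" "j \<in> ?V" "i \<noteq> j" for i j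
  proof -
    have "f i \<in> ?V" "f j \<in> ?V" using bij_betwE[OF f] ij by blast+
    moreover have "f i \<noteq> f j" using inj_on_eq_iff[OF inj ij(1,2)] ij(3) by simp
    ultimately have "{i, j} \<in> E \<longleftrightarrow> f i < k \<or> f j < k"
      using k iso[OF ij(1,2)] by (simp add: join_clique_indep_edges_iff)
    then show ?thesis using ij unfolding adj_weight_def K_def by simp
  qed
  ultimately show "clique_joined ?V (adj_weight E) k"
    unfolding clique_joined_def by (intro exI[of _ K]) (auto simp: K_def)
qed

theorem theorem1p1:
  fixes r :: nat
  assumes "r \<ge> 3"
  shows "\<exists>n0::nat. \<forall>n\<ge>n0. \<forall>E. wf_graph {0..<n} E \<and> \<not> has_complete_minor r {0..<n} E \<longrightarrow>
     spread n E \<le> sqrt (4 * (real r - 2) * (real n - real r + 2) + (real r - 3)^2) \<and>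
     (spread n E = sqrt (4 * (real r - 2) * (real n - real r + 2) + (real r - 3)^2) \<longleftrightarrow>
        graph_iso {0..<n} E {0..<n} (join_clique_indep_edges (r - 2) (n + 2 - r)))"
proof -
  define k where "k = r - 2"
  have k: "k \<ge> 1" "r = k + 2" "real k = real r - 2" using assms unfolding k_def by auto
  obtain n0 where n0: "\<forall>(V :: nat set) a. few_common_nbrs V a (2 ^ (k + 3)) k \<and> n0 \<le> card V \<longrightarrow>
    (\<exists>c. \<forall>x l. (\<forall>i\<in>V. (\<Sum>j\<in>V. a i j * x j) = l * x i) \<and> (\<Sum>i\<in>V. (x i)\<^sup>2) = 1 \<longrightarrow>
      \<bar>l - c\<bar> \<le> sqrt (real k * (real (card V) - k) + (real k - 1)\<^sup>2 / 4) \<and>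
      (\<not> clique_joined V a k \<longrightarrow>
        \<bar>l - c\<bar> < sqrt (real k * (real (card V) - k) + (real k - 1)\<^sup>2 / 4)))"
    using spectrum_centered[OF k(1), of "2 ^ (k + 3)"] by auto
  show ?thesis
  proof (intro exI[of _ "n0 + k + 1"] allI impI, elim conjE)
    fix n E
    assume n: "n0 + k + 1 \<le> n" and wf: "wf_graph {0..<n} E" and nm: "\<not> has_complete_minor r {0..<n} E"
    define \<sigma> where "\<sigma> = sqrt (real k * (real n - k) + (real k - 1)\<^sup>2 / 4)"
    have nk: "k < n" using n by simp
    have \<sigma>2: "\<sigma>\<^sup>2 = real k * (real n - k) + (real k - 1)\<^sup>2 / 4"
      unfolding \<sigma>_def using nk by simp
    have \<sigma>0: "0 \<le> \<sigma>" unfolding \<sigma>_def using nk by simp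
    have bound: "sqrt (4 * (real r - 2) * (real n - real r + 2) + (real r - 3)^2) = 2 * \<sigma>"
    proof -
      have eq: "4 * (real r - 2) * (real n - real r + 2) + (real r - 3)^2 = (2 * \<sigma>)\<^sup>2"
        unfolding power_mult_distrib \<sigma>2 k(2) by (simp add: field_simps)
      show ?thesis unfolding eq real_sqrt_abs using \<sigma>0 by simp
    qed
    have iso: "clique_joined {0..<n} (adj_weight E) k \<longleftrightarrow>
        graph_iso {0..<n} E {0..<n} (join_clique_indep_edges (r - 2) (n + 2 - r))"
    proof -
      have "n + 2 - r = n - k" using k(2) by simp
      then show ?thesis using clique_joined_iff_graph_iso[OF wf] nk unfolding k_def[symmetric] by simp
    qed
    have "few_common_nbrs {0..<n} (adj_weight E) (2 ^ (k + 3)) k"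
      using few_common_nbrs_of_minor_free[OF wf] nm unfolding k(2) by blast
    then obtain c where c: "\<And>x l. (\<forall>i\<in>{0..<n}. (\<Sum>j\<in>{0..<n}. adj_weight E i j * x j) = l * x i) \<Longrightarrow>
        (\<Sum>i\<in>{0..<n}. (x i)\<^sup>2) = 1 \<Longrightarrow> \<bar>l - c\<bar> \<le> \<sigma> \<and>
        (\<not> clique_joined {0..<n} (adj_weight E) k \<longrightarrow> \<bar>l - c\<bar> < \<sigma>)"
      using n0[rule_format, of "{0..<n}" "adj_weight E"] n unfolding \<sigma>_def by auto
    let ?S = "{l. eigenvalue (adj_mat n E) l}"
    have fin: "finite ?S" by (rule finite_eigenvalues)
    have ne: "?S \<noteq> {}" using exists_eigenvalue[of n E] nk by auto
    have near: "\<bar>l - c\<bar> \<le> \<sigma> \<and> (\<not> clique_joined {0..<n} (adj_weight E) k \<longrightarrow> \<bar>l - c\<bar> < \<sigma>)"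
      if "l \<in> ?S" for l
    proof -
      have "eigenvalue (adj_mat n E) l" using that by simp
      then obtain x where "\<forall>i\<in>{0..<n}. (\<Sum>j\<in>{0..<n}. adj_weight E i j * x j) = l * x i"
        "(\<Sum>i\<in>{0..<n}. (x i)\<^sup>2) = 1" by (rule eigenvalue_adj_mat_unit)
      then show ?thesis by (rule c)
    qed
    note nearM = near[OF Max_in[OF fin ne]] and nearm = near[OF Min_in[OF fin ne]]
    have le: "spread n E \<le> 2 * \<sigma>" unfolding spread_def using nearM nearm by linarith
    have lt: "spread n E < 2 * \<sigma>" if "\<not> clique_joined {0..<n} (adj_weight E) k"
      unfolding spread_def using nearM nearm that by linarith
    have ge: "2 * \<sigma> \<le> spread n E" if cj: "clique_joined {0..<n} (adj_weight E) k"
    proof -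
      \<comment> \<open>Completing the square, the roots of the equation in
        \<open>eigenvalue_of_clique_joined\<close> are \<open>(k - 1) / 2 + s\<close> with
        \<open>s\<^sup>2 = \<sigma>\<^sup>2\<close>. The two signs give eigenvalues at distance
        \<open>2 * \<sigma>\<close>.\<close>
      have ev: "(real k - 1) / 2 + s \<in> ?S" if "s\<^sup>2 = \<sigma>\<^sup>2" for s
      proof -
        have "((real k - 1) / 2 + s)\<^sup>2 = (real k - 1)\<^sup>2 / 4 + (real k - 1) * s + s\<^sup>2"
          by (simp add: power2_sum power_divide)
        also have "\<dots> = (real k - 1) * ((real k - 1) / 2 + s) + real k * (real n - real k)"
          unfolding that \<sigma>2 by (simp add: power2_eq_square field_simps)
        finally have "eigenvalue (adj_mat n E) ((real k - 1) / 2 + s)"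
          by (rule eigenvalue_of_clique_joined[OF wf cj k(1) nk])
        then show ?thesis by simp
      qed
      have "(real k - 1) / 2 + \<sigma> \<le> Max ?S" using fin ev[of \<sigma>] by (intro Max_ge) auto
      moreover have "Min ?S \<le> (real k - 1) / 2 + (- \<sigma>)" using fin ev[of "- \<sigma>"] by (intro Min_le) auto
      ultimately show ?thesis unfolding spread_def by linarith
    qed
    have "spread n E = 2 * \<sigma> \<longleftrightarrow> clique_joined {0..<n} (adj_weight E) k"
    proof (cases "clique_joined {0..<n} (adj_weight E) k")
      case True
      then show ?thesis using le ge by (simp add: antisym)
    next
      case False
      then show ?thesis using lt by simp
    qed
    then show "spread n E \<le> sqrt (4 * (real r - 2) * (real n - real r + 2) + (real r - 3)^2) \<and>
      (spread n E = sqrt (4 * (real r - 2) * (real n - real r + 2) + (real r - 3)^2) \<longleftrightarrow>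
        graph_iso {0..<n} E {0..<n} (join_clique_indep_edges (r - 2) (n + 2 - r)))"
      using le unfolding bound iso[symmetric] by (intro conjI)
  qed
qed

end
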